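(* There exists a randomized algorithm that, given an $n$-vertex graph $G=(V,E)$ with a tree decomposition of width $p$ (together with a nonempty set $S\subseteq V$ and an integer $k$), solves the Constrained $CVCP_3$ problem on $(G,S,k)$ in $O(4^{p}\cdot p\,n^{6})$ time. The algorithm cannot give false positives and may give false negatives with probability at most $1/2$.
   Context: Graphs are finite, simple and undirected. A set $F\subseteq V(G)$ is a $VCP_3$ set of $G$ if every path on $3$ vertices in $G$ (as a subgraph, not necessarily induced) contains at least one vertex of $F$; equivalently, $G[V\setminus F]$ has maximum degree at most one. Constrained Connected Vertex Cover $P_3$ (Constrained $CVCP_3$). Input: a graph $G=(V,E)$, a subset $S\subseteq V$ (assumed nonempty) and an integer $k$. Question: does there exist a $VCP_3$ set $F$ of $G$ of size at most $k$ such that $S\subseteq F$ and $G[F]$ is connected? A tree decomposition of $G=(V,E)$ is a pair $(T,\{X_i : i\in I\})$, where $T$ is a rooted tree with node set $I$ and each bag $X_i\subseteq V$, such that $\bigcup_i X_i=V$; every edge $uv\in E$ satisfies $u,v\in X_i$ for some $i$; and whenever $j$ lies on the path from $i$ to $l$ in $T$, $X_i\cap X_l\subseteq X_j$. Its width is $\max_i|X_i|-1$. A false positive is the answer YES on an instance whose correct answer is NO; a false negative is the answer NO on an instance whose correct answer is YES.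
   Formalization: Time counts unit-cost RAM steps (integer +, −, <) and is O(max(4^p·max(1,p)·n^6, N·n)), N being the number of tree nodes: the stated bound is 0 for p=0 and ignores the time to read an arbitrarily long decomposition; it is as stated when p≥1 and N≤n^5. *)

theory Defs
  imports "HOL-Probability.Probability" "Graph_Theory.Graph_Theory"
begin

text \<open>
  A finite simple undirected graph is a \<^const>\<open>pair_graph\<close>: every edge is present as two
  opposite arcs.
\<close>

definition VCP3_set :: "'a pair_pre_digraph \<Rightarrow> 'a set \<Rightarrow> bool" where
  "VCP3_set G F \<longleftrightarrow> F \<subseteq> pverts G \<and> (\<forall>p. vpath p G \<and> length p = 3 \<longrightarrow> set p \<inter> F \<noteq> {})"

definition constrained_CVCP3 :: "'a pair_pre_digraph \<Rightarrow> 'a set \<Rightarrow> int \<Rightarrow> bool" where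
  "constrained_CVCP3 G S k \<longleftrightarrow>
    (\<exists>F. VCP3_set G F \<and> int (card F) \<le> k \<and> S \<subseteq> F \<and>
         Digraph_Component.connected (with_proj G \<restriction> F))"


text \<open>
  A rooted tree on the node set \<open>I\<close> is given by its root and its parent function, the root being
  its own parent by convention. \<open>tree_graph\<close> is the underlying undirected tree.
\<close>

definition rooted_tree :: "'i set \<Rightarrow> 'i \<Rightarrow> ('i \<Rightarrow> 'i) \<Rightarrow> bool" where
  "rooted_tree I r par \<longleftrightarrow>
    finite I \<and> r \<in> I \<and> par r = r \<and> (\<forall>i\<in>I. par i \<in> I \<and> (\<exists>m. (par ^^ m) i = r))"

definition tree_graph :: "'i set \<Rightarrow> 'i \<Rightarrow> ('i \<Rightarrow> 'i) \<Rightarrow> 'i pair_pre_digraph" where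
  "tree_graph I r par =
    \<lparr>pverts = I, parcs = (\<Union>i\<in>I - {r}. {(i, par i), (par i, i)})\<rparr>"

definition tree_decomposition ::
  "'a pair_pre_digraph \<Rightarrow> 'i set \<Rightarrow> 'i \<Rightarrow> ('i \<Rightarrow> 'i) \<Rightarrow> ('i \<Rightarrow> 'a set) \<Rightarrow> bool" where
  "tree_decomposition G I r par X \<longleftrightarrow>
    rooted_tree I r par \<and>
    (\<Union>i\<in>I. X i) = pverts G \<and>
    (\<forall>(u, v)\<in>parcs G. \<exists>i\<in>I. u \<in> X i \<and> v \<in> X i) \<and>
    (\<forall>p j. vpath p (tree_graph I r par) \<and> j \<in> set p \<longrightarrow> X (hd p) \<inter> X (last p) \<subseteq> X j)"

text \<open>The truncated subtraction is harmless: graphs with a vertex have a nonempty bag.\<close>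

definition width :: "'i set \<Rightarrow> ('i \<Rightarrow> 'a set) \<Rightarrow> nat" where
  "width I X = Max ((\<lambda>i. card (X i)) ` I) - 1"


text \<open>
  Algorithms are programs of a uniform-cost random access machine with fair coin tosses, written
  as structured while programs. The memory consists of named integer arrays; a scalar variable is
  cell 0 of an array. The only arithmetic operations are addition and subtraction, so that \<open>t\<close>
  steps create numbers of only \<open>O(t)\<close> more bits than the input numbers. The expressions of a
  program have fixed size, so each step takes a constant number of elementary operations.
\<close>

type_synonym store = "string \<Rightarrow> int \<Rightarrow> int"

datatype aexp =
    Const int
  | Cell string aexp
  | Add aexp aexp
  | Sub aexp aexp

datatype bexp =
    Less aexp aexp
  | Neg bexp
  | Conj bexp bexp

primrec aval :: "aexp \<Rightarrow> store \<Rightarrow> int" where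
  "aval (Const c) s = c"
| "aval (Cell x a) s = s x (aval a s)"
| "aval (Add a b) s = aval a s + aval b s"
| "aval (Sub a b) s = aval a s - aval b s"

primrec bval :: "bexp \<Rightarrow> store \<Rightarrow> bool" where
  "bval (Less a b) s \<longleftrightarrow> aval a s < aval b s"
| "bval (Neg b) s \<longleftrightarrow> \<not> bval b s"
| "bval (Conj b c) s \<longleftrightarrow> bval b s \<and> bval c s"

datatype com =
    Skip
  | Assign string aexp aexp
  | Flip string
  | Then com com
  | IfElse bexp com com
  | While bexp com

definition upd :: "store \<Rightarrow> string \<Rightarrow> int \<Rightarrow> int \<Rightarrow> store" where
  "upd s x i v = s(x := (s x)(i := v))"

text \<open>
  \<open>Assign x a e\<close> stores the value of \<open>e\<close> in cell \<open>a\<close> of the array \<open>x\<close>. A computation has halted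
  when the remaining program is \<open>Skip\<close>.
\<close>

fun step :: "com \<times> store \<Rightarrow> (com \<times> store) pmf" where
  "step (Skip, s) = return_pmf (Skip, s)"
| "step (Assign x a e, s) = return_pmf (Skip, upd s x (aval a s) (aval e s))"
| "step (Flip x, s) = map_pmf (\<lambda>b. (Skip, upd s x 0 (of_bool b))) (bernoulli_pmf (1 / 2))"
| "step (Then c d, s) =
    (if c = Skip then return_pmf (d, s)
     else map_pmf (\<lambda>(c', s'). (Then c' d, s')) (step (c, s)))"
| "step (IfElse b c d, s) = return_pmf (if bval b s then c else d, s)"
| "step (While b c, s) = return_pmf (if bval b s then Then c (While b c) else Skip, s)"

primrec run :: "nat \<Rightarrow> com \<times> store \<Rightarrow> (com \<times> store) pmf" where
  "run 0 cfg = return_pmf cfg"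
| "run (Suc t) cfg = bind_pmf (run t cfg) step"

definition halted :: "com \<times> store \<Rightarrow> bool" where
  "halted cfg \<longleftrightarrow> fst cfg = Skip"

definition answers_yes :: "com \<times> store \<Rightarrow> bool" where
  "answers_yes cfg \<longleftrightarrow> halted cfg \<and> snd cfg ''out'' 0 = 1"

definition answers_no :: "com \<times> store \<Rightarrow> bool" where
  "answers_no cfg \<longleftrightarrow> halted cfg \<and> snd cfg ''out'' 0 = 0"


text \<open>
  The input: a graph on the vertices \<open>0, \<dots>, n - 1\<close> as an adjacency matrix, the set \<open>S\<close> as a 0/1
  vector, the integer \<open>k\<close>, and a tree decomposition with nodes \<open>0, \<dots>, N - 1\<close> as its root, the
  vector of parents and the \<open>N\<close> by \<open>n\<close> 0/1 matrix of the bags. Matrices are stored row by row;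
  all other cells are 0.
\<close>

definition vec :: "nat \<Rightarrow> (nat \<Rightarrow> int) \<Rightarrow> int \<Rightarrow> int" where
  "vec m f i = (if 0 \<le> i \<and> i < int m then f (nat i) else 0)"

definition input_store ::
  "nat \<Rightarrow> nat pair_pre_digraph \<Rightarrow> nat set \<Rightarrow> int \<Rightarrow>
   nat \<Rightarrow> nat \<Rightarrow> (nat \<Rightarrow> nat) \<Rightarrow> (nat \<Rightarrow> nat set) \<Rightarrow> store" where
  "input_store n G S k N r par X = (\<lambda>_ _. 0)
    (''n'' := vec 1 (\<lambda>_. int n),
     ''adj'' := vec (n * n) (\<lambda>i. of_bool ((i div n, i mod n) \<in> parcs G)),
     ''S'' := vec n (\<lambda>v. of_bool (v \<in> S)),
     ''k'' := vec 1 (\<lambda>_. k),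
     ''N'' := vec 1 (\<lambda>_. int N),
     ''root'' := vec 1 (\<lambda>_. int r),
     ''parent'' := vec N (\<lambda>i. int (par i)),
     ''bag'' := vec (N * n) (\<lambda>i. of_bool (i mod n \<in> X (i div n))))"

end

theory Submission
  imports Defs
begin

text \<open>
  The algorithm is a Cut \<open>&\<close> Count dynamic programme. Every vertex of a candidate set \<open>F\<close> lies on one
  of two sides of a cut, with a fixed vertex \<open>v0\<close> of \<open>S\<close> on the first side; since \<open>F\<close> has
  \<open>2^(c - 1)\<close> cuts when it induces \<open>c\<close> components, modulo 2 only connected sets count. A vertex
  outside \<open>F\<close> also has two states, with weights chosen such that they sum to \<open>d^(max 1 m)\<close>, where
  \<open>m\<close> is the number of its neighbours outside \<open>F\<close>. Once the vertices of \<open>F\<close> contribute a factor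
  \<open>d\<close> each, the power of \<open>d\<close> is minimal exactly for \<open>VCP\<^sub>3\<close> sets, so that four states per vertex
  suffice although degrees have to be bounded. Vertices are eliminated in order of decreasing depth
  of their topmost bags, at a cost of at most \<open>4^(p + 1)\<close> table updates each. Random vertex weights
  isolate a solution of minimum size with probability at least 1/2. All formal variables are
  replaced by powers of two so large that the digits of the resulting integer are the wanted
  coefficients.
\<close>

section \<open>The partition function\<close>

text \<open>The factor \<open>n^6\<close> comes from packing a whole generating polynomial into one
  integer. Vertex weights are below \<open>4 * n\<close>, so a set weighs less than
  \<open>M = O(n^2)\<close>; size and weight together stay below \<open>D = O(n^3)\<close>; a digit
  of \<open>b = O(n)\<close> bits holds every number of cuts. Hence \<open>d = 2^(b * D)\<close> has
  \<open>O(n^4)\<close> bits, a local factor is at most \<open>d^(2 * (p + 1))\<close>, and a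
  product over all vertices has \<open>L = O(p * n^5)\<close> bits, with \<open>max 1 p\<close> for
  \<open>p\<close>. The machine only adds, subtracts and compares, so a table update costs
  \<open>O(L)\<close> steps, and there are at most \<open>4^(p + 1)\<close> updates for each of the
  \<open>n\<close> vertices. The obstacle behind the evaluation at a number is the weight
  \<open>d - 1\<close>: as a polynomial it has a negative coefficient, so tables of coefficients
  would have to carry cancellations. At a power of two every factor is a nonnegative integer, which
  bounds all table entries at once. Counts are kept exactly, and parity is taken only in the final
  sum, where the two states of each outside vertex have merged into a power of
  \<open>d\<close>.\<close>

definition conf :: "nat set \<Rightarrow> (nat \<Rightarrow> nat) set" where
  "conf U = {\<sigma>. (\<forall>v\<in>U. \<sigma> v < 4) \<and> (\<forall>v. v \<notin> U \<longrightarrow> \<sigma> v = 0)}"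

lemma conf_empty: "conf {} = {\<lambda>_. 0}"
  by (auto simp: conf_def)

lemma sum_conf_insert:
  fixes f :: "(nat \<Rightarrow> nat) \<Rightarrow> int"
  assumes "c \<notin> U"
  shows "(\<Sum>\<sigma>\<in>conf (insert c U). f \<sigma>) = (\<Sum>\<sigma>\<in>conf U. \<Sum>s<4. f (\<sigma>(c := s)))"
proof -
  have "(\<Sum>\<sigma>\<in>conf U. \<Sum>s<4. f (\<sigma>(c := s))) = (\<Sum>(\<sigma>,s)\<in>conf U \<times> {..<4}. f (\<sigma>(c := s)))"
    by (simp add: sum.cartesian_product)
  also have "\<dots> = (\<Sum>\<sigma>\<in>conf (insert c U). f \<sigma>)"
    by (rule sum.reindex_bij_witness[of _ "\<lambda>\<sigma>. (\<sigma>(c := 0), \<sigma> c)" "\<lambda>(\<sigma>,s). \<sigma>(c := s)"])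
       (use assms in \<open>auto simp: conf_def fun_eq_iff\<close>)
  finally show ?thesis by simp
qed

text \<open>States 0 and 1 are the sides of the cut of \<open>F\<close>, states 2 and 3 lie outside \<open>F\<close>. A vertex outside
  \<open>F\<close> with a neighbour outside \<open>F\<close> must be in state 3; an isolated one contributes
  \<open>(d - 1) + 1 = d\<close> over both states.\<close>

definition agree :: "nat \<Rightarrow> nat \<Rightarrow> bool" where
  "agree s t \<longleftrightarrow> (s < 2) \<noteq> (t < 2) \<or> (s = t \<and> s \<noteq> 2)"

text \<open>For every edge \<open>{c, u}\<close> either \<open>u \<in> K c\<close> or \<open>c \<in> K u\<close>, so each edge outside \<open>F\<close> contributes
  \<open>d^2\<close> at one end, that is \<open>d\<close> for each end.\<close>

definition loc :: "(nat \<Rightarrow> nat \<Rightarrow> bool) \<Rightarrow> (nat \<Rightarrow> nat set) \<Rightarrow> nat set \<Rightarrow> nat \<Rightarrow> int \<Rightarrow> (nat \<Rightarrow> int)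
    \<Rightarrow> nat \<Rightarrow> (nat \<Rightarrow> nat) \<Rightarrow> int" where
  "loc adj K S v0 d x c \<sigma> =
    (if (\<forall>u\<in>K c. adj c u \<longrightarrow> agree (\<sigma> c) (\<sigma> u)) \<and> (\<sigma> c < 2 \<or> c \<notin> S) \<and> \<not> (\<sigma> c = 1 \<and> c = v0)
     then (if \<sigma> c < 2 then x c else if \<sigma> c = 2 then d - 1
           else d ^ (2 * card {u\<in>K c. adj c u \<and> \<sigma> u = 3}))
     else 0)"

text \<open>For symmetric \<open>adj\<close> and \<open>v0 \<in> F\<close> these are the unions of
  connected components of \<open>F\<close> other than the component of \<open>v0\<close>.\<close>

definition cuts :: "(nat \<Rightarrow> nat \<Rightarrow> bool) \<Rightarrow> nat \<Rightarrow> nat set \<Rightarrow> nat set set" where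
  "cuts adj v0 F = {A. A \<subseteq> F \<and> v0 \<notin> A \<and> (\<forall>u\<in>A. \<forall>w\<in>F - A. \<not> adj u w)}"

definition outdeg :: "(nat \<Rightarrow> nat \<Rightarrow> bool) \<Rightarrow> nat set \<Rightarrow> nat set \<Rightarrow> nat \<Rightarrow> nat" where
  "outdeg adj V F v = card {u\<in>V - F. adj v u}"

definition excess :: "(nat \<Rightarrow> nat \<Rightarrow> bool) \<Rightarrow> nat set \<Rightarrow> nat set \<Rightarrow> nat" where
  "excess adj V F = (\<Sum>v\<in>V - F. max 1 (outdeg adj V F v))"

text \<open>\<open>K v\<close> need not consist of neighbours: it will be the part of the topmost
  bag of \<open>v\<close> that precedes \<open>v\<close> in the order. \<open>K_orient\<close> makes
  every edge visible from exactly one end, which allows a product of local factors to test each edge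
  once.\<close>

locale oriented_graph =
  fixes V :: "nat set" and adj :: "nat \<Rightarrow> nat \<Rightarrow> bool" and K :: "nat \<Rightarrow> nat set"
  assumes finite_V: "finite V"
    and adj_sym: "adj u v \<Longrightarrow> adj v u"
    and adj_irrefl: "\<not> adj v v"
    and K_subset: "v \<in> V \<Longrightarrow> K v \<subseteq> V"
    and K_orient: "u \<in> V \<Longrightarrow> v \<in> V \<Longrightarrow> adj u v \<Longrightarrow> (u \<in> K v) \<noteq> (v \<in> K u)"
begin

text \<open>Handshake count: an edge inside \<open>N\<close> is seen from one end only, where it
  counts 2, while on the right it counts 1 at both ends.\<close>

lemma sum_orient:
  assumes "N \<subseteq> V"
  shows "(\<Sum>c\<in>N. 2 * card {u\<in>K c. adj c u \<and> u \<in> N}) = (\<Sum>c\<in>N. card {u\<in>N. adj c u})"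
proof -
  have finN: "finite N" using assms finite_V finite_subset by blast
  have 1: "card {u\<in>N. adj c u} = card {u\<in>N. u \<in> K c \<and> adj c u} + card {u\<in>N. c \<in> K u \<and> adj u c}"
    if c: "c \<in> N" for c
  proof -
    have "{u\<in>N. adj c u} = {u\<in>N. u \<in> K c \<and> adj c u} \<union> {u\<in>N. c \<in> K u \<and> adj u c}"
      using K_orient adj_sym c assms by blast
    moreover have "{u\<in>N. u \<in> K c \<and> adj c u} \<inter> {u\<in>N. c \<in> K u \<and> adj u c} = {}"
      using K_orient adj_sym c assms by blast
    ultimately show ?thesis using finN by (simp add: card_Un_disjoint)
  qed
  have "(\<Sum>c\<in>N. card {u\<in>N. c \<in> K u \<and> adj u c}) = (\<Sum>c\<in>N. \<Sum>u\<in>N. of_bool (c \<in> K u \<and> adj u c))"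
    using finN by (simp add: Int_def)
  also have "\<dots> = (\<Sum>u\<in>N. \<Sum>c\<in>N. of_bool (c \<in> K u \<and> adj u c))"
    by (rule sum.swap)
  also have "\<dots> = (\<Sum>c\<in>N. card {u\<in>N. u \<in> K c \<and> adj c u})"
    using finN by (simp add: Int_def)
  finally have 2: "(\<Sum>c\<in>N. card {u\<in>N. c \<in> K u \<and> adj u c}) = (\<Sum>c\<in>N. card {u\<in>N. u \<in> K c \<and> adj c u})" .
  have 3: "{u\<in>K c. adj c u \<and> u \<in> N} = {u\<in>N. u \<in> K c \<and> adj c u}" for c by auto
  show ?thesis
    by (simp add: 1 2 3 sum.distrib sum_distrib_left[symmetric])
qed

text \<open>A state consists of two bits. \<open>F\<close> is the set with high bit 0;
  \<open>A\<close> collects the low bits and means the second side of the cut on \<open>F\<close>,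
  but state 3 outside \<open>F\<close>. An edge outside \<open>F\<close> forces both ends into
  \<open>A\<close>, so a vertex left in state 2 must have \<open>outdeg\<close> 0.\<close>

lemma prod_loc:
  assumes F: "F \<subseteq> V" and A: "A \<subseteq> V" and v0: "v0 \<in> S" "S \<subseteq> V"
    and \<sigma>: "\<And>v. v \<in> V \<Longrightarrow> \<sigma> v = (if v \<in> F then 0 else 2) + (if v \<in> A then 1 else 0)"
  shows "(\<Prod>c\<in>V. loc adj K S v0 d x c \<sigma>) =
    (if S \<subseteq> F \<and> A \<inter> F \<in> cuts adj v0 F
     then (\<Prod>v\<in>F. x v) * ((\<Prod>v\<in>A - F. d ^ outdeg adj V F v) *
          (\<Prod>v\<in>V - F - A. if outdeg adj V F v = 0 then d - 1 else 0)) else 0)"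
    (is "?lhs = ?rhs")
proof -
  have st: "\<sigma> v < 2 \<longleftrightarrow> v \<in> F" "\<sigma> v = 2 \<longleftrightarrow> v \<notin> F \<and> v \<notin> A" "\<sigma> v = 3 \<longleftrightarrow> v \<notin> F \<and> v \<in> A"
    "\<sigma> v = 1 \<longleftrightarrow> v \<in> F \<and> v \<in> A" if "v \<in> V" for v
    using \<sigma>[OF that] by auto
  have comp: "agree (\<sigma> u) (\<sigma> v) \<longleftrightarrow> ((u \<in> F) \<noteq> (v \<in> F)) \<or> ((u \<in> F) \<and> (v \<in> F) \<and> (u \<in> A \<longleftrightarrow> v \<in> A)) \<or>
      (u \<notin> F \<and> v \<notin> F \<and> u \<in> A \<and> v \<in> A)" if "u \<in> V" "v \<in> V" for u v
    using \<sigma>[OF that(1)] \<sigma>[OF that(2)] by (auto simp: agree_def)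
  have comp_sym: "agree s t \<longleftrightarrow> agree t s" for s t by (auto simp: agree_def)
  define P where "P c \<longleftrightarrow> (\<forall>u\<in>K c. adj c u \<longrightarrow> agree (\<sigma> c) (\<sigma> u)) \<and> (\<sigma> c < 2 \<or> c \<notin> S) \<and> \<not> (\<sigma> c = 1 \<and> c = v0)" for c
  have allP: "(\<forall>c\<in>V. P c) \<longleftrightarrow> S \<subseteq> F \<and> A \<inter> F \<in> cuts adj v0 F \<and> (\<forall>v\<in>V - F - A. outdeg adj V F v = 0)"
  proof -
    \<comment> \<open>A local factor tests an edge only at the end whose \<open>K\<close> contains
      the other end; symmetry of \<open>agree\<close> extends the test to all ordered pairs.\<close>
    have edges: "(\<forall>c\<in>V. \<forall>u\<in>K c. adj c u \<longrightarrow> agree (\<sigma> c) (\<sigma> u)) \<longleftrightarrow> (\<forall>c\<in>V. \<forall>u\<in>V. adj c u \<longrightarrow> agree (\<sigma> c) (\<sigma> u))"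
    proof safe
      fix c u assume *: "\<forall>c\<in>V. \<forall>u\<in>K c. adj c u \<longrightarrow> agree (\<sigma> c) (\<sigma> u)" "c \<in> V" "u \<in> V" "adj c u"
      show "agree (\<sigma> c) (\<sigma> u)"
      proof (cases "u \<in> K c")
        case True
        with * show ?thesis by auto
      next
        case False
        hence "c \<in> K u" using K_orient[of u c] *(2-4) adj_sym[of c u] by auto
        hence "agree (\<sigma> u) (\<sigma> c)" using * adj_sym[of c u] by auto
        thus ?thesis by (simp add: comp_sym[of "\<sigma> c"])
      qed
    next
      fix c u assume "\<forall>c\<in>V. \<forall>u\<in>V. adj c u \<longrightarrow> agree (\<sigma> c) (\<sigma> u)" "c \<in> V" "u \<in> K c" "adj c u"
      thus "agree (\<sigma> c) (\<sigma> u)" using K_subset[of c] by auto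
    qed
    have e2: "(\<forall>c\<in>V. \<forall>u\<in>V. adj c u \<longrightarrow> agree (\<sigma> c) (\<sigma> u)) \<longleftrightarrow>
       (\<forall>c\<in>F. \<forall>u\<in>F. adj c u \<longrightarrow> (c \<in> A \<longleftrightarrow> u \<in> A)) \<and> (\<forall>c\<in>V-F. \<forall>u\<in>V-F. adj c u \<longrightarrow> c \<in> A \<and> u \<in> A)"
    proof -
      have "(\<forall>c\<in>V. \<forall>u\<in>V. adj c u \<longrightarrow> agree (\<sigma> c) (\<sigma> u)) \<longleftrightarrow>
          (\<forall>c\<in>V. \<forall>u\<in>V. adj c u \<longrightarrow> (c \<in> F \<and> u \<in> F \<longrightarrow> (c \<in> A \<longleftrightarrow> u \<in> A)) \<and>
            (c \<notin> F \<and> u \<notin> F \<longrightarrow> c \<in> A \<and> u \<in> A))"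
        by (intro ball_cong refl) (auto simp: comp)
      thus ?thesis using F unfolding subset_eq by (simp only:) blast
    qed
    have e3: "(\<forall>c\<in>V-F. \<forall>u\<in>V-F. adj c u \<longrightarrow> c \<in> A \<and> u \<in> A) \<longleftrightarrow> (\<forall>v\<in>V - F - A. outdeg adj V F v = 0)"
      using finite_V adj_sym by (auto simp: outdeg_def)
    have e4: "(\<forall>c\<in>V. (\<sigma> c < 2 \<or> c \<notin> S) \<and> \<not> (\<sigma> c = 1 \<and> c = v0)) \<longleftrightarrow> S \<subseteq> F \<and> v0 \<notin> A \<inter> F"
      using st v0 F by (auto; blast)
    have e5: "A \<inter> F \<in> cuts adj v0 F \<longleftrightarrow> v0 \<notin> A \<inter> F \<and> (\<forall>c\<in>F. \<forall>u\<in>F. adj c u \<longrightarrow> (c \<in> A \<longleftrightarrow> u \<in> A))"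
      using adj_sym by (auto simp: cuts_def)
    have "(\<forall>c\<in>V. P c) \<longleftrightarrow> (\<forall>c\<in>V. \<forall>u\<in>K c. adj c u \<longrightarrow> agree (\<sigma> c) (\<sigma> u)) \<and>
        (\<forall>c\<in>V. (\<sigma> c < 2 \<or> c \<notin> S) \<and> \<not> (\<sigma> c = 1 \<and> c = v0))"
      unfolding P_def ball_conj_distrib ..
    thus ?thesis unfolding edges e2 e3 e4 e5 by argo
  qed
  show ?thesis
  proof (cases "\<forall>c\<in>V. P c")
    case False
    then obtain c where c: "c \<in> V" "\<not> P c" by blast
    have "loc adj K S v0 d x c \<sigma> = 0" unfolding loc_def using c(2)[unfolded P_def] by (rule if_not_P)
    hence l0: "?lhs = 0" using c(1) finite_V by (meson prod_zero)
    have "?rhs = 0"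
    proof (cases "S \<subseteq> F \<and> A \<inter> F \<in> cuts adj v0 F")
      case True
      then obtain v where v: "v \<in> V - F - A" "outdeg adj V F v \<noteq> 0" using False unfolding allP by auto
      have "(\<Prod>v\<in>V - F - A. if outdeg adj V F v = 0 then d - 1 else 0) = 0"
        using v finite_V by (intro prod_zero bexI[of _ v]) auto
      then show ?thesis by simp
    qed auto
    with l0 show ?thesis by simp
  next
    case True
    have l: "?lhs = (\<Prod>c\<in>V. (if \<sigma> c < 2 then x c else if \<sigma> c = 2 then d - 1
           else d ^ (2 * card {u\<in>K c. adj c u \<and> \<sigma> u = 3})))"
    proof (intro prod.cong refl)
      fix c assume "c \<in> V"
      hence "P c" using True by blast
      thus "loc adj K S v0 d x c \<sigma> = (if \<sigma> c < 2 then x c else if \<sigma> c = 2 then d - 1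
           else d ^ (2 * card {u\<in>K c. adj c u \<and> \<sigma> u = 3}))"
        unfolding loc_def P_def by (rule if_P)
    qed
    have V: "V = F \<union> ((A - F) \<union> (V - F - A))" using F A by blast
    have fin: "finite F" "finite A" using F A finite_V finite_subset by blast+
    have "?lhs = (\<Prod>v\<in>F. x v) * ((\<Prod>c\<in>A - F. d ^ (2 * card {u\<in>K c. adj c u \<and> \<sigma> u = 3})) * (\<Prod>v\<in>V-F-A. d - 1))"
    proof -
      let ?f = "\<lambda>c. if \<sigma> c < 2 then x c else if \<sigma> c = 2 then d - 1
           else d ^ (2 * card {u\<in>K c. adj c u \<and> \<sigma> u = 3})"
      have "?lhs = prod ?f (F \<union> ((A - F) \<union> (V - F - A)))" unfolding l using V by simp
      also have "\<dots> = prod ?f F * (prod ?f (A - F) * prod ?f (V - F - A))"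
      proof -
        have "prod ?f ((A - F) \<union> (V - F - A)) = prod ?f (A - F) * prod ?f (V - F - A)"
          by (rule prod.union_disjoint) (use fin finite_V in auto)
        moreover have "prod ?f (F \<union> ((A - F) \<union> (V - F - A))) = prod ?f F * prod ?f ((A - F) \<union> (V - F - A))"
          by (rule prod.union_disjoint) (use fin finite_V in auto)
        ultimately show ?thesis by simp
      qed
      also have "prod ?f F = (\<Prod>v\<in>F. x v)" using st F by (intro prod.cong) auto
      also have "prod ?f (A - F) = (\<Prod>c\<in>A - F. d ^ (2 * card {u\<in>K c. adj c u \<and> \<sigma> u = 3}))"
        using st A by (intro prod.cong) auto
      also have "prod ?f (V - F - A) = (\<Prod>v\<in>V-F-A. d - 1)" using st by (intro prod.cong) auto
      finally show ?thesis .
    qed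
    moreover have "(\<Prod>v\<in>V-F-A. d - 1) = (\<Prod>v\<in>V - F - A. if outdeg adj V F v = 0 then d - 1 else 0)"
    proof (intro prod.cong refl)
      fix v assume "v \<in> V - F - A"
      hence "outdeg adj V F v = 0" using True unfolding allP by blast
      thus "d - 1 = (if outdeg adj V F v = 0 then d - 1 else 0)" by simp
    qed
    moreover have "(\<Prod>c\<in>A - F. d ^ (2 * card {u\<in>K c. adj c u \<and> \<sigma> u = 3})) = (\<Prod>v\<in>A - F. d ^ outdeg adj V F v)"
    proof -
      have a: "card {u\<in>K c. adj c u \<and> \<sigma> u = 3} = card {u\<in>K c. adj c u \<and> u \<in> A - F}" if "c \<in> A - F" for c
      proof -
        have "\<sigma> u = 3 \<longleftrightarrow> u \<in> A - F" if "u \<in> K c" for u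
          using st(3)[of u] K_subset[of c] that \<open>c \<in> A - F\<close> A by auto
        hence "{u\<in>K c. adj c u \<and> \<sigma> u = 3} = {u\<in>K c. adj c u \<and> u \<in> A - F}" by auto
        thus ?thesis by simp
      qed
      \<comment> \<open>A vertex in state 2 has no neighbour outside \<open>F\<close>, so
        \<open>outdeg\<close> counts only vertices in state 3.\<close>
      have b: "outdeg adj V F c = card {u\<in>A - F. adj c u}" if "c \<in> A - F" for c
      proof -
        have "\<forall>v\<in>V - F - A. {u \<in> V - F. adj v u} = {}" using True finite_V unfolding allP by (simp add: outdeg_def)
        hence "u \<in> A" if "u \<in> V - F" "adj c u" for u using that adj_sym[of c u] \<open>c \<in> A - F\<close> A by auto
        hence "{u\<in>V - F. adj c u} = {u\<in>A - F. adj c u}" using A by auto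
        thus ?thesis by (simp add: outdeg_def)
      qed
      have "A - F \<subseteq> V" using A by blast
      from sum_orient[OF this]
      have "(\<Sum>c\<in>A - F. 2 * card {u\<in>K c. adj c u \<and> \<sigma> u = 3}) = (\<Sum>c\<in>A - F. outdeg adj V F c)"
        by (simp only: a b cong: sum.cong)
      thus ?thesis by (simp only: power_sum[symmetric])
    qed
    moreover have "S \<subseteq> F \<and> A \<inter> F \<in> cuts adj v0 F" using True unfolding allP by (elim conjE) (intro conjI)
    ultimately show ?thesis by (simp only: if_True simp_thms)
  qed
qed

text \<open>Expansion of the right-hand product: \<open>A\<close> is the set of factors that
  contribute \<open>f\<close>.\<close>

lemma prod_plus_Pow:
  fixes f g :: "nat \<Rightarrow> int"
  assumes "finite N"
  shows "(\<Sum>A\<in>Pow N. (\<Prod>v\<in>A. f v) * (\<Prod>v\<in>N - A. g v)) = (\<Prod>v\<in>N. f v + g v)"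
  using assms
proof (induction N rule: finite_induct)
  case (insert c N)
  have inj: "inj_on (insert c) (Pow N)" using insert.hyps by (auto simp: inj_on_def)
  have dis: "Pow N \<inter> insert c ` Pow N = {}" using insert.hyps by auto
  have 1: "(\<Sum>A\<in>Pow N. (\<Prod>v\<in>insert c A. f v) * (\<Prod>v\<in>insert c N - insert c A. g v))
      = f c * (\<Sum>A\<in>Pow N. (\<Prod>v\<in>A. f v) * (\<Prod>v\<in>N - A. g v))"
    unfolding sum_distrib_left
  proof (rule sum.cong)
    fix A assume A: "A \<in> Pow N"
    have "c \<notin> A" "finite A" using A insert.hyps finite_subset by auto
    moreover have "insert c N - insert c A = N - A" using A insert.hyps by auto
    ultimately show "(\<Prod>v\<in>insert c A. f v) * (\<Prod>v\<in>insert c N - insert c A. g v) = f c * ((\<Prod>v\<in>A. f v) * (\<Prod>v\<in>N - A. g v))"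
      by simp
  qed simp
  have 2: "(\<Sum>A\<in>Pow N. (\<Prod>v\<in>A. f v) * (\<Prod>v\<in>insert c N - A. g v))
      = g c * (\<Sum>A\<in>Pow N. (\<Prod>v\<in>A. f v) * (\<Prod>v\<in>N - A. g v))"
    unfolding sum_distrib_left
  proof (rule sum.cong)
    fix A assume A: "A \<in> Pow N"
    hence "insert c N - A = insert c (N - A)" using insert.hyps by auto
    moreover have "c \<notin> N - A" using insert.hyps by auto
    ultimately show "(\<Prod>v\<in>A. f v) * (\<Prod>v\<in>insert c N - A. g v) = g c * ((\<Prod>v\<in>A. f v) * (\<Prod>v\<in>N - A. g v))"
      using insert.hyps by simp
  qed simp
  have "(\<Sum>A\<in>Pow (insert c N). (\<Prod>v\<in>A. f v) * (\<Prod>v\<in>insert c N - A. g v)) =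
     (\<Sum>A\<in>Pow N. (\<Prod>v\<in>A. f v) * (\<Prod>v\<in>insert c N - A. g v)) +
     (\<Sum>A\<in>Pow N. (\<Prod>v\<in>insert c A. f v) * (\<Prod>v\<in>insert c N - insert c A. g v))"
    using insert.hyps dis by (simp add: Pow_insert sum.union_disjoint sum.reindex[OF inj])
  also have "\<dots> = (f c + g c) * (\<Prod>v\<in>N. f v + g v)"
    unfolding 1 2 insert.IH by (simp add: algebra_simps)
  finally show ?case using insert.hyps by simp
qed simp

text \<open>For a fixed \<open>F\<close> the low bits inside and outside \<open>F\<close> are
  independent. Summing over the inside counts the cuts; summing over the outside factorises into one
  sum per vertex.\<close>

theorem partition_function:
  assumes v0: "v0 \<in> S" "S \<subseteq> V"
  shows "(\<Sum>\<sigma>\<in>conf V. \<Prod>c\<in>V. loc adj K S v0 d x c \<sigma>) =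
    (\<Sum>F | S \<subseteq> F \<and> F \<subseteq> V. int (card (cuts adj v0 F)) * ((\<Prod>v\<in>F. x v) * d ^ excess adj V F))"
proof -
  define st :: "nat set \<times> nat set \<Rightarrow> nat \<Rightarrow> nat" where
    "st = (\<lambda>(F, A) v. if v \<in> V then (if v \<in> F then 0 else 2) + (if v \<in> A then 1 else 0) else 0)"
  define g where "g F v = (if outdeg adj V F v = 0 then d - 1 else 0)" for F v
  define T where "T F A = (if S \<subseteq> F \<and> A \<inter> F \<in> cuts adj v0 F
     then (\<Prod>v\<in>F. x v) * ((\<Prod>v\<in>A - F. d ^ outdeg adj V F v) * (\<Prod>v\<in>V - F - A. g F v)) else 0)" for F A
  have "(\<Sum>\<sigma>\<in>conf V. \<Prod>c\<in>V. loc adj K S v0 d x c \<sigma>) =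
      (\<Sum>FA\<in>Pow V \<times> Pow V. \<Prod>c\<in>V. loc adj K S v0 d x c (st FA))"
  proof (rule sum.reindex_bij_witness[of _ st "\<lambda>\<sigma>. ({v\<in>V. \<sigma> v < 2}, {v\<in>V. odd (\<sigma> v)})"])
    fix \<sigma> assume "\<sigma> \<in> conf V"
    hence *: "\<sigma> v < 4" "v \<notin> V \<Longrightarrow> \<sigma> v = 0" for v by (cases "v \<in> V"; auto simp: conf_def)+
    show "st ({v\<in>V. \<sigma> v < 2}, {v\<in>V. odd (\<sigma> v)}) = \<sigma>"
    proof
      fix v
      have "\<sigma> v = 0 \<or> \<sigma> v = 1 \<or> \<sigma> v = 2 \<or> \<sigma> v = 3" using *(1)[of v] by linarith
      then show "st ({v\<in>V. \<sigma> v < 2}, {v\<in>V. odd (\<sigma> v)}) v = \<sigma> v"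
        using *(2)[of v] by (auto simp: st_def)
    qed
    then show "(\<Prod>c\<in>V. loc adj K S v0 d x c (st ({v\<in>V. \<sigma> v < 2}, {v\<in>V. odd (\<sigma> v)}))) = (\<Prod>c\<in>V. loc adj K S v0 d x c \<sigma>)"
      by simp
  qed (auto simp: st_def conf_def split: if_splits)
  also have "\<dots> = (\<Sum>FA\<in>Pow V \<times> Pow V. T (fst FA) (snd FA))"
  proof (rule sum.cong[OF refl])
    fix FA assume "FA \<in> Pow V \<times> Pow V"
    hence FA: "fst FA \<subseteq> V" "snd FA \<subseteq> V" by auto
    show "(\<Prod>c\<in>V. loc adj K S v0 d x c (st FA)) = T (fst FA) (snd FA)"
      unfolding T_def g_def
      by (rule prod_loc[OF FA v0]) (simp add: st_def split_def)
  qed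
  also have "\<dots> = (\<Sum>F\<in>Pow V. \<Sum>A\<in>Pow V. T F A)"
    by (simp add: sum.cartesian_product split_def)
  also have "\<dots> = (\<Sum>F\<in>Pow V. if S \<subseteq> F then int (card (cuts adj v0 F)) * ((\<Prod>v\<in>F. x v) * d ^ excess adj V F) else 0)"
  proof (rule sum.cong[OF refl])
    fix F assume "F \<in> Pow V"
    hence F: "F \<subseteq> V" by simp
    have finF: "finite F" "finite (V - F)" using F finite_V finite_subset by auto
    show "(\<Sum>A\<in>Pow V. T F A) = (if S \<subseteq> F then int (card (cuts adj v0 F)) * ((\<Prod>v\<in>F. x v) * d ^ excess adj V F) else 0)"
    proof (cases "S \<subseteq> F")
      case True
      have "(\<Sum>A\<in>Pow V. T F A) = (\<Sum>A\<in>Pow F \<times> Pow (V - F). T F (fst A \<union> snd A))"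
        by (rule sum.reindex_bij_witness[of _ "\<lambda>A. fst A \<union> snd A" "\<lambda>A. (A \<inter> F, A - F)"]) (use F in \<open>auto simp: Int_Diff_Un\<close>)
      also have "\<dots> = (\<Sum>A\<in>Pow F \<times> Pow (V - F). (if fst A \<in> cuts adj v0 F then 1 else 0) * (\<Prod>v\<in>F. x v) *
          ((\<Prod>v\<in>snd A. d ^ outdeg adj V F v) * (\<Prod>v\<in>V - F - snd A. g F v)))"
      proof (rule sum.cong[OF refl])
        fix A assume "A \<in> Pow F \<times> Pow (V - F)"
        hence "(fst A \<union> snd A) \<inter> F = fst A" "(fst A \<union> snd A) - F = snd A"
          "V - F - (fst A \<union> snd A) = V - F - snd A" by auto
        then show "T F (fst A \<union> snd A) = (if fst A \<in> cuts adj v0 F then 1 else 0) * (\<Prod>v\<in>F. x v) *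
          ((\<Prod>v\<in>snd A. d ^ outdeg adj V F v) * (\<Prod>v\<in>V - F - snd A. g F v))"
          using True by (simp add: T_def)
      qed
      also have "\<dots> = (\<Sum>A1\<in>Pow F. (if A1 \<in> cuts adj v0 F then 1 else 0) * (\<Prod>v\<in>F. x v)) *
          (\<Sum>A2\<in>Pow (V - F). (\<Prod>v\<in>A2. d ^ outdeg adj V F v) * (\<Prod>v\<in>V - F - A2. g F v))"
        by (simp add: sum_product sum.cartesian_product split_def)
      also have "(\<Sum>A2\<in>Pow (V - F). (\<Prod>v\<in>A2. d ^ outdeg adj V F v) * (\<Prod>v\<in>V - F - A2. g F v)) =
          (\<Prod>v\<in>V - F. d ^ outdeg adj V F v + g F v)"
        by (rule prod_plus_Pow[OF finF(2)])
      \<comment> \<open>For \<open>outdeg\<close> 0 the summands are 1 and \<open>d - 1\<close>;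
        otherwise only the power of \<open>d\<close> remains.\<close>
      also have "\<dots> = (\<Prod>v\<in>V - F. d ^ max 1 (outdeg adj V F v))"
        by (rule prod.cong) (auto simp: g_def max_def Suc_le_eq)
      also have "\<dots> = d ^ excess adj V F" by (simp add: excess_def power_sum)
      also have "(\<Sum>A1\<in>Pow F. (if A1 \<in> cuts adj v0 F then 1 else 0) * (\<Prod>v\<in>F. x v)) =
          (\<Sum>A1\<in>Pow F. (if A1 \<in> cuts adj v0 F then 1 else 0)) * (\<Prod>v\<in>F. x v)"
        by (simp add: sum_distrib_right)
      also have "(\<Sum>A1\<in>Pow F. (if A1 \<in> cuts adj v0 F then 1 else 0)) = int (card (cuts adj v0 F))"
      proof -
        have "{A \<in> Pow F. A \<in> cuts adj v0 F} = cuts adj v0 F" by (auto simp: cuts_def)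
        moreover have "(\<Sum>A1\<in>Pow F. (if A1 \<in> cuts adj v0 F then 1 else 0)) = (\<Sum>A1\<in>{A \<in> Pow F. A \<in> cuts adj v0 F}. 1::int)"
          by (rule sum.inter_filter[symmetric]) (use finF in simp)
        ultimately show ?thesis by simp
      qed
      finally show ?thesis using True by (simp add: mult.assoc)
    qed (simp add: T_def)
  qed
  also have "\<dots> = (\<Sum>F | S \<subseteq> F \<and> F \<subseteq> V. int (card (cuts adj v0 F)) * ((\<Prod>v\<in>F. x v) * d ^ excess adj V F))"
  proof -
    have "{F \<in> Pow V. S \<subseteq> F} = {F. S \<subseteq> F \<and> F \<subseteq> V}" by auto
    moreover have "finite (Pow V)" using finite_V by simp
    ultimately show ?thesis
      using sum.inter_filter[of "Pow V" "\<lambda>F. int (card (cuts adj v0 F)) * ((\<Prod>v\<in>F. x v) * d ^ excess adj V F)" "\<lambda>F. S \<subseteq> F"]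
      by (simp only:)
  qed
  finally show ?thesis .
qed

end

section \<open>Connectivity by parity, and solutions as binary digits\<close>

definition connected_in :: "(nat \<Rightarrow> nat \<Rightarrow> bool) \<Rightarrow> nat set \<Rightarrow> bool" where
  "connected_in adj F \<longleftrightarrow> (\<forall>u\<in>F. \<forall>v\<in>F. (u, v) \<in> {(a, b). a \<in> F \<and> b \<in> F \<and> adj a b}\<^sup>*)"

definition solutions :: "(nat \<Rightarrow> nat \<Rightarrow> bool) \<Rightarrow> nat set \<Rightarrow> nat set \<Rightarrow> nat set set" where
  "solutions adj V S = {F. S \<subseteq> F \<and> F \<subseteq> V \<and> (\<forall>v\<in>V - F. outdeg adj V F v \<le> 1) \<and> connected_in adj F}"

lemma excess_eq:
  assumes "finite V"
  shows "excess adj V F = card (V - F) + (\<Sum>v\<in>V - F. outdeg adj V F v - 1)"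
proof -
  have "excess adj V F = (\<Sum>v\<in>V - F. 1 + (outdeg adj V F v - 1))"
    unfolding excess_def by (rule sum.cong) auto
  thus ?thesis by (simp only: sum.distrib) simp
qed

text \<open>A vertex of \<open>F\<close> contributes 1, and a vertex outside contributes 1 plus the
  truncated surplus \<open>outdeg - 1\<close>; equality means that no surplus occurs.\<close>

lemma excess_eq_iff:
  assumes "finite V" "F \<subseteq> V"
  shows "card F + excess adj V F \<ge> card V"
    and "card F + excess adj V F = card V \<longleftrightarrow> (\<forall>v\<in>V - F. outdeg adj V F v \<le> 1)"
proof -
  have "card V = card F + card (V - F)"
    using assms by (metis card_Diff_subset card_mono finite_subset le_add_diff_inverse)
  moreover have "(\<Sum>v\<in>V - F. outdeg adj V F v - 1) = 0 \<longleftrightarrow> (\<forall>v\<in>V - F. outdeg adj V F v \<le> 1)"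
    using assms by auto
  ultimately show "card F + excess adj V F \<ge> card V"
    "card F + excess adj V F = card V \<longleftrightarrow> (\<forall>v\<in>V - F. outdeg adj V F v \<le> 1)"
    using excess_eq[OF assms(1)] by auto
qed

text \<open>If \<open>F\<close> is connected, a cut avoiding \<open>v0\<close> is empty. Otherwise
  let \<open>C\<close> be the part not reachable from \<open>v0\<close>: it is closed under
  adjacency within \<open>F\<close>, and symmetric difference with \<open>C\<close> is an involution
  on the cuts. It changes the membership of each \<open>w \<in> C\<close>, so it has no fixed point
  and the number of cuts is even.\<close>

lemma odd_card_cuts_iff:
  assumes sym: "\<And>u v. adj u v \<Longrightarrow> adj v u" and F: "finite F" and v0: "v0 \<in> F"
  shows "odd (card (cuts adj v0 F)) \<longleftrightarrow> connected_in adj F"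
proof -
  define R where "R = {(a, b). a \<in> F \<and> b \<in> F \<and> adj a b}"
  have symR: "sym (R\<^sup>*)" by (intro sym_rtrancl symI) (use sym in \<open>unfold R_def, blast\<close>)
  show ?thesis
  proof (cases "connected_in adj F")
    case True
    have "A = {}" if A: "A \<in> cuts adj v0 F" for A
    proof (rule ccontr)
      assume "A \<noteq> {}"
      then obtain u where u: "u \<in> A" by blast
      have "(v0, u) \<in> R\<^sup>*" using True u A v0 by (auto simp: connected_in_def R_def cuts_def)
      hence "u \<notin> A"
      proof (induction rule: rtrancl_induct)
        case base
        then show ?case using A by (simp add: cuts_def)
      next
        case (step y z)
        then show ?case using A sym[of y z] by (auto simp: cuts_def R_def)
      qed
      with u show False by simp
    qed
    moreover have "{} \<in> cuts adj v0 F" by (simp add: cuts_def)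
    ultimately have "cuts adj v0 F = {{}}" by blast
    with True show ?thesis by simp
  next
    case False
    define C where "C = {u\<in>F. (v0, u) \<notin> R\<^sup>*}"
    have "\<exists>w. w \<in> C"
    proof (rule ccontr)
      assume "\<nexists>w. w \<in> C"
      hence r: "(v0, u) \<in> R\<^sup>*" if "u \<in> F" for u using that by (auto simp: C_def)
      have "(u, v) \<in> R\<^sup>*" if "u \<in> F" "v \<in> F" for u v
        using r[OF that(1)] r[OF that(2)] symR by (meson rtrancl_trans symD)
      thus False using False by (auto simp: connected_in_def R_def)
    qed
    then obtain w where w: "w \<in> C" ..
    have closed: "u \<in> C \<longleftrightarrow> v \<in> C" if "u \<in> F" "v \<in> F" "adj u v" for u v
    proof -
      have "(u, v) \<in> R" "(v, u) \<in> R" using that sym[of u v] by (auto simp: R_def)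
      thus ?thesis using that rtrancl.rtrancl_into_rtrancl[of v0 u R v] rtrancl.rtrancl_into_rtrancl[of v0 v R u]
        by (auto simp: C_def)
    qed
    define flip where "flip A = (A - C) \<union> (C - A)" for A
    have flip: "flip A \<in> cuts adj v0 F" if "A \<in> cuts adj v0 F" for A
    proof -
      have "v0 \<notin> C" by (simp add: C_def)
      moreover have "C \<subseteq> F" by (auto simp: C_def)
      moreover have "\<not> adj u x" if "u \<in> flip A" "x \<in> F - flip A" for u x
      proof
        assume "adj u x"
        moreover have "u \<in> F" using that \<open>A \<in> cuts adj v0 F\<close> \<open>C \<subseteq> F\<close> by (auto simp: flip_def cuts_def)
        ultimately have "u \<in> C \<longleftrightarrow> x \<in> C" using closed[of u x] that by auto
        hence "(u \<in> A \<and> x \<notin> A) \<or> (x \<in> A \<and> u \<notin> A)" using that by (auto simp: flip_def)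
        thus False using \<open>A \<in> cuts adj v0 F\<close> \<open>adj u x\<close> sym[OF \<open>adj u x\<close>] \<open>u \<in> F\<close> that by (auto simp: cuts_def)
      qed
      ultimately show ?thesis using that by (auto simp: cuts_def flip_def)
    qed
    have flipflip: "flip (flip A) = A" for A by (auto simp: flip_def)
    have wflip: "w \<in> flip A \<longleftrightarrow> w \<notin> A" for A using w by (auto simp: flip_def)
    have "bij_betw flip {A \<in> cuts adj v0 F. w \<in> A} {A \<in> cuts adj v0 F. w \<notin> A}"
      by (rule bij_betw_byWitness[of _ flip]) (use flip flipflip wflip in auto)
    hence "card {A \<in> cuts adj v0 F. w \<in> A} = card {A \<in> cuts adj v0 F. w \<notin> A}"
      by (rule bij_betw_same_card)
    moreover have "card (cuts adj v0 F) = card {A \<in> cuts adj v0 F. w \<in> A} + card {A \<in> cuts adj v0 F. w \<notin> A}"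
    proof -
      have "finite (cuts adj v0 F)" using F by (auto simp: cuts_def intro: finite_subset[of _ "Pow F"])
      hence "card ({A \<in> cuts adj v0 F. w \<in> A} \<union> {A \<in> cuts adj v0 F. w \<notin> A}) =
          card {A \<in> cuts adj v0 F. w \<in> A} + card {A \<in> cuts adj v0 F. w \<notin> A}"
        by (intro card_Un_disjoint) auto
      moreover have "{A \<in> cuts adj v0 F. w \<in> A} \<union> {A \<in> cuts adj v0 F. w \<notin> A} = cuts adj v0 F" by auto
      ultimately show ?thesis by simp
    qed
    ultimately show ?thesis using False by simp
  qed
qed

text \<open>Kronecker substitution. The sum of all coefficients, not only of those with equal
  exponent, is required to be below \<open>B\<close>; this rules out carries and also bounds what
  lies below position \<open>y\<close>.\<close>

lemma digit_of_sum:
  fixes c e :: "'a \<Rightarrow> nat"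
  assumes I: "finite I" and B: "(\<Sum>i\<in>I. c i) < B"
  shows "(\<Sum>i\<in>I. c i * B ^ e i) div B ^ y mod B = (\<Sum>i | i \<in> I \<and> e i = y. c i)"
proof -
  define L where "L = (\<Sum>i | i \<in> I \<and> e i < y. c i * B ^ e i)"
  define a where "a = (\<Sum>i | i \<in> I \<and> e i = y. c i)"
  define H where "H = (\<Sum>i | i \<in> I \<and> e i > y. c i * B ^ (e i - Suc y))"
  have B0: "B > 0" using B by simp
  \<comment> \<open>For \<open>y > 0\<close> all lower terms together are at most
    \<open>(B - 1) * B^(y - 1)\<close>.\<close>
  have L: "L < B ^ y"
  proof (cases "y = 0")
    case False
    have "L \<le> (\<Sum>i | i \<in> I \<and> e i < y. c i * B ^ (y - 1))"
      unfolding L_def using B0 by (intro sum_mono mult_left_mono power_increasing) auto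
    also have "\<dots> \<le> (\<Sum>i\<in>I. c i * B ^ (y - 1))" using I by (intro sum_mono2) auto
    also have "\<dots> = (\<Sum>i\<in>I. c i) * B ^ (y - 1)" by (simp add: sum_distrib_right)
    also have "\<dots> < B * B ^ (y - 1)" using B B0 by (intro mult_strict_right_mono) auto
    also have "\<dots> = B ^ y" using False by (cases y) auto
    finally show ?thesis .
  qed (simp add: L_def)
  have "a \<le> (\<Sum>i\<in>I. c i)" unfolding a_def using I by (intro sum_mono2) auto
  hence a: "a < B" using B by simp
  have "I = {i. i \<in> I \<and> e i < y} \<union> ({i. i \<in> I \<and> e i = y} \<union> {i. i \<in> I \<and> e i > y})" by auto
  hence "(\<Sum>i\<in>I. c i * B ^ e i) = (\<Sum>i\<in>{i. i \<in> I \<and> e i < y} \<union> ({i. i \<in> I \<and> e i = y} \<union> {i. i \<in> I \<and> e i > y}). c i * B ^ e i)"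
    by simp
  also have "\<dots> = L + ((\<Sum>i | i \<in> I \<and> e i = y. c i * B ^ e i) + (\<Sum>i | i \<in> I \<and> e i > y. c i * B ^ e i))"
  proof -
    have "(\<Sum>i\<in>{i. i \<in> I \<and> e i = y} \<union> {i. i \<in> I \<and> e i > y}. c i * B ^ e i) =
        (\<Sum>i | i \<in> I \<and> e i = y. c i * B ^ e i) + (\<Sum>i | i \<in> I \<and> e i > y. c i * B ^ e i)"
      by (rule sum.union_disjoint) (use I in auto)
    moreover have "(\<Sum>i\<in>{i. i \<in> I \<and> e i < y} \<union> ({i. i \<in> I \<and> e i = y} \<union> {i. i \<in> I \<and> e i > y}). c i * B ^ e i)
        = L + (\<Sum>i\<in>{i. i \<in> I \<and> e i = y} \<union> {i. i \<in> I \<and> e i > y}. c i * B ^ e i)"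
      unfolding L_def by (rule sum.union_disjoint) (use I in auto)
    ultimately show ?thesis by simp
  qed
  also have "(\<Sum>i | i \<in> I \<and> e i = y. c i * B ^ e i) = a * B ^ y"
    by (simp add: a_def sum_distrib_right)
  also have "(\<Sum>i | i \<in> I \<and> e i > y. c i * B ^ e i) = H * B * B ^ y"
  proof -
    have "c i * B ^ e i = c i * B ^ (e i - Suc y) * B * B ^ y" if "e i > y" for i
    proof -
      have "B ^ e i = B ^ ((e i - Suc y) + Suc y)" using that by simp
      thus ?thesis by (simp add: power_add)
    qed
    thus ?thesis unfolding H_def sum_distrib_right by (intro sum.cong) auto
  qed
  finally have "(\<Sum>i\<in>I. c i * B ^ e i) = L + (a + H * B) * B ^ y" by (simp add: algebra_simps)
  hence "(\<Sum>i\<in>I. c i * B ^ e i) div B ^ y = a + H * B" using L B0 by simp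
  thus ?thesis using a by (simp add: a_def)
qed

lemma card_cuts_le:
  assumes "finite V" "F \<subseteq> V"
  shows "card (cuts adj v0 F) \<le> 2 ^ card V"
proof -
  have "card (cuts adj v0 F) \<le> card (Pow V)"
    using assms by (intro card_mono) (auto simp: cuts_def)
  thus ?thesis using assms by (simp add: card_Pow)
qed

lemma odd_sum_iff_card:
  assumes "finite A"
  shows "odd (\<Sum>x\<in>A. f x :: nat) \<longleftrightarrow> odd (card {x\<in>A. odd (f x)})"
  using assms
proof (induction A rule: finite_induct)
  case (insert x A)
  have "{y \<in> insert x A. odd (f y)} = (if odd (f x) then insert x {y\<in>A. odd (f y)} else {y\<in>A. odd (f y)})" by auto
  with insert show ?case by auto
qed simp

text \<open>The power of \<open>d\<close> together with the \<open>D\<close> in the weights of the vertices of \<open>F\<close> has an exponent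
  \<open>card F + excess adj V F\<close>, which is at least \<open>card V\<close> with equality exactly for \<open>VCP\<^sub>3\<close> sets. The base
  \<open>2^b\<close> exceeds the sum of all numbers of cuts, so that there are no carries.\<close>

theorem solution_digit:
  assumes V: "finite V" and S: "v0 \<in> S" "S \<subseteq> V"
    and sym: "\<And>u v. adj u v \<Longrightarrow> adj v u"
    and b: "b = 2 * card V + 1" and D: "M * (card V + 1) \<le> D"
    and M: "\<And>F. F \<subseteq> V \<Longrightarrow> (\<Sum>v\<in>F. \<omega> v) < M" and w: "w < D"
    and Z: "Z = (\<Sum>F | S \<subseteq> F \<and> F \<subseteq> V. int (card (cuts adj v0 F)) *
       ((\<Prod>v\<in>F. 2 ^ (b * (D + M + \<omega> v))) * (2 ^ (b * D)) ^ excess adj V F))"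
  shows "odd (Z div 2 ^ (b * (D * card V + w))) \<longleftrightarrow>
    odd (card {F \<in> solutions adj V S. M * card F + (\<Sum>v\<in>F. \<omega> v) = w})"
proof -
  define I where "I = {F. S \<subseteq> F \<and> F \<subseteq> V}"
  define c where "c F = card (cuts adj v0 F)" for F
  define e where "e F = D * (card F + excess adj V F) + (M * card F + (\<Sum>v\<in>F. \<omega> v))" for F
  define B :: nat where "B = 2 ^ b"
  have I: "finite I" using V by (auto simp: I_def intro: finite_subset[of _ "Pow V"])
  have finF: "finite F" if "F \<subseteq> V" for F using that V finite_subset by blast
  have Z': "Z = int (\<Sum>F\<in>I. c F * B ^ e F)"
  proof -
    have "int (card (cuts adj v0 F)) * ((\<Prod>v\<in>F. 2 ^ (b * (D + M + \<omega> v))) * (2 ^ (b * D)) ^ excess adj V F)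
        = int (c F * B ^ e F)" if "F \<subseteq> V" for F
    proof -
      have "(\<Prod>v\<in>F. 2 ^ (b * (D + M + \<omega> v))) = (2::int) ^ (b * (D * card F + M * card F + (\<Sum>v\<in>F. \<omega> v)))"
      proof -
        have "(\<Sum>v\<in>F. b * (D + M + \<omega> v)) = b * (\<Sum>v\<in>F. D + M + \<omega> v)" by (simp only: sum_distrib_left)
        also have "(\<Sum>v\<in>F. D + M + \<omega> v) = D * card F + M * card F + (\<Sum>v\<in>F. \<omega> v)"
          by (simp only: sum.distrib sum_constant) (simp add: mult.commute)
        finally show ?thesis by (simp only: power_sum[symmetric])
      qed
      hence "(\<Prod>v\<in>F. 2 ^ (b * (D + M + \<omega> v))) * (2 ^ (b * D)) ^ excess adj V F = (2::int) ^ (b * e F)"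
      proof -
        have "b * (D * card F + M * card F + (\<Sum>v\<in>F. \<omega> v)) + b * D * excess adj V F = b * e F"
          unfolding e_def by (simp add: algebra_simps)
        with \<open>(\<Prod>v\<in>F. 2 ^ (b * (D + M + \<omega> v))) = _\<close> show ?thesis
          by (simp only: power_mult[symmetric] power_add[symmetric])
      qed
      thus ?thesis by (simp add: c_def B_def power_mult)
    qed
    thus ?thesis unfolding Z I_def of_nat_sum by (intro sum.cong) auto
  qed
  \<comment> \<open>There are at most \<open>2^card V\<close> sets with at most as many cuts each;
    this is the origin of \<open>b = 2 * card V + 1\<close>.\<close>
  have cB: "(\<Sum>F\<in>I. c F) < B"
  proof -
    have "(\<Sum>F\<in>I. c F) \<le> (\<Sum>F\<in>I. 2 ^ card V)"
      using V by (intro sum_mono) (auto simp: I_def c_def intro: card_cuts_le)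
    also have "\<dots> \<le> (\<Sum>F\<in>Pow V. 2 ^ card V)"
      using V by (intro sum_mono2) (auto simp: I_def)
    also have "\<dots> = 2 ^ (2 * card V)" using V by (simp add: card_Pow power_add[symmetric] mult_2)
    also have "\<dots> < B" by (simp add: B_def b)
    finally show ?thesis .
  qed
  have evenB: "even B" by (simp add: B_def b)
  \<comment> \<open>\<open>e F\<close> has two digits in base \<open>D\<close>:
    \<open>card F + excess adj V F\<close>, which equals \<open>card V\<close> exactly for the sets
    of interest, and the combination of size and weight, which fits because \<open>D\<close> is at
    least \<open>M * (card V + 1)\<close>.\<close>
  have eq: "e F = D * card V + w \<longleftrightarrow> (\<forall>v\<in>V - F. outdeg adj V F v \<le> 1) \<and> M * card F + (\<Sum>v\<in>F. \<omega> v) = w"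
    if F: "F \<subseteq> V" for F
  proof -
    have "card F \<le> card V" using F V by (rule card_mono[rotated])
    hence "M * card F + (\<Sum>v\<in>F. \<omega> v) < M * card V + M" using M[OF F] by (simp add: add_le_less_mono)
    hence lt: "M * card F + (\<Sum>v\<in>F. \<omega> v) < D" using D by simp
    have "e F div D = card F + excess adj V F" "e F mod D = M * card F + (\<Sum>v\<in>F. \<omega> v)"
      using lt by (simp_all add: e_def)
    moreover have "(D * card V + w) div D = card V" "(D * card V + w) mod D = w" using w by simp_all
    ultimately have "e F = D * card V + w \<longrightarrow> card F + excess adj V F = card V \<and> M * card F + (\<Sum>v\<in>F. \<omega> v) = w"
      by (intro impI) (simp only:)
    moreover have "card F + excess adj V F = card V \<and> M * card F + (\<Sum>v\<in>F. \<omega> v) = w \<longrightarrow> e F = D * card V + w"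
      unfolding e_def by (intro impI, elim conjE) (simp only:)
    ultimately have "e F = D * card V + w \<longleftrightarrow> card F + excess adj V F = card V \<and> M * card F + (\<Sum>v\<in>F. \<omega> v) = w"
      by argo
    thus ?thesis using excess_eq_iff(2)[OF V F] by simp
  qed
  have "odd (Z div 2 ^ (b * (D * card V + w))) \<longleftrightarrow> odd ((\<Sum>F\<in>I. c F * B ^ e F) div B ^ (D * card V + w))"
  proof -
    have "(2::int) ^ (b * (D * card V + w)) = int (B ^ (D * card V + w))" by (simp add: B_def power_mult)
    thus ?thesis unfolding Z' by (simp only: zdiv_int[symmetric] even_of_nat)
  qed
  also have "\<dots> \<longleftrightarrow> odd ((\<Sum>F\<in>I. c F * B ^ e F) div B ^ (D * card V + w) mod B)"
    using evenB by (simp add: dvd_mod_iff)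
  also have "\<dots> \<longleftrightarrow> odd (\<Sum>F | F \<in> I \<and> e F = D * card V + w. c F)"
    by (simp only: digit_of_sum[OF I cB])
  also have "\<dots> \<longleftrightarrow> odd (card {F \<in> {F. F \<in> I \<and> e F = D * card V + w}. odd (c F)})"
    using I by (intro odd_sum_iff_card) auto
  also have "{F \<in> {F. F \<in> I \<and> e F = D * card V + w}. odd (c F)} =
      {F \<in> solutions adj V S. M * card F + (\<Sum>v\<in>F. \<omega> v) = w}"
  proof -
    have oddc: "odd (c F) \<longleftrightarrow> connected_in adj F" if "S \<subseteq> F" "F \<subseteq> V" for F
      unfolding c_def by (rule odd_card_cuts_iff) (use that S finF sym in auto)
    have "F \<in> I \<and> e F = D * card V + w \<and> odd (c F) \<longleftrightarrow>
        F \<in> solutions adj V S \<and> M * card F + (\<Sum>v\<in>F. \<omega> v) = w" for F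
    proof (cases "S \<subseteq> F \<and> F \<subseteq> V")
      case True
      with eq[of F] oddc[of F] show ?thesis unfolding I_def solutions_def mem_Collect_eq by argo
    next
      case False
      thus ?thesis unfolding I_def solutions_def mem_Collect_eq by argo
    qed
    thus ?thesis by simp
  qed
  finally show ?thesis .
qed

section \<open>The isolation lemma\<close>

text \<open>Horner evaluation of bits from position \<open>a\<close> on, with the most significant
  bit at \<open>a\<close>; this is the order in which the program consumes its coins.\<close>

primrec hval :: "(nat \<Rightarrow> bool) \<Rightarrow> nat \<Rightarrow> nat \<Rightarrow> nat" where
  "hval f a 0 = 0"
| "hval f a (Suc i) = 2 * hval f a i + of_bool (f (a + i))"

definition weight :: "nat \<Rightarrow> (nat \<Rightarrow> bool) \<Rightarrow> nat \<Rightarrow> nat" where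
  "weight r f v = hval f (v * r) r"

lemma hval_less: "hval f a r < 2 ^ r"
  by (induction r) auto

lemma hval_inj: "hval f a r = hval g a r \<Longrightarrow> i < r \<Longrightarrow> f (a + i) = g (a + i)"
proof (induction r)
  case (Suc r)
  have eq: "2 * hval f a r + of_bool (f (a + r)) = 2 * hval g a r + of_bool (g (a + r))" using Suc.prems by simp
  have "hval f a r = hval g a r \<and> f (a + r) = g (a + r)"
    using eq by (cases "f (a + r)"; cases "g (a + r)"; simp; presburger)
  thus ?case using Suc by (cases "i = r") auto
qed simp

lemma hval_cong: "(\<And>i. i < r \<Longrightarrow> f (a + i) = g (a + i)) \<Longrightarrow> hval f a r = hval g a r"
  by (induction r) auto

lemma weight_less: "weight r f v < 2 ^ r"
  by (simp add: weight_def hval_less)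

definition isolates :: "(nat \<Rightarrow> nat) \<Rightarrow> nat set set \<Rightarrow> bool" where
  "isolates \<omega> \<F> \<longleftrightarrow> (\<exists>F\<in>\<F>. \<forall>F'\<in>\<F>. F' \<noteq> F \<longrightarrow> (\<Sum>v\<in>F. \<omega> v) < (\<Sum>v\<in>F'. \<omega> v))"

definition random_bits :: "nat \<Rightarrow> (nat \<Rightarrow> bool) pmf" where
  "random_bits m = Pi_pmf {..<m} False (\<lambda>_. bernoulli_pmf (1 / 2))"

lemma random_bits_uniform:
  "random_bits m = pmf_of_set {f. \<forall>i. m \<le> i \<longrightarrow> \<not> f i}"
proof -
  have "random_bits m = pmf_of_set (PiE_dflt {..<m} False (\<lambda>_. UNIV))"
    unfolding random_bits_def bernoulli_pmf_half_conv_pmf_of_set by (rule Pi_pmf_of_set) auto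
  also have "PiE_dflt {..<m} False (\<lambda>_. UNIV) = {f. \<forall>i. m \<le> i \<longrightarrow> \<not> f i}"
    by (auto simp: PiE_dflt_def)
  finally show ?thesis .
qed

text \<open>If two minimum weight sets differ at \<open>v\<close>, then the weights of the other vertices determine
  the weight of \<open>v\<close>.\<close>

theorem isolation:
  assumes "\<F> \<subseteq> Pow {..<n}" "\<F> \<noteq> {}" "2 * n \<le> 2 ^ r"
  shows "measure_pmf.prob (random_bits (n * r)) {f. \<not> isolates (weight r f) \<F>} \<le> 1 / 2"
proof -
  define \<Omega> where "\<Omega> = (\<lambda>J. {f :: nat \<Rightarrow> bool. \<forall>i. i \<notin> J \<longrightarrow> \<not> f i})"
  have \<Omega>: "finite (\<Omega> J) \<and> card (\<Omega> J) = 2 ^ card J" if "finite J" for J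
  proof -
    have e: "\<Omega> J = PiE_dflt J False (\<lambda>_. UNIV)" by (auto simp: PiE_dflt_def \<Omega>_def)
    show ?thesis unfolding e using that by (auto simp: card_PiE_dflt intro: finite_PiE_dflt)
  qed
  define wt where "wt f F = (\<Sum>v\<in>F. weight r f v)" for f F
  \<comment> \<open>Vertex \<open>v\<close> is ambiguous: of two sets of minimum weight one contains
    \<open>v\<close> and the other does not.\<close>
  define bad where "bad v = {f \<in> \<Omega> {..<n*r}. \<exists>F1\<in>\<F>. \<exists>F2\<in>\<F>. v \<notin> F1 \<and> v \<in> F2 \<and>
     (\<forall>F'\<in>\<F>. wt f F1 \<le> wt f F') \<and> (\<forall>F'\<in>\<F>. wt f F2 \<le> wt f F')}" for v
  define blk where "blk v = {v * r..<v * r + r}" for v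
  have finF: "finite F" if "F \<in> \<F>" for F using that assms(1) finite_subset by blast
  have bad_sub: "bad v \<subseteq> \<Omega> {..<n*r}" for v unfolding bad_def by (rule Collect_restrict)
  have bad_card: "card (bad v) * 2 ^ r \<le> 2 ^ (n * r)" if v: "v < n" for v
  proof -
    have "Suc v * r \<le> n * r" using v by (intro mult_right_mono) auto
    hence blk: "blk v \<subseteq> {..<n*r}" by (auto simp: blk_def)
    \<comment> \<open>Erasing the bits of \<open>v\<close> is injective on \<open>bad v\<close>, so
      at most a fraction \<open>1 / 2^r\<close> of the bit vectors is bad for
      \<open>v\<close>.\<close>
    define h where "h f i = (f i \<and> i \<notin> blk v)" for f :: "nat \<Rightarrow> bool" and i
    have "inj_on h (bad v)"
    proof (rule inj_onI)
      fix f g assume f: "f \<in> bad v" and g: "g \<in> bad v" and hh: "h f = h g"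
      have off: "f i = g i" if "i \<notin> blk v" for i using fun_cong[OF hh, of i] that by (simp add: h_def)
      have wo: "weight r f u = weight r g u" if "u \<noteq> v" for u
        unfolding weight_def
      proof (rule hval_cong)
        fix i assume "i < r"
        have "u * r + i \<notin> blk v"
        proof
          assume "u * r + i \<in> blk v"
          hence "v * r \<le> u * r + i" "u * r + i < v * r + r" by (auto simp: blk_def)
          hence "(u * r + i) div r = v" by (intro div_nat_eqI) (simp_all add: mult.commute)
          thus False using that \<open>i < r\<close> by simp
        qed
        thus "f (u * r + i) = g (u * r + i)" by (rule off)
      qed
      obtain F1 F2 where F: "F1 \<in> \<F>" "F2 \<in> \<F>" "v \<notin> F1" "v \<in> F2" "\<And>F'. F' \<in> \<F> \<Longrightarrow> wt f F1 \<le> wt f F'"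
        "\<And>F'. F' \<in> \<F> \<Longrightarrow> wt f F2 \<le> wt f F'" using f unfolding bad_def by blast
      obtain G1 G2 where G: "G1 \<in> \<F>" "G2 \<in> \<F>" "v \<notin> G1" "v \<in> G2" "\<And>F'. F' \<in> \<F> \<Longrightarrow> wt g G1 \<le> wt g F'"
        "\<And>F'. F' \<in> \<F> \<Longrightarrow> wt g G2 \<le> wt g F'" using g unfolding bad_def by blast
      have out: "wt f F = wt g F" if "v \<notin> F" for F
        unfolding wt_def using that by (intro sum.cong refl wo) auto
      have inn: "wt f F = weight r f v + wt g (F - {v})" "wt g F = weight r g v + wt g (F - {v})"
        if "F \<in> \<F>" "v \<in> F" for F
        using out[of "F - {v}"] sum.remove[OF finF[OF that(1)] that(2), of "weight r f"]
          sum.remove[OF finF[OF that(1)] that(2), of "weight r g"] by (auto simp: wt_def)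
      \<comment> \<open>Among sets avoiding \<open>v\<close>, the minimum weight is the same under
        \<open>f\<close> and \<open>g\<close>; among sets containing \<open>v\<close>, so is the
        minimum of the weight without \<open>v\<close>. In the ambiguous case the weight of
        \<open>v\<close> is the difference of these two numbers.\<close>
      have "weight r f v = weight r g v"
        using F(5)[OF F(2)] F(6)[OF F(1)] F(5)[OF G(1)] F(6)[OF G(2)]
          G(5)[OF G(2)] G(6)[OF G(1)] G(5)[OF F(1)] G(6)[OF F(2)] out[OF F(3)] out[OF G(3)]
          inn[OF F(2,4)] inn[OF G(2,4)] by linarith
      hence "f (v * r + i) = g (v * r + i)" if "i < r" for i using hval_inj that by (simp add: weight_def)
      hence "f i = g i" if "i \<in> blk v" for i
      proof -
        have "i = v * r + (i - v * r)" "i - v * r < r" using that by (auto simp: blk_def)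
        thus ?thesis using \<open>\<And>i. i < r \<Longrightarrow> f (v * r + i) = g (v * r + i)\<close> by metis
      qed
      with off show "f = g" by blast
    qed
    moreover have "h ` bad v \<subseteq> \<Omega> ({..<n*r} - blk v)"
      using bad_sub[of v] by (auto simp: \<Omega>_def h_def)
    ultimately have "card (bad v) \<le> card (\<Omega> ({..<n*r} - blk v))"
      using \<Omega> by (intro card_inj_on_le[of h]) auto
    also have "\<dots> = 2 ^ (n * r - r)"
      using \<Omega>[of "{..<n*r} - blk v"] blk by (simp add: card_Diff_subset blk_def)
    finally have "card (bad v) * 2 ^ r \<le> 2 ^ (n * r - r) * 2 ^ r" by simp
    also have "\<dots> = 2 ^ (n * r)" using v by (simp add: power_add[symmetric])
    finally show ?thesis .
  qed
  have fin: "finite (\<Omega> {..<n*r})" "card (\<Omega> {..<n*r}) = 2 ^ (n * r)" using \<Omega>[of "{..<n*r}"] by auto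
  have bad: "\<Omega> {..<n*r} \<inter> {f. \<not> isolates (weight r f) \<F>} \<subseteq> (\<Union>v<n. bad v)"
  proof safe
    fix f assume f: "f \<in> \<Omega> {..<n*r}" "\<not> isolates (weight r f) \<F>"
    obtain F0 where "F0 \<in> \<F>" using assms(2) by blast
    then obtain F where F: "F \<in> \<F>" "\<And>F'. F' \<in> \<F> \<Longrightarrow> wt f F \<le> wt f F'"
      using ex_has_least_nat[of "\<lambda>F. F \<in> \<F>" F0 "wt f"] by auto
    have "\<exists>F'\<in>\<F>. F' \<noteq> F \<and> \<not> wt f F < wt f F'"
      using f(2) F(1) unfolding isolates_def wt_def by blast
    then obtain F' where F': "F' \<in> \<F>" "F' \<noteq> F" "wt f F' \<le> wt f F"
      by (auto simp: not_less)
    have mins: "\<And>G. G \<in> \<F> \<Longrightarrow> wt f F' \<le> wt f G" using F'(3) F(2) by (rule order.trans)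
    obtain v where v: "(v \<in> F \<and> v \<notin> F') \<or> (v \<in> F' \<and> v \<notin> F)" using F'(2) by blast
    have "v < n" using v F(1) F'(1) assms(1) by auto
    moreover have "f \<in> bad v"
    proof (cases "v \<in> F")
      case True
      hence "v \<notin> F'" using v by blast
      with True show ?thesis using f(1) F F'(1) mins unfolding bad_def by (intro CollectI conjI bexI[of _ F'] bexI[of _ F]) auto
    next
      case False
      hence "v \<in> F'" using v by blast
      with False show ?thesis using f(1) F F'(1) mins unfolding bad_def by (intro CollectI conjI bexI[of _ F] bexI[of _ F']) auto
    qed
    ultimately show "f \<in> (\<Union>v<n. bad v)" by blast
  qed
  have "card (\<Omega> {..<n*r} \<inter> {f. \<not> isolates (weight r f) \<F>}) \<le> card (\<Union>v<n. bad v)"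
    by (rule card_mono[OF _ bad]) (intro finite_UN_I finite_lessThan finite_subset[OF bad_sub fin(1)])
  also have "\<dots> \<le> (\<Sum>v<n. card (bad v))" by (rule card_UN_le) simp
  \<comment> \<open>Union bound: the failure probability is at most \<open>n / 2^r\<close>.\<close>
  finally have "card (\<Omega> {..<n*r} \<inter> {f. \<not> isolates (weight r f) \<F>}) * 2 ^ r \<le> (\<Sum>v<n. card (bad v)) * 2 ^ r" by simp
  also have "\<dots> = (\<Sum>v<n. card (bad v) * 2 ^ r)" by (simp add: sum_distrib_right)
  also have "\<dots> \<le> (\<Sum>v<n. 2 ^ (n * r))" by (intro sum_mono bad_card) auto
  also have "\<dots> = n * 2 ^ (n * r)" by simp
  finally have "2 * (card (\<Omega> {..<n*r} \<inter> {f. \<not> isolates (weight r f) \<F>}) * 2 ^ r) \<le> 2 * n * 2 ^ (n * r)" by simp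
  also have "\<dots> \<le> 2 ^ r * 2 ^ (n * r)" using assms(3) by simp
  finally have *: "2 * card (\<Omega> {..<n*r} \<inter> {f. \<not> isolates (weight r f) \<F>}) \<le> 2 ^ (n * r)"
    by (simp add: algebra_simps)
  have "{f. \<forall>i. n * r \<le> i \<longrightarrow> \<not> f i} = \<Omega> {..<n*r}" by (auto simp: \<Omega>_def not_less)
  moreover have "(\<lambda>_. False) \<in> \<Omega> {..<n*r}" by (simp add: \<Omega>_def)
  ultimately have "measure_pmf.prob (random_bits (n * r)) {f. \<not> isolates (weight r f) \<F>} =
     real (card (\<Omega> {..<n*r} \<inter> {f. \<not> isolates (weight r f) \<F>})) / real (card (\<Omega> {..<n*r}))"
    unfolding random_bits_uniform using fin(1) by (simp only:) (rule measure_pmf_of_set, auto)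
  also have "\<dots> = real (card (\<Omega> {..<n*r} \<inter> {f. \<not> isolates (weight r f) \<F>})) / 2 ^ (n * r)"
    by (simp add: fin(2))
  also have "\<dots> \<le> 1 / 2"
  proof -
    have "real (2 * card (\<Omega> {..<n*r} \<inter> {f. \<not> isolates (weight r f) \<F>})) \<le> real (2 ^ (n * r))"
      using * by (simp only: of_nat_le_iff)
    hence "2 * real (card (\<Omega> {..<n*r} \<inter> {f. \<not> isolates (weight r f) \<F>})) \<le> 2 ^ (n * r)"
      by simp
    thus ?thesis by (simp add: pos_divide_le_eq)
  qed
  finally show ?thesis .
qed

section \<open>Running times of programs\<close>

text \<open>After \<open>t\<close> steps all mass is on halted configurations, and \<open>Q\<close>
  is the distribution of their stores. As \<open>Skip\<close> steps to itself, \<open>t\<close> is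
  an upper bound of the running time rather than its exact value.\<close>

definition ends :: "nat \<Rightarrow> com \<Rightarrow> store \<Rightarrow> store pmf \<Rightarrow> bool" where
  "ends t c s Q \<longleftrightarrow> run t (c, s) = map_pmf (Pair Skip) Q"

text \<open>\<open>run\<close> adds steps at the end, whereas reasoning about programs splits off
  the earliest step.\<close>

lemma run_Suc_left: "run (Suc t) cfg = bind_pmf (step cfg) (run t)"
proof (induction t arbitrary: cfg)
  case (Suc t)
  have "run (Suc (Suc t)) cfg = bind_pmf (bind_pmf (step cfg) (run t)) step" using Suc by simp
  thus ?case by (simp add: bind_assoc_pmf)
qed (simp add: bind_return_pmf bind_return_pmf' run.simps(1)[abs_def])

lemma run_Skip: "run t (Skip, s) = return_pmf (Skip, s)"
  by (induction t) (simp_all add: bind_return_pmf)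

lemma run_add: "run (t + u) cfg = bind_pmf (run t cfg) (run u)"
proof (induction t arbitrary: cfg)
  case (Suc t)
  show ?case by (simp only: add_Suc run_Suc_left bind_assoc_pmf) (simp only: Suc[abs_def])
qed (simp add: bind_return_pmf)

lemma ends_mono:
  assumes "ends t c s Q" "t \<le> u"
  shows "ends u c s Q"
proof -
  obtain d where u: "u = t + d" using assms(2) le_Suc_ex by blast
  show ?thesis using assms(1) unfolding u ends_def run_add
    by (simp add: map_pmf_def bind_assoc_pmf bind_return_pmf run_Skip)
qed

lemma ends_step:
  assumes "\<And>cfg. cfg \<in> set_pmf (step (c, s)) \<Longrightarrow> ends t (fst cfg) (snd cfg) (Q cfg)"
  shows "ends (Suc t) c s (bind_pmf (step (c, s)) Q)"
  using assms unfolding ends_def run_Suc_left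
  by (simp add: map_bind_pmf cong: bind_pmf_cong)

text \<open>The additional step is the one that discards \<open>Skip\<close> in front of
  \<open>d\<close>. The induction is over the time of \<open>c\<close>, because a step may replace
  \<open>c\<close> by a program that is not a part of it.\<close>

lemma ends_Then:
  assumes "ends t c s Q" "\<And>s'. s' \<in> set_pmf Q \<Longrightarrow> ends u d s' (R s')"
  shows "ends (t + u + 1) (Then c d) s (bind_pmf Q R)"
  using assms
proof (induction t arbitrary: c s Q)
  case 0
  hence "return_pmf (c, s) = map_pmf (Pair Skip) Q" by (simp add: ends_def)
  hence Q: "c = Skip" "Q = return_pmf s"
  proof -
    assume *: "return_pmf (c, s) = map_pmf (Pair Skip) Q"
    from arg_cong[OF *, of "map_pmf snd"] show "Q = return_pmf s" by (simp add: map_pmf_comp)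
    with * show "c = Skip" by simp
  qed
  with 0 have "ends u d s (R s)" by simp
  thus ?case using Q by (simp add: ends_def run_Suc_left bind_return_pmf del: run.simps(2))
next
  case (Suc t)
  show ?case
  proof (cases "c = Skip")
    case True
    with Suc.prems(1) have *: "return_pmf (Skip, s) = map_pmf (Pair Skip) Q" by (simp add: ends_def run_Skip del: run.simps(2))
    from arg_cong[OF *, of "map_pmf snd"] have Q: "Q = return_pmf s" by (simp add: map_pmf_comp)
    have "ends u d s (R s)" using Suc.prems(2) Q by simp
    hence "ends (Suc u) (Then Skip d) s (R s)" by (simp add: ends_def run_Suc_left bind_return_pmf del: run.simps(2))
    hence "ends (Suc t + u + 1) (Then Skip d) s (R s)" by (rule ends_mono) simp
    thus ?thesis using True Q by (simp add: bind_return_pmf)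
  next
    case False
    \<comment> \<open>Since \<open>c\<close> has surely halted after \<open>Suc t\<close> steps, so
      has every successor configuration after \<open>t\<close> more; \<open>q\<close> is the
      distribution of its final stores.\<close>
    define q where "q cfg = map_pmf snd (run t cfg)" for cfg :: "com \<times> store"
    have run: "bind_pmf (step (c, s)) (run t) = map_pmf (Pair Skip) Q"
      using Suc.prems(1) by (simp add: ends_def run_Suc_left del: run.simps(2))
    have q: "ends t (fst cfg) (snd cfg) (q cfg)" if "cfg \<in> set_pmf (step (c, s))" for cfg
    proof -
      have "set_pmf (run t cfg) \<subseteq> Pair Skip ` set_pmf Q"
        using arg_cong[OF run, of set_pmf] that by auto
      hence "run t cfg = map_pmf (\<lambda>x. (Skip, snd x)) (run t cfg)"
        by (intro pmf.map_ident_strong[symmetric]) auto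
      thus ?thesis by (simp add: ends_def q_def map_pmf_comp)
    qed
    have Q: "Q = bind_pmf (step (c, s)) q"
      using arg_cong[OF run, of "map_pmf snd"] by (simp add: map_bind_pmf map_pmf_comp q_def[abs_def])
    \<comment> \<open>The continuation is a function of the configuration of
      \<open>Then c d\<close>; the \<open>case\<close> recovers from it the configuration of
      \<open>c\<close>.\<close>
    have "ends (Suc (t + u + 1)) (Then c d) s
      (bind_pmf (step (Then c d, s)) (\<lambda>cfg. bind_pmf (case fst cfg of Then c' d' \<Rightarrow> q (c', snd cfg)) R))"
    proof (rule ends_step)
      fix cfg assume "cfg \<in> set_pmf (step (Then c d, s))"
      then obtain c' s' where cfg: "cfg = (Then c' d, s')" "(c', s') \<in> set_pmf (step (c, s))"
        using False by auto
      have "ends (t + u + 1) (Then c' d) s' (bind_pmf (q (c', s')) R)"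
      proof (rule Suc.IH)
        show "ends t c' s' (q (c', s'))" using q[OF cfg(2)] by simp
        fix s'' assume "s'' \<in> set_pmf (q (c', s'))"
        thus "ends u d s'' (R s'')" using Suc.prems(2) cfg(2) unfolding Q by auto
      qed
      thus "ends (t + u + 1) (fst cfg) (snd cfg) (bind_pmf (case fst cfg of Then c' d' \<Rightarrow> q (c', snd cfg)) R)"
        by (simp add: cfg)
    qed
    moreover have "bind_pmf (step (Then c d, s)) (\<lambda>cfg. bind_pmf (case fst cfg of Then c' d' \<Rightarrow> q (c', snd cfg)) R)
        = bind_pmf Q R"
      using False by (simp add: Q bind_map_pmf bind_assoc_pmf split_def)
    ultimately show ?thesis by simp
  qed
qed

text \<open>The weakest precondition bounds the number of steps, so that the rules below establish
  total correctness together with a running time.\<close>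

definition wp :: "nat \<Rightarrow> com \<Rightarrow> (store \<Rightarrow> bool) \<Rightarrow> store \<Rightarrow> bool" where
  "wp t c P s \<longleftrightarrow> (\<exists>s'. ends t c s (return_pmf s') \<and> P s')"

section \<open>Frame conditions: the arrays that a program may change\<close>

primrec writes :: "com \<Rightarrow> string set" where
  "writes Skip = {}"
| "writes (Assign x a e) = {x}"
| "writes (Flip x) = {x}"
| "writes (Then c d) = writes c \<union> writes d"
| "writes (IfElse b c d) = writes c \<union> writes d"
| "writes (While b c) = writes c"

lemma step_writes:
  assumes "cfg \<in> set_pmf (step (c, s))" "x \<notin> writes c"
  shows "snd cfg x = s x \<and> x \<notin> writes (fst cfg)"
  using assms
proof (induction c arbitrary: cfg)
  case (Then c d)
  then show ?case by (auto split: if_splits; fastforce)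
qed (auto simp: upd_def split: if_splits)

lemma run_writes:
  assumes "cfg \<in> set_pmf (run t (c, s))" "x \<notin> writes c"
  shows "snd cfg x = s x \<and> x \<notin> writes (fst cfg)"
  using assms
proof (induction t arbitrary: cfg)
  case (Suc t)
  then obtain cfg' where "cfg' \<in> set_pmf (run t (c, s))" "cfg \<in> set_pmf (step cfg')" by auto
  with Suc.IH[of cfg'] Suc.prems step_writes[of cfg "fst cfg'" "snd cfg'" x] show ?case by auto
qed auto

lemma ends_writes:
  assumes "ends t c s Q" "s' \<in> set_pmf Q" "x \<notin> writes c"
  shows "s' x = s x"
  using run_writes[of "(Skip, s')" t c s x] assms by (auto simp: ends_def)

definition same :: "string set \<Rightarrow> store \<Rightarrow> store \<Rightarrow> bool" where
  "same W s s' \<longleftrightarrow> (\<forall>x. x \<notin> W \<longrightarrow> s' x = s x)"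

lemma sameD: "same W s s' \<Longrightarrow> x \<notin> W \<Longrightarrow> s' x = s x"
  by (simp add: same_def)

lemma same_trans: "same W s s' \<Longrightarrow> same W s' s'' \<Longrightarrow> same W s s''"
  by (simp add: same_def)

lemma same_mono: "same W s s' \<Longrightarrow> W \<subseteq> W' \<Longrightarrow> same W' s s'"
  by (auto simp: same_def)

lemma wp_frame: "wp t c P s \<Longrightarrow> wp t c (\<lambda>s'. P s' \<and> same (writes c) s s') s"
  by (fastforce simp: wp_def same_def dest: ends_writes)

text \<open>The frame is available when proving the new postcondition, so specifications can be
  confined to the arrays that change.\<close>

lemma wp_conseq: "wp t c P s \<Longrightarrow> t \<le> u \<Longrightarrow> (\<And>s'. P s' \<Longrightarrow> same (writes c) s s' \<Longrightarrow> Q s') \<Longrightarrow> wp u c Q s"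
  using wp_frame[of t c P s] ends_mono unfolding wp_def by blast

lemma wp_Then: "wp t c (wp u d P) s \<Longrightarrow> wp (t + u + 1) (Then c d) P s"
proof -
  assume "wp t c (wp u d P) s"
  then obtain s' s'' where "ends t c s (return_pmf s')" "ends u d s' (return_pmf s'')" "P s''"
    by (auto simp: wp_def)
  thus ?thesis using ends_Then[of t c s "return_pmf s'" u d "\<lambda>_. return_pmf s''"]
    by (auto simp: wp_def bind_return_pmf)
qed

lemma wp_step:
  assumes "step (c, s) = return_pmf (c', s')" "wp t c' P s'"
  shows "wp (Suc t) c P s"
  using assms by (auto simp: wp_def ends_def run_Suc_left bind_return_pmf simp del: run.simps(2))

lemma wp_Skip: "P s \<Longrightarrow> wp t Skip P s"
  by (auto simp: wp_def ends_def run_Skip)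

lemma wp_Assign: "P (upd s x (aval a s) (aval e s)) \<Longrightarrow> wp 1 (Assign x a e) P s"
  using wp_step[of "Assign x a e" s Skip _ 0 P] by (auto intro: wp_Skip)

lemma wp_IfElse:
  assumes "bval b s \<Longrightarrow> wp t c P s" "\<not> bval b s \<Longrightarrow> wp t d P s"
  shows "wp (t + 1) (IfElse b c d) P s"
  using wp_step[of "IfElse b c d" s "if bval b s then c else d" s t P] assms by (cases "bval b s") auto

text \<open>The loop-free deterministic fragment. On it, \<open>exec\<close> and \<open>cost\<close>
  let simplification compute the final store and a time bound; for \<open>Flip\<close> and
  \<open>While\<close> they hold default values.\<close>

primrec simple :: "com \<Rightarrow> bool" where
  "simple Skip = True"
| "simple (Assign x a e) = True"
| "simple (Flip x) = False"
| "simple (Then c d) = (simple c \<and> simple d)"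
| "simple (IfElse b c d) = (simple c \<and> simple d)"
| "simple (While b c) = False"

primrec cost :: "com \<Rightarrow> nat" where
  "cost Skip = 0"
| "cost (Assign x a e) = 1"
| "cost (Flip x) = 1"
| "cost (Then c d) = cost c + cost d + 1"
| "cost (IfElse b c d) = max (cost c) (cost d) + 1"
| "cost (While b c) = 0"

primrec exec :: "com \<Rightarrow> store \<Rightarrow> store" where
  "exec Skip s = s"
| "exec (Assign x a e) s = upd s x (aval a s) (aval e s)"
| "exec (Flip x) s = s"
| "exec (Then c d) s = exec d (exec c s)"
| "exec (IfElse b c d) s = (if bval b s then exec c s else exec d s)"
| "exec (While b c) s = s"

lemma wp_exec: "simple c \<Longrightarrow> P (exec c s) \<Longrightarrow> wp (cost c) c P s"
proof (induction c arbitrary: s P)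
  case (Then c d)
  have "wp (cost c) c (wp (cost d) d P) s" using Then by simp
  then show ?case using wp_Then by simp
next
  case (IfElse b c d)
  show ?case unfolding cost.simps
    by (rule wp_IfElse; rule wp_conseq[of "if bval b s then cost c else cost d" _ P])
       (use IfElse in auto)
qed (use wp_Assign wp_Skip in auto)

lemma wp_simple: "simple c \<Longrightarrow> cost c \<le> t \<Longrightarrow> P (exec c s) \<Longrightarrow> wp t c P s"
  using wp_exec wp_conseq by blast

lemma wp_While_True: "bval b s \<Longrightarrow> wp t c (wp u (While b c) P) s \<Longrightarrow> wp (t + u + 2) (While b c) P s"
  using wp_step[of "While b c" s "Then c (While b c)" s "t + u + 1" P] wp_Then by auto

lemma wp_While_False: "\<not> bval b s \<Longrightarrow> P s \<Longrightarrow> wp 1 (While b c) P s"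
  using wp_step[of "While b c" s Skip s 0 P] by (auto intro: wp_Skip)

text \<open>The index of \<open>I\<close> is the number of iterations still to come, so one family
  serves as invariant and variant. Each iteration pays for the test and for removing
  \<open>Skip\<close>.\<close>

lemma wp_While:
  assumes "I m s"
    and "\<And>k s. I (Suc k) s \<Longrightarrow> bval b s \<and> wp t c (I k) s"
    and "\<And>s. I 0 s \<Longrightarrow> \<not> bval b s \<and> P s"
  shows "wp (m * (t + 2) + 1) (While b c) P s"
  using assms(1)
proof (induction m arbitrary: s)
  case 0
  with assms(3)[of s] wp_While_False[of b s P] show ?case by simp
next
  case (Suc m)
  have "wp (t + (m * (t + 2) + 1) + 2) (While b c) P s"
    using assms(2)[OF Suc.prems] Suc.IH by (intro wp_While_True) (auto intro: wp_conseq)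
  then show ?case by (rule wp_conseq) auto
qed

abbreviation Var :: "string \<Rightarrow> aexp" where
  "Var x \<equiv> Cell x (Const 0)"

abbreviation Set_var :: "string \<Rightarrow> aexp \<Rightarrow> com" (infix \<open>::=\<close> 65) where
  "x ::= e \<equiv> Assign x (Const 0) e"

abbreviation Seq (infixr \<open>;;\<close> 60) where
  "c ;; d \<equiv> Then c d"

definition For :: "string \<Rightarrow> aexp \<Rightarrow> com \<Rightarrow> com" where
  "For i e c = i ::= Const 0 ;; While (Less (Var i) e) (c ;; i ::= Add (Var i) (Const 1))"

lemma writes_For [simp]: "writes (For i e c) = insert i (writes c)"
  by (auto simp: For_def)

text \<open>Here the index counts finished iterations, and the frame of the whole loop is handed to
  the obligations. The summand 4 stands for the test, the increment and two removals of
  \<open>Skip\<close>.\<close>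

lemma wp_For:
  assumes e: "\<And>s. same (insert i (writes c)) s0 s \<Longrightarrow> aval e s = int m"
    and init: "I 0 (upd s0 i 0 0)"
    and body: "\<And>k s. k < m \<Longrightarrow> I k s \<Longrightarrow> s i 0 = int k \<Longrightarrow> same (insert i (writes c)) s0 s \<Longrightarrow>
        wp t c (\<lambda>s'. I (Suc k) (upd s' i 0 (int (Suc k)))) s"
    and i: "i \<notin> writes c"
    and fin: "\<And>s. I m s \<Longrightarrow> s i 0 = int m \<Longrightarrow> same (insert i (writes c)) s0 s \<Longrightarrow> P s"
  shows "wp (m * (t + 4) + 3) (For i e c) P s0"
proof -
  define J where "J = (\<lambda>k s. k \<le> m \<and> I (m - k) s \<and> s i 0 = int (m - k) \<and> same (insert i (writes c)) s0 s)"
  have upd_same: "same (insert i W) s (upd s i a v)" for W s a v by (simp add: same_def upd_def)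
  have "wp (m * ((t + 2) + 2) + 1) (While (Less (Var i) e) (c ;; i ::= Add (Var i) (Const 1))) P (upd s0 i 0 0)"
  proof (rule wp_While[of J])
    show "J m (upd s0 i 0 0)" using init upd_same by (simp add: J_def) (simp add: upd_def)
  next
    fix k s assume J: "J (Suc k) s"
    hence k: "Suc k \<le> m" "m - k = Suc (m - Suc k)" by (auto simp: J_def)
    have sm: "same (insert i (writes c)) s0 s" using J by (simp add: J_def)
    have b: "bval (Less (Var i) e) s" using J k e[OF sm] by (auto simp: J_def)
    have "wp t c (\<lambda>s'. I (m - k) (upd s' i 0 (int (m - k)))) s"
      using body[of "m - Suc k" s] J k by (simp add: J_def)
    hence "wp t c (wp 1 (i ::= Add (Var i) (Const 1)) (J k)) s"
    proof (rule wp_conseq)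
      fix s' assume *: "I (m - k) (upd s' i 0 (int (m - k)))" "same (writes c) s s'"
      have si: "s' i 0 + 1 = int (m - k)" using * i J k by (simp add: same_def J_def)
      have "same (insert i (writes c)) s0 (upd s' i 0 (int (m - k)))"
        using sm *(2) by (simp add: same_def upd_def)
      thus "wp 1 (i ::= Add (Var i) (Const 1)) (J k) s'"
        using * k si by (intro wp_Assign) (simp add: J_def, simp add: upd_def)
    qed simp
    from wp_Then[OF this] b show "bval (Less (Var i) e) s \<and>
      wp (t + 2) (c ;; i ::= Add (Var i) (Const 1)) (J k) s" by simp
  next
    fix s assume "J 0 s"
    thus "\<not> bval (Less (Var i) e) s \<and> P s" using e[of s] fin[of s] by (auto simp: J_def)
  qed
  hence "wp 1 (i ::= Const 0) (wp (m * (t + 4) + 1) (While (Less (Var i) e) (c ;; i ::= Add (Var i) (Const 1))) P) s0"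
    by (intro wp_Assign) (simp add: add.assoc numeral_eq_Suc)
  from wp_Then[OF this] show ?thesis unfolding For_def by (rule wp_conseq) simp
qed

section \<open>The elimination order of a tree decomposition\<close>

lemma vwalk_successively:
  "vwalk p G \<longleftrightarrow> set p \<subseteq> verts G \<and> successively (\<lambda>a b. (a, b) \<in> arcs_ends G) p \<and> p \<noteq> []"
proof -
  have "set (vwalk_arcs p) \<subseteq> arcs_ends G \<longleftrightarrow> successively (\<lambda>a b. (a, b) \<in> arcs_ends G) p"
    by (induction p rule: vwalk_arcs.induct) auto
  thus ?thesis by (auto simp: vwalk_def)
qed

locale rooted =
  fixes I :: "'i set" and r :: 'i and par :: "'i \<Rightarrow> 'i"
  assumes rooted: "rooted_tree I r par"
begin

definition depth :: "'i \<Rightarrow> nat" where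
  "depth i = (LEAST m. (par ^^ m) i = r)"

lemma finite_I: "finite I" and r_in: "r \<in> I" and par_r: "par r = r"
  and par_in: "i \<in> I \<Longrightarrow> par i \<in> I" and reaches: "i \<in> I \<Longrightarrow> \<exists>m. (par ^^ m) i = r"
  using rooted unfolding rooted_tree_def by blast+

lemma pow_in: "i \<in> I \<Longrightarrow> (par ^^ s) i \<in> I"
  by (induction s) (auto simp: par_in)

lemma depth_r: "depth r = 0"
  unfolding depth_def by (rule Least_eq_0) simp

lemma pow_depth: "i \<in> I \<Longrightarrow> (par ^^ depth i) i = r"
  unfolding depth_def by (rule LeastI_ex) (rule reaches)

lemma depth_par: "i \<in> I \<Longrightarrow> i \<noteq> r \<Longrightarrow> depth i = Suc (depth (par i))"
  unfolding depth_def using reaches[of i]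
  by (subst Least_Suc[where n = "SOME m. (par ^^ m) i = r"])
     (auto simp: funpow_swap1 intro: someI_ex)

lemma depth_par': "i \<in> I \<Longrightarrow> depth (par i) = depth i - 1"
  by (cases "i = r") (auto simp: depth_par depth_r par_r)

lemma depth_pow: "i \<in> I \<Longrightarrow> depth ((par ^^ s) i) = depth i - s"
  by (induction s) (auto simp: depth_par' pow_in)

lemma depth_0: "i \<in> I \<Longrightarrow> depth i = 0 \<Longrightarrow> i = r"
  using pow_depth[of i] by simp

lemma inj_pow: "i \<in> I \<Longrightarrow> inj_on (\<lambda>k. (par ^^ k) i) {..depth i}"
proof (rule inj_onI)
  fix x y assume "i \<in> I" "x \<in> {..depth i}" "y \<in> {..depth i}" "(par ^^ x) i = (par ^^ y) i"
  moreover from this have "depth i - x = depth i - y" using depth_pow by metis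
  ultimately show "x = y" by auto
qed

lemma depth_less: "i \<in> I \<Longrightarrow> depth i < card I"
proof -
  assume i: "i \<in> I"
  have "card ((\<lambda>k. (par ^^ k) i) ` {..depth i}) \<le> card I"
    using i by (intro card_mono finite_I) (auto simp: pow_in)
  thus ?thesis using card_image[OF inj_pow[OF i]] by simp
qed

lemma arc_up: "i \<in> I \<Longrightarrow> i \<noteq> r \<Longrightarrow> (i, par i) \<in> parcs (tree_graph I r par) \<and> (par i, i) \<in> parcs (tree_graph I r par)"
  by (auto simp: tree_graph_def)

lemma arc_pow:
  assumes "i \<in> I" "k < depth i"
  shows "((par ^^ k) i, (par ^^ Suc k) i) \<in> parcs (tree_graph I r par)"
    "((par ^^ Suc k) i, (par ^^ k) i) \<in> parcs (tree_graph I r par)"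
proof -
  have "depth ((par ^^ k) i) \<noteq> 0" using assms depth_pow by simp
  hence "(par ^^ k) i \<noteq> r" using depth_r by auto
  with arc_up[OF pow_in[OF assms(1)]] show "((par ^^ k) i, (par ^^ Suc k) i) \<in> parcs (tree_graph I r par)"
    "((par ^^ Suc k) i, (par ^^ k) i) \<in> parcs (tree_graph I r par)" by auto
qed

lemma successively_upt:
  "(\<And>k. Suc k < m \<Longrightarrow> P (f k) (f (Suc k))) \<Longrightarrow> successively P (map f [0..<m])"
proof (induction m)
  case (Suc m)
  then show ?case by (cases m) (auto simp: successively_append_iff)
qed simp

lemma vpath_up:
  assumes "i \<in> I" "s \<le> depth i"
  shows "vpath (map (\<lambda>k. (par ^^ k) i) [0..<Suc s]) (with_proj (tree_graph I r par))"
  unfolding vpath_def vwalk_successively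
proof (intro conjI)
  show "set (map (\<lambda>k. (par ^^ k) i) [0..<Suc s]) \<subseteq> verts (with_proj (tree_graph I r par))"
    using pow_in[OF assms(1)] by (auto simp: tree_graph_def simp del: upt_Suc)
  show "successively (\<lambda>a b. (a, b) \<in> arcs_ends (with_proj (tree_graph I r par))) (map (\<lambda>k. (par ^^ k) i) [0..<Suc s])"
    by (rule successively_upt) (use arc_pow(1)[OF assms(1)] assms(2) in \<open>auto simp del: funpow.simps\<close>)
  show "distinct (map (\<lambda>k. (par ^^ k) i) [0..<Suc s])"
    using inj_pow[OF assms(1)] assms(2) by (auto simp: distinct_map simp del: upt_Suc elim!: inj_on_subset)
qed simp

text \<open>The common ancestor belongs to the second list only; hence the strict bound on
  \<open>k\<close> and the weak one on \<open>k'\<close> in \<open>disj\<close>.\<close>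

lemma vpath_up_down:
  assumes i: "i \<in> I" "s \<le> depth i" and j: "j \<in> I" "s' \<le> depth j"
    and meet: "(par ^^ s) i = (par ^^ s') j" and disj: "\<And>k k'. k < s \<Longrightarrow> k' \<le> s' \<Longrightarrow> (par ^^ k) i \<noteq> (par ^^ k') j"
  shows "vpath (map (\<lambda>k. (par ^^ k) i) [0..<s] @ rev (map (\<lambda>k. (par ^^ k) j) [0..<Suc s'])) (with_proj (tree_graph I r par))"
    (is "vpath (?p @ rev ?q) ?T")
  unfolding vpath_def vwalk_successively
proof (intro conjI)
  show "set (?p @ rev ?q) \<subseteq> verts ?T"
    using pow_in[OF i(1)] pow_in[OF j(1)] by (auto simp: tree_graph_def simp del: upt_Suc)
  have "successively (\<lambda>a b. (a, b) \<in> arcs_ends ?T) ?p"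
    by (rule successively_upt) (use arc_pow(1)[OF i(1)] i(2) in \<open>auto simp del: funpow.simps\<close>)
  moreover have "successively (\<lambda>a b. (b, a) \<in> arcs_ends ?T) ?q"
    by (rule successively_upt) (use arc_pow(2)[OF j(1)] j(2) in \<open>auto simp del: funpow.simps\<close>)
  moreover have "(last ?p, hd (rev ?q)) \<in> arcs_ends ?T" if "?p \<noteq> []"
  proof -
    obtain s0 where s0: "s = Suc s0" using \<open>?p \<noteq> []\<close> by (cases s) auto
    have "last ?p = (par ^^ s0) i" by (simp add: s0)
    moreover have "hd (rev ?q) = (par ^^ Suc s0) i" using meet s0 by (simp add: hd_rev)
    ultimately show ?thesis using arc_pow(1)[OF i(1), of s0] i(2) s0 by simp
  qed
  ultimately show "successively (\<lambda>a b. (a, b) \<in> arcs_ends ?T) (?p @ rev ?q)"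
    unfolding successively_append_iff successively_rev by blast
  have "distinct ?p" "distinct ?q"
    using inj_pow[OF i(1)] i(2) inj_pow[OF j(1)] j(2)
    by (auto simp: distinct_map simp del: upt_Suc elim!: inj_on_subset)
  moreover have "set ?p \<inter> set ?q = {}" using disj by (auto simp: less_Suc_eq_le simp del: upt_Suc)
  ultimately show "distinct (?p @ rev ?q)" by simp
qed simp

end

section \<open>Topmost bags and the order of the vertices\<close>

locale decomposed = rooted I r par for I :: "nat set" and r par +
  fixes G :: "nat pair_pre_digraph" and n :: nat and X :: "nat \<Rightarrow> nat set"
  assumes graph: "pair_graph G" and verts: "pverts G = {..<n}"
    and decomp: "tree_decomposition G I r par X"
begin

definition adj :: "nat \<Rightarrow> nat \<Rightarrow> bool" where
  "adj u v \<longleftrightarrow> (u, v) \<in> parcs G"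

lemma adj_sym: "adj u v \<Longrightarrow> adj v u"
proof -
  have "sym (parcs G)"
    using pair_sym_digraph.pair_sym_arcs[OF pair_pseudo_graph.axioms(2)[OF pair_graph.axioms(2)[OF graph]]]
    by (simp add: Digraph.symmetric_def)
  thus "adj u v \<Longrightarrow> adj v u" unfolding adj_def by (rule symD)
qed

lemma adj_irrefl: "\<not> adj v v"
  using graph unfolding adj_def pair_graph_def pair_digraph_def
  by (auto dest: pair_loopfree_digraph.pair_no_loops)

lemma adj_verts: "adj u v \<Longrightarrow> u < n \<and> v < n"
  using graph verts unfolding adj_def pair_graph_def pair_digraph_def pair_fin_digraph_def pair_wf_digraph_def
  by force

lemma cover: "(\<Union>i\<in>I. X i) = {..<n}"
  and edges: "adj u v \<Longrightarrow> \<exists>i\<in>I. u \<in> X i \<and> v \<in> X i"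
  and paths: "vpath p (with_proj (tree_graph I r par)) \<Longrightarrow> j \<in> set p \<Longrightarrow> X (hd p) \<inter> X (last p) \<subseteq> X j"
  using decomp verts unfolding tree_decomposition_def adj_def by blast+

lemma bag_subset: "i \<in> I \<Longrightarrow> X i \<subseteq> {..<n}"
  using cover by blast

lemma bag_up:
  assumes "i \<in> I" "s \<le> depth i" "k \<le> s" "v \<in> X i" "v \<in> X ((par ^^ s) i)"
  shows "v \<in> X ((par ^^ k) i)"
proof -
  have "hd (map (\<lambda>k. (par ^^ k) i) [0..<Suc s]) = i" by (simp add: hd_map del: upt_Suc)
  moreover have "last (map (\<lambda>k. (par ^^ k) i) [0..<Suc s]) = (par ^^ s) i" by simp
  moreover have "(par ^^ k) i \<in> set (map (\<lambda>k. (par ^^ k) i) [0..<Suc s])" using assms(3) by (auto simp del: upt_Suc)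
  ultimately show ?thesis using paths[OF vpath_up[OF assms(1,2)], of "(par ^^ k) i"] assms(4,5) by auto
qed

definition is_top :: "nat \<Rightarrow> nat \<Rightarrow> bool" where
  "is_top v t \<longleftrightarrow> t \<in> I \<and> v \<in> X t \<and> (t = r \<or> v \<notin> X (par t))"

text \<open>On the tree path between two topmost nodes of \<open>v\<close> all bags contain
  \<open>v\<close>. A path leaving \<open>t\<close> upwards would pass through the parent of
  \<open>t\<close>, whose bag lacks \<open>v\<close>; the same holds for \<open>t'\<close>, so both
  coincide with the highest node of the path.\<close>

lemma is_top_unique:
  assumes "is_top v t" "is_top v t'"
  shows "t = t'"
proof -
  have t: "t \<in> I" "v \<in> X t" and t': "t' \<in> I" "v \<in> X t'" using assms by (auto simp: is_top_def)
  define Q where "Q s \<longleftrightarrow> (\<exists>s'\<le>depth t'. (par ^^ s) t = (par ^^ s') t')" for s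
  have ex: "Q (depth t)" using pow_depth t(1) t'(1) unfolding Q_def by (metis order_refl)
  \<comment> \<open>The least \<open>s\<close> leads to the lowest common ancestor, which makes the
    two branches disjoint.\<close>
  define s where "s = (LEAST s. Q s)"
  have Qs: "Q s" unfolding s_def by (rule LeastI[of Q, OF ex])
  have s: "s \<le> depth t" unfolding s_def by (rule Least_le[of Q, OF ex])
  obtain s' where s': "s' \<le> depth t'" "(par ^^ s) t = (par ^^ s') t'" using Qs by (auto simp: Q_def)
  have disj: "(par ^^ k) t \<noteq> (par ^^ k') t'" if "k < s" "k' \<le> s'" for k k'
  proof
    assume "(par ^^ k) t = (par ^^ k') t'"
    hence "Q k" using that s' unfolding Q_def by (metis order_trans)
    thus False using that(1) not_less_Least unfolding s_def by blast
  qed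
  let ?q = "map (\<lambda>k. (par ^^ k) t) [0..<s] @ rev (map (\<lambda>k. (par ^^ k) t') [0..<Suc s'])"
  have path: "vpath ?q (with_proj (tree_graph I r par))"
    by (rule vpath_up_down[OF t(1) s t'(1) s'(1,2) disj])
  have hd: "hd ?q = t"
  proof (cases s)
    case 0
    then show ?thesis using s' by (simp add: hd_rev)
  qed (simp add: hd_append upt_rec del: upt_Suc)
  have last: "last ?q = t'"
    by (simp add: last_rev hd_map del: upt_Suc)
  have in_bag: "v \<in> X j" if "j \<in> set ?q" for j using paths[OF path that] hd last t t' by auto
  have "s = 0"
  proof (rule ccontr)
    assume "s \<noteq> 0"
    have "par t \<in> set ?q"
    proof (cases "s = 1")
      case True
      have "(par ^^ s') t' \<in> set (rev (map (\<lambda>k. (par ^^ k) t') [0..<Suc s']))" by simp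
      then show ?thesis using s'(2) True by simp
    next
      case False
      hence "1 \<in> set [0..<s]" using \<open>s \<noteq> 0\<close> by auto
      hence "(par ^^ 1) t \<in> (\<lambda>k. (par ^^ k) t) ` set [0..<s]" by (rule imageI)
      thus ?thesis by simp
    qed
    moreover have "t \<noteq> r" using s \<open>s \<noteq> 0\<close> depth_r by auto
    ultimately show False using in_bag assms(1) by (auto simp: is_top_def)
  qed
  moreover have "s' = 0"
  proof (rule ccontr)
    assume "s' \<noteq> 0"
    hence "1 \<in> set [0..<Suc s']" by auto
    hence "(par ^^ 1) t' \<in> (\<lambda>k. (par ^^ k) t') ` set [0..<Suc s']" by (rule imageI)
    hence "par t' \<in> set ?q" unfolding set_append set_rev set_map by (intro UnI2) simp
    moreover have "t' \<noteq> r" using s' \<open>s' \<noteq> 0\<close> depth_r by auto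
    ultimately show False using in_bag assms(2) by (auto simp: is_top_def)
  qed
  ultimately show ?thesis using s'(2) by simp
qed

lemma is_top_above:
  assumes "i \<in> I" "v \<in> X i"
  shows "\<exists>s\<le>depth i. is_top v ((par ^^ s) i)"
proof -
  define s where "s = Max {s. s \<le> depth i \<and> v \<in> X ((par ^^ s) i)}"
  have ne: "0 \<in> {s. s \<le> depth i \<and> v \<in> X ((par ^^ s) i)}" using assms by simp
  have fin: "finite {s. s \<le> depth i \<and> v \<in> X ((par ^^ s) i)}" by simp
  have s: "s \<le> depth i" "v \<in> X ((par ^^ s) i)" using Max_in[OF fin] ne unfolding s_def by blast+
  have mx: "k \<le> s" if "k \<le> depth i" "v \<in> X ((par ^^ k) i)" for k
    unfolding s_def using that by (intro Max_ge fin) simp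
  have "(par ^^ s) i = r \<or> v \<notin> X (par ((par ^^ s) i))"
  proof (cases "s = depth i")
    case True
    then show ?thesis using pow_depth[OF assms(1)] by simp
  next
    case False
    hence "v \<notin> X ((par ^^ Suc s) i)" using mx[of "Suc s"] s by auto
    thus ?thesis by simp
  qed
  thus ?thesis using s pow_in[OF assms(1)] by (auto simp: is_top_def)
qed

definition top :: "nat \<Rightarrow> nat" where
  "top v = (THE t. is_top v t)"

lemma is_top_iff: "v < n \<Longrightarrow> is_top v t \<longleftrightarrow> t = top v"
proof -
  assume "v < n"
  then obtain i where "i \<in> I" "v \<in> X i" using cover by blast
  then obtain t0 where "is_top v t0" using is_top_above by blast
  moreover from this have "top v = t0" unfolding top_def using is_top_unique by blast
  ultimately show ?thesis using is_top_unique by blast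
qed

lemma top_in: "v < n \<Longrightarrow> top v \<in> I" and in_top: "v < n \<Longrightarrow> v \<in> X (top v)"
  using is_top_iff by (auto simp: is_top_def)

text \<open>The depth of the topmost bag, with ties broken by the number of the vertex.\<close>

definition key :: "nat \<Rightarrow> nat" where
  "key v = v + n * depth (top v)"

lemma key_inj: "u < n \<Longrightarrow> v < n \<Longrightarrow> key u = key v \<Longrightarrow> u = v"
  unfolding key_def by (metis mod_less mod_mult_self2)

lemma key_less_depth: "u < n \<Longrightarrow> v < n \<Longrightarrow> key u < key v \<Longrightarrow> depth (top u) \<le> depth (top v)"
proof (rule ccontr)
  assume "u < n" "v < n" "key u < key v" "\<not> depth (top u) \<le> depth (top v)"
  hence "n * Suc (depth (top v)) \<le> n * depth (top u)" by (intro mult_left_mono) auto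
  thus False using \<open>v < n\<close> \<open>key u < key v\<close> by (auto simp: key_def)
qed

lemma key_bound: "v < n \<Longrightarrow> key v < card I * n"
proof -
  assume v: "v < n"
  have "n * Suc (depth (top v)) \<le> n * card I"
    using depth_less[OF top_in[OF v]] by (intro mult_left_mono) auto
  thus ?thesis using v by (simp add: key_def mult.commute)
qed

text \<open>Turning all bags into cliques gives a chordal graph, for which decreasing
  \<open>key\<close> is a perfect elimination order; \<open>K v\<close> consists of the neighbours
  of \<open>v\<close> that are still present when \<open>v\<close> is eliminated.\<close>

definition K :: "nat \<Rightarrow> nat set" where
  "K v = {u \<in> X (top v). key u < key v}"

lemma K_lt: "v < n \<Longrightarrow> u \<in> K v \<Longrightarrow> u < n"
  using bag_subset[OF top_in[of v]] by (auto simp: K_def)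

text \<open>Both topmost nodes are ancestors of \<open>i\<close>, and that of \<open>w\<close> is
  not deeper than that of \<open>u\<close>. So the latter lies on the way from \<open>i\<close> to a
  node whose bag contains \<open>w\<close>, and its own bag contains \<open>w\<close>.\<close>

lemma common_bag:
  assumes "i \<in> I" "u \<in> X i" "w \<in> X i" "key w < key u"
  shows "w \<in> K u"
proof -
  have lt: "u < n" "w < n" using assms bag_subset by blast+
  obtain s where s: "s \<le> depth i" "top u = (par ^^ s) i" using is_top_above[OF assms(1,2)] is_top_iff lt by metis
  obtain s' where s': "s' \<le> depth i" "top w = (par ^^ s') i" using is_top_above[OF assms(1,3)] is_top_iff lt by metis
  have "depth (top w) \<le> depth (top u)" using key_less_depth lt assms(4) by blast
  hence "s \<le> s'" using s s' depth_pow[OF assms(1)] by auto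
  hence "w \<in> X ((par ^^ s) i)" using bag_up[OF assms(1) s'(1) _ assms(3)] in_top[OF lt(2)] s'(2) by simp
  thus ?thesis using assms(4) s(2) by (simp add: K_def)
qed

lemma K_edge: "adj u v \<Longrightarrow> key u < key v \<Longrightarrow> u \<in> K v"
  using edges[of u v] common_bag by blast

text \<open>All of \<open>K v\<close> lies in a single bag, the topmost bag of \<open>v\<close>; so
  summing out \<open>v\<close> creates no scope beyond those of the vertices eliminated
  later.\<close>

lemma K_clique: "v < n \<Longrightarrow> u \<in> K v \<Longrightarrow> w \<in> K v \<Longrightarrow> key w < key u \<Longrightarrow> w \<in> K u"
  using common_bag[OF top_in[of v]] by (auto simp: K_def)

lemma bag_card:
  assumes "width I X = p" "i \<in> I"
  shows "card (X i) \<le> p + 1"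
proof -
  have "card (X i) \<le> Max ((\<lambda>i. card (X i)) ` I)" using assms finite_I by (intro Max_ge) auto
  thus ?thesis using assms(1) by (simp add: width_def)
qed

text \<open>\<open>v\<close> itself takes one of the at most \<open>p + 1\<close> places of its
  topmost bag.\<close>

lemma K_card:
  assumes "width I X = p" "v < n"
  shows "card (insert v (K v)) \<le> p + 1" "card (K v) \<le> p"
proof -
  have fin: "finite (X (top v))" using bag_subset[OF top_in[OF assms(2)]] finite_subset by blast
  have sub: "insert v (K v) \<subseteq> X (top v)" using in_top[OF assms(2)] by (auto simp: K_def)
  show 1: "card (insert v (K v)) \<le> p + 1"
    using card_mono[OF fin sub] bag_card[OF assms(1) top_in[OF assms(2)]] by simp
  have "v \<notin> K v" by (simp add: K_def)
  thus "card (K v) \<le> p" using 1 finite_subset[OF sub fin] by simp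
qed

sublocale oriented_graph "{..<n}" adj K
proof
  fix u v assume "u \<in> {..<n}" "v \<in> {..<n}" "adj u v"
  thus "(u \<in> K v) \<noteq> (v \<in> K u)"
    using K_edge[of u v] K_edge[of v u] adj_sym[of u v] adj_irrefl[of u] key_inj[of u v]
    by (cases "key u" "key v" rule: linorder_cases) (auto simp: K_def)
qed (use adj_sym adj_irrefl K_lt in auto)

text \<open>A path on three vertices that avoids \<open>F\<close> amounts to a middle vertex outside
  \<open>F\<close> with two neighbours outside \<open>F\<close>.\<close>

lemma VCP3_iff: "VCP3_set G F \<longleftrightarrow> F \<subseteq> {..<n} \<and> (\<forall>v\<in>{..<n} - F. outdeg adj {..<n} F v \<le> 1)"
proof -
  have "(\<forall>p. vpath p (with_proj G) \<and> length p = 3 \<longrightarrow> set p \<inter> F \<noteq> {}) \<longleftrightarrow> (\<forall>v\<in>{..<n} - F. outdeg adj {..<n} F v \<le> 1)"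
    (is "?L \<longleftrightarrow> ?R")
  proof
    assume L: ?L
    show ?R
    proof (intro ballI, rule ccontr)
      fix v assume v: "v \<in> {..<n} - F" "\<not> outdeg adj {..<n} F v \<le> 1"
      define A where "A = {u \<in> {..<n} - F. adj v u}"
      have fin: "finite A" by (simp add: A_def)
      have "\<not> card A \<le> Suc 0" using v(2) by (simp add: outdeg_def A_def)
      then obtain a c where ac: "a \<in> A" "c \<in> A" "a \<noteq> c" using card_le_Suc0_iff_eq[OF fin] by blast
      have "a \<noteq> v" "c \<noteq> v" using ac adj_irrefl by (auto simp: A_def)
      moreover have "adj a v" "adj v c" using ac adj_sym by (auto simp: A_def)
      ultimately have "vpath [a, v, c] (with_proj G)"
        using ac v verts by (auto simp: vpath_def vwalk_def A_def adj_def)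
      with L[rule_format, of "[a, v, c]"] ac v show False by (auto simp: A_def)
    qed
  next
    assume R: ?R
    show ?L
    proof (intro allI impI notI)
      fix p assume p: "vpath p (with_proj G) \<and> length p = 3" "set p \<inter> F = {}"
      then obtain a b c where abc: "p = [a, b, c]" by (auto simp: numeral_3_eq_3 length_Suc_conv)
      have e: "adj a b" "adj b c" "a \<noteq> c" "a \<noteq> b" using p(1) by (auto simp: abc vpath_def vwalk_def adj_def)
      have "{a, c} \<subseteq> {u \<in> {..<n} - F. adj b u}" using e adj_sym[of a b] adj_verts[of a b] adj_verts[of b c] p(2) by (auto simp: abc)
      hence "card {a, c} \<le> card {u \<in> {..<n} - F. adj b u}" by (intro card_mono) auto
      hence "2 \<le> outdeg adj {..<n} F b" using e by (simp add: outdeg_def)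
      moreover have "b \<in> {..<n} - F" using adj_verts[of a b] e p(2) by (auto simp: abc)
      ultimately have "outdeg adj {..<n} F b \<le> 1" "2 \<le> outdeg adj {..<n} F b" using R by blast+
      thus False by simp
    qed
  qed
  thus ?thesis by (simp add: VCP3_set_def verts)
qed

text \<open>The digraph notion of connectedness rejects the empty graph, which
  \<open>connected_in\<close> accepts; nonemptiness of \<open>F\<close> bridges the gap.\<close>

lemma connected_iff:
  assumes "F \<noteq> {}"
  shows "Digraph_Component.connected (with_proj G \<restriction> F) \<longleftrightarrow> connected_in adj F"
proof -
  define R where "R = {(a, b). a \<in> F \<and> b \<in> F \<and> adj a b}"
  have arcs: "parcs (mk_symmetric (with_proj G \<restriction> F)) = R"
    unfolding mk_symmetric_def using adj_sym by (force simp: induce_subgraph_def R_def adj_def)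
  have "rtrancl_on F R = {(u, v) \<in> R\<^sup>*. u \<in> F \<and> v \<in> F}"
  proof safe
    fix u v assume "(u, v) \<in> rtrancl_on F R"
    thus "(u, v) \<in> R\<^sup>*" "u \<in> F" "v \<in> F" using rtrancl_on_rtranclI in_rtrancl_on_in_F by metis+
  next
    fix u v assume "(u, v) \<in> R\<^sup>*" "u \<in> F" "v \<in> F"
    thus "(u, v) \<in> rtrancl_on F R" by (rule rtrancl_consistent_rtrancl_on) (auto simp: R_def)
  qed
  moreover have "pverts (mk_symmetric (with_proj G \<restriction> F)) = F" by (simp add: mk_symmetric_def)
  ultimately show ?thesis using assms
    by (auto simp: Digraph_Component.connected_def strongly_connected_def reachable_def arcs connected_in_def R_def[symmetric])
qed

lemma constrained_iff:
  assumes "S \<noteq> {}"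
  shows "constrained_CVCP3 G S k \<longleftrightarrow> (\<exists>F\<in>solutions adj {..<n} S. int (card F) \<le> k)"
proof -
  have "VCP3_set G F \<and> int (card F) \<le> k \<and> S \<subseteq> F \<and> Digraph_Component.connected (with_proj G \<restriction> F) \<longleftrightarrow>
      F \<in> solutions adj {..<n} S \<and> int (card F) \<le> k" for F
  proof (cases "F = {}")
    case False
    thus ?thesis unfolding solutions_def mem_Collect_eq VCP3_iff connected_iff[OF False] by argo
  next
    case True
    hence "\<not> S \<subseteq> F" using assms by simp
    thus ?thesis unfolding solutions_def by blast
  qed
  thus ?thesis unfolding constrained_CVCP3_def by blast
qed

end

section \<open>Eliminating a vertex\<close>

text \<open>The state of \<open>v\<close> is the digit at position \<open>v\<close> in base 4. Every
  bag uses the same positions, so passing to a smaller set only deletes digits. Indices range up to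
  \<open>4^n\<close>, but only \<open>4^card A\<close> cells of a table are visited.\<close>

definition code :: "nat set \<Rightarrow> (nat \<Rightarrow> nat) \<Rightarrow> nat" where
  "code A \<sigma> = (\<Sum>v\<in>A. \<sigma> v * 4 ^ v)"

lemma code_cong: "(\<And>v. v \<in> A \<Longrightarrow> \<sigma> v = \<tau> v) \<Longrightarrow> code A \<sigma> = code A \<tau>"
  by (simp add: code_def)

lemma code_insert: "finite A \<Longrightarrow> v \<notin> A \<Longrightarrow> code (insert v A) \<sigma> = \<sigma> v * 4 ^ v + code A \<sigma>"
  by (simp add: code_def)

lemma code_Suc: "code (A \<inter> {..<Suc k}) \<sigma> = code (A \<inter> {..<k}) \<sigma> + (if k \<in> A then \<sigma> k * 4 ^ k else 0)"
proof (cases "k \<in> A")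
  case True
  hence "A \<inter> {..<Suc k} = insert k (A \<inter> {..<k})" by (auto simp: less_Suc_eq)
  with True show ?thesis by (simp add: code_insert)
next
  case False
  hence "A \<inter> {..<Suc k} = A \<inter> {..<k}" by (auto simp: less_Suc_eq)
  with False show ?thesis by simp
qed

lemma code_less: "\<sigma> \<in> conf UNIV \<Longrightarrow> code (A \<inter> {..<k}) \<sigma> < 4 ^ k"
proof (induction k)
  case (Suc k)
  have "\<sigma> k \<le> 3" using Suc.prems by (auto simp: conf_def less_Suc_eq_le numeral_eq_Suc)
  hence "\<sigma> k * 4 ^ k \<le> 3 * 4 ^ k" by simp
  with Suc.IH[OF Suc.prems] have "code (A \<inter> {..<k}) \<sigma> + \<sigma> k * 4 ^ k < 4 ^ Suc k"
    by (simp only: power_Suc)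
  thus ?case unfolding code_Suc by (cases "k \<in> A") auto
qed (simp add: code_def)

lemma code_less': "\<sigma> \<in> conf UNIV \<Longrightarrow> A \<subseteq> {..<n} \<Longrightarrow> code A \<sigma> < 4 ^ n"
  using code_less[of \<sigma> A n] by (simp add: Int_absorb2)

text \<open>The order is that of the list built by \<open>Extend\<close>: a new vertex appends three
  shifted copies of the list.\<close>

primrec codes :: "nat set \<Rightarrow> nat \<Rightarrow> nat list" where
  "codes A 0 = [0]"
| "codes A (Suc u) = (if u \<in> A then codes A u @ map (\<lambda>x. x + 4 ^ u) (codes A u) @
     map (\<lambda>x. x + 2 * 4 ^ u) (codes A u) @ map (\<lambda>x. x + 3 * 4 ^ u) (codes A u) else codes A u)"

lemma length_codes: "length (codes A u) = 4 ^ card (A \<inter> {..<u})"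
proof (induction u)
  case (Suc u)
  have "A \<inter> {..<Suc u} = (if u \<in> A then insert u (A \<inter> {..<u}) else A \<inter> {..<u})"
    by (auto simp: less_Suc_eq)
  with Suc show ?case by simp
qed simp

lemma set_codes: "set (codes A u) = code (A \<inter> {..<u}) ` conf UNIV"
proof (induction u)
  case 0
  have "(\<lambda>_. 0) \<in> conf UNIV" by (simp add: conf_def)
  thus ?case by (auto simp: code_def)
next
  case (Suc u)
  show ?case
  proof (cases "u \<in> A")
    case True
    have upd: "code (A \<inter> {..<u}) (\<sigma>(u := s)) = code (A \<inter> {..<u}) \<sigma>" for \<sigma> s by (rule code_cong) auto
    have "code (A \<inter> {..<Suc u}) ` conf UNIV = (\<Union>s<4. (\<lambda>x. x + s * 4 ^ u) ` code (A \<inter> {..<u}) ` conf UNIV)"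
    proof safe
      fix \<sigma> :: "nat \<Rightarrow> nat" assume "\<sigma> \<in> conf UNIV"
      thus "code (A \<inter> {..<Suc u}) \<sigma> \<in> (\<Union>s<4. (\<lambda>x. x + s * 4 ^ u) ` code (A \<inter> {..<u}) ` conf UNIV)"
        using True by (auto simp: code_Suc conf_def intro!: bexI[of _ "\<sigma> u"])
    next
      fix \<sigma> :: "nat \<Rightarrow> nat" and s :: nat assume "\<sigma> \<in> conf UNIV" "s < 4"
      hence "code (A \<inter> {..<u}) \<sigma> + s * 4 ^ u = code (A \<inter> {..<Suc u}) (\<sigma>(u := s))" "\<sigma>(u := s) \<in> conf UNIV"
        using True by (auto simp: code_Suc upd conf_def)
      thus "code (A \<inter> {..<u}) \<sigma> + s * 4 ^ u \<in> code (A \<inter> {..<Suc u}) ` conf UNIV" by blast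
    qed
    also have "\<dots> = set (codes A (Suc u))"
      using True Suc by (simp add: numeral_eq_Suc lessThan_Suc Un_ac)
    finally show ?thesis ..
  next
    case False
    hence "A \<inter> {..<Suc u} = A \<inter> {..<u}" by (auto simp: less_Suc_eq)
    with False Suc show ?thesis by simp
  qed
qed

lemma codes_less: "x \<in> set (codes A u) \<Longrightarrow> x < 4 ^ u"
  by (auto simp: set_codes code_less)

lemma distinct_codes: "distinct (codes A u)"
proof (induction u)
  case (Suc u)
  then show ?case using codes_less[of _ A u] by (fastforce simp: distinct_map inj_on_def)
qed simp

locale counting = decomposed +
  fixes S :: "nat set" and v0 :: nat and d :: int and x :: "nat \<Rightarrow> int"
begin

abbreviation lc :: "nat \<Rightarrow> (nat \<Rightarrow> nat) \<Rightarrow> int" where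
  "lc \<equiv> loc adj K S v0 d x"

text \<open>The scope of the table of \<open>u\<close>. The additional root \<open>n\<close> has an
  empty scope and thus a single entry.\<close>

definition bagset :: "nat \<Rightarrow> nat set" where
  "bagset u = (if u < n then insert u (K u) else {})"

text \<open>The memory holds the value minus one, since it is initially 0 and the empty product is 1. Index
  \<open>n\<close> stands for an additional root, which collects the messages of the vertices \<open>c\<close> with empty \<open>K c\<close>.\<close>

definition acc :: "(int \<Rightarrow> int) \<Rightarrow> nat \<Rightarrow> (nat \<Rightarrow> nat) \<Rightarrow> int" where
  "acc g u \<sigma> = g (int (u * 4 ^ n + code (bagset u) \<sigma>)) + 1"

text \<open>Summing over the state of \<open>c\<close> leaves a function of the states of
  \<open>K c\<close> only.\<close>

definition msg :: "(int \<Rightarrow> int) \<Rightarrow> nat \<Rightarrow> (nat \<Rightarrow> nat) \<Rightarrow> int" where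
  "msg g c \<sigma> = (\<Sum>s<4. lc c (\<sigma>(c := s)) * acc g c (\<sigma>(c := s)))"

text \<open>The partition function with the vertices outside \<open>U\<close> already summed out;
  their contributions sit in the tables. Elimination keeps this number unchanged.\<close>

definition total :: "nat set \<Rightarrow> (int \<Rightarrow> int) \<Rightarrow> int" where
  "total U g = (\<Sum>\<sigma>\<in>conf U. (\<Prod>u\<in>U. lc u \<sigma> * acc g u \<sigma>) * acc g n \<sigma>)"

text \<open>The parent in the elimination tree: the member of \<open>K c\<close> that is eliminated
  soonest after \<open>c\<close>, or the additional root.\<close>

definition is_parent :: "nat \<Rightarrow> nat \<Rightarrow> bool" where
  "is_parent c q \<longleftrightarrow> (K c = {} \<and> q = n) \<or> (q \<in> K c \<and> (\<forall>w\<in>K c. key w \<le> key q))"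

lemma bagset_subset: "bagset u \<subseteq> {..<n}"
  using K_lt by (auto simp: bagset_def)

lemma finite_bagset: "finite (bagset u)"
  using bagset_subset finite_subset by blast

lemma K_notin: "v \<notin> K v"
  by (simp add: K_def)

text \<open>All other members of \<open>K c\<close> have smaller keys than \<open>q\<close>, and by
  \<open>K_clique\<close> they lie in \<open>K q\<close>; so the message of \<open>c\<close> is a
  function on the scope of \<open>q\<close>.\<close>

lemma parent_bag: "c < n \<Longrightarrow> is_parent c q \<Longrightarrow> K c \<subseteq> bagset q"
proof
  fix w assume c: "c < n" "is_parent c q" and w: "w \<in> K c"
  hence q: "q \<in> K c" "key w \<le> key q" by (auto simp: is_parent_def)
  have "q < n" "w < n" using K_lt c w q by auto
  moreover have "w = q \<or> w \<in> K q"
    using K_clique[OF c(1) q(1) w] key_inj[of w q] q \<open>q < n\<close> \<open>w < n\<close> by (cases "key w = key q") auto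
  ultimately show "w \<in> bagset q" by (auto simp: bagset_def)
qed

lemma acc_cong: "(\<And>v. v \<in> bagset u \<Longrightarrow> \<sigma> v = \<tau> v) \<Longrightarrow> acc g u \<sigma> = acc g u \<tau>"
  using code_cong[of "bagset u" \<sigma> \<tau>] by (simp add: acc_def)

lemma lc_cong:
  assumes "\<And>v. v \<in> insert u (K u) \<Longrightarrow> \<sigma> v = \<tau> v"
  shows "lc u \<sigma> = lc u \<tau>"
proof -
  have u: "\<sigma> u = \<tau> u" using assms by simp
  have "(\<forall>v\<in>K u. adj u v \<longrightarrow> agree (\<tau> u) (\<sigma> v)) = (\<forall>v\<in>K u. adj u v \<longrightarrow> agree (\<tau> u) (\<tau> v))"
    using assms by auto
  moreover have "{v\<in>K u. adj u v \<and> \<sigma> v = 3} = {v\<in>K u. adj u v \<and> \<tau> v = 3}"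
    using assms by auto
  ultimately show ?thesis unfolding loc_def u by (simp only:)
qed

lemma msg_cong:
  assumes "\<And>v. v \<in> K c \<Longrightarrow> \<sigma> v = \<tau> v"
  shows "msg g c \<sigma> = msg g c \<tau>"
proof -
  have "lc c (\<sigma>(c := s)) = lc c (\<tau>(c := s))" for s by (rule lc_cong) (use assms in auto)
  moreover have "acc g c (\<sigma>(c := s)) = acc g c (\<tau>(c := s))" for s
    by (rule acc_cong) (use assms in \<open>auto simp: bagset_def split: if_splits\<close>)
  ultimately show ?thesis by (simp add: msg_def)
qed

lemma bagset_below: "c < n \<Longrightarrow> u \<le> n \<Longrightarrow> u \<noteq> c \<Longrightarrow> (u < n \<Longrightarrow> key u \<le> key c) \<Longrightarrow> c \<notin> bagset u"
  by (auto simp: bagset_def K_def)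

lemma conf_UNIV: "conf U \<subseteq> conf UNIV"
  by (auto simp: conf_def)

text \<open>Distributivity. Since \<open>c\<close> has the largest key of \<open>U\<close>, it lies
  in no other remaining scope, and the sum over its state can be drawn into the factor of
  \<open>c\<close>. The assumption on smaller keys guarantees that the parent is still present to
  receive the message.\<close>

lemma total_eliminate:
  assumes U: "finite U" "U \<subseteq> {..<n}" and c: "c \<in> U" "\<And>u. u \<in> U \<Longrightarrow> key u \<le> key c"
    and low: "\<And>u. u < n \<Longrightarrow> key u < key c \<Longrightarrow> u \<in> U" and q: "is_parent c q"
    and g': "\<And>u \<sigma>. u \<in> insert n (U - {c}) \<Longrightarrow> \<sigma> \<in> conf UNIV \<Longrightarrow>
       acc g' u \<sigma> = (if u = q then acc g q \<sigma> * msg g c \<sigma> else acc g u \<sigma>)"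
  shows "total (U - {c}) g' = total U g"
proof -
  define U' where "U' = U - {c}"
  have cn: "c < n" using c U by auto
  have U': "U = insert c U'" "c \<notin> U'" "finite U'" "n \<notin> U'" using c U by (auto simp: U'_def)
  have qU: "q \<in> insert n U'"
    using q low[of q] K_lt[OF cn, of q] by (auto simp: is_parent_def K_def U'_def)
  have out: "c \<notin> bagset u" if "u \<in> insert n U'" for u
    using that bagset_below[of c u] cn c(2)[of u] U by (auto simp: U'_def)
  have out_lc: "lc u (\<sigma>(c := s)) = lc u \<sigma>" if "u \<in> U'" for u \<sigma> s
  proof (rule lc_cong)
    fix v assume "v \<in> insert u (K u)"
    moreover have "insert u (K u) = bagset u" using that U by (auto simp: bagset_def U'_def)
    ultimately show "(\<sigma>(c := s)) v = \<sigma> v" using out that by auto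
  qed
  have out_acc: "acc g u (\<sigma>(c := s)) = acc g u \<sigma>" if "u \<in> insert n U'" for u \<sigma> s
    by (rule acc_cong) (use out that in auto)
  have "total U g = (\<Sum>\<sigma>\<in>conf U'. \<Sum>s<4. (\<Prod>u\<in>insert c U'. lc u (\<sigma>(c := s)) * acc g u (\<sigma>(c := s))) * acc g n (\<sigma>(c := s)))"
    unfolding total_def U'(1) by (rule sum_conf_insert[OF U'(2)])
  also have "\<dots> = (\<Sum>\<sigma>\<in>conf U'. msg g c \<sigma> * ((\<Prod>u\<in>U'. lc u \<sigma> * acc g u \<sigma>) * acc g n \<sigma>))"
  proof (rule sum.cong[OF refl])
    fix \<sigma> assume "\<sigma> \<in> conf U'"
    have "(\<Prod>u\<in>insert c U'. lc u (\<sigma>(c := s)) * acc g u (\<sigma>(c := s))) * acc g n (\<sigma>(c := s)) =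
        lc c (\<sigma>(c := s)) * acc g c (\<sigma>(c := s)) * ((\<Prod>u\<in>U'. lc u \<sigma> * acc g u \<sigma>) * acc g n \<sigma>)" for s
    proof -
      have "(\<Prod>u\<in>U'. lc u (\<sigma>(c := s)) * acc g u (\<sigma>(c := s))) = (\<Prod>u\<in>U'. lc u \<sigma> * acc g u \<sigma>)"
        by (intro prod.cong refl) (simp add: out_lc out_acc)
      thus ?thesis using U' by (simp add: out_acc)
    qed
    thus "(\<Sum>s<4. (\<Prod>u\<in>insert c U'. lc u (\<sigma>(c := s)) * acc g u (\<sigma>(c := s))) * acc g n (\<sigma>(c := s))) =
        msg g c \<sigma> * ((\<Prod>u\<in>U'. lc u \<sigma> * acc g u \<sigma>) * acc g n \<sigma>)"
      by (simp only: msg_def sum_distrib_right)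
  qed
  also have "\<dots> = (\<Sum>\<sigma>\<in>conf U'. (\<Prod>u\<in>U'. lc u \<sigma> * acc g' u \<sigma>) * acc g' n \<sigma>)"
  proof (rule sum.cong[OF refl])
    fix \<sigma> assume "\<sigma> \<in> conf U'"
    hence \<sigma>: "\<sigma> \<in> conf UNIV" using conf_UNIV by blast
    have g: "acc g' u \<sigma> = (if u = q then acc g q \<sigma> * msg g c \<sigma> else acc g u \<sigma>)" if "u \<in> insert n U'" for u
      using g' that \<sigma> by (simp add: U'_def)
    show "msg g c \<sigma> * ((\<Prod>u\<in>U'. lc u \<sigma> * acc g u \<sigma>) * acc g n \<sigma>) = (\<Prod>u\<in>U'. lc u \<sigma> * acc g' u \<sigma>) * acc g' n \<sigma>"
    proof (cases "q = n")
      case True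
      have "(\<Prod>u\<in>U'. lc u \<sigma> * acc g' u \<sigma>) = (\<Prod>u\<in>U'. lc u \<sigma> * acc g u \<sigma>)"
        using True U' by (intro prod.cong refl) (auto simp: g)
      with True show ?thesis by (simp add: g)
    next
      case False
      hence qU': "q \<in> U'" using qU by simp
      have "(\<Prod>u\<in>U' - {q}. lc u \<sigma> * acc g' u \<sigma>) = (\<Prod>u\<in>U' - {q}. lc u \<sigma> * acc g u \<sigma>)"
        by (intro prod.cong refl) (auto simp: g)
      with False show ?thesis using U' qU' by (simp add: prod.remove[OF U'(3) qU'] g)
    qed
  qed
  finally show ?thesis by (simp add: total_def U'_def)
qed

text \<open>\<open>a u\<close> counts the eliminated vertices whose factors have reached the table
  of \<open>u\<close>. Each of them accounts for a factor of at most \<open>Q\<close>, so no entry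
  ever exceeds \<open>Q^n\<close>.\<close>

definition bounded :: "int \<Rightarrow> nat set \<Rightarrow> (int \<Rightarrow> int) \<Rightarrow> bool" where
  "bounded Q U g \<longleftrightarrow> (\<exists>a. (\<forall>u\<in>insert n U. \<forall>\<sigma>\<in>conf UNIV. 0 \<le> acc g u \<sigma> \<and> acc g u \<sigma> \<le> Q ^ a u) \<and>
     (\<Sum>u\<in>insert n U. a u) + card U = n)"

lemma bounded_le:
  assumes "bounded Q U g" "u \<in> insert n U" "\<sigma> \<in> conf UNIV" "1 \<le> Q" "finite U"
  shows "0 \<le> acc g u \<sigma>" "acc g u \<sigma> \<le> Q ^ n"
proof -
  obtain a where a: "\<forall>u\<in>insert n U. \<forall>\<sigma>\<in>conf UNIV. 0 \<le> acc g u \<sigma> \<and> acc g u \<sigma> \<le> Q ^ a u"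
    "(\<Sum>u\<in>insert n U. a u) + card U = n" using assms(1) by (auto simp: bounded_def)
  have "a u \<le> (\<Sum>u\<in>insert n U. a u)" using assms by (intro member_le_sum) auto
  hence "Q ^ a u \<le> Q ^ n" using assms a by (intro power_increasing) auto
  with a assms show "0 \<le> acc g u \<sigma>" "acc g u \<sigma> \<le> Q ^ n" by (blast, meson order_trans)
qed

text \<open>The factor 4 in the bound on \<open>lc c \<sigma>\<close> pays for the sum over four
  states, so that a message costs at most one further factor \<open>Q\<close>.\<close>

lemma bounded_eliminate:
  assumes b: "bounded Q U g" and U: "finite U" "U \<subseteq> {..<n}" and c: "c \<in> U"
    and low: "\<And>u. u < n \<Longrightarrow> key u < key c \<Longrightarrow> u \<in> U" and q: "is_parent c q"
    and lc: "\<And>\<sigma>. \<sigma> \<in> conf UNIV \<Longrightarrow> 0 \<le> lc c \<sigma> \<and> 4 * lc c \<sigma> \<le> Q" and Q: "1 \<le> Q"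
    and g': "\<And>u \<sigma>. u \<in> insert n (U - {c}) \<Longrightarrow> \<sigma> \<in> conf UNIV \<Longrightarrow>
       acc g' u \<sigma> = (if u = q then acc g q \<sigma> * msg g c \<sigma> else acc g u \<sigma>)"
  shows "bounded Q (U - {c}) g'"
proof -
  obtain a where a: "\<And>u \<sigma>. u \<in> insert n U \<Longrightarrow> \<sigma> \<in> conf UNIV \<Longrightarrow> 0 \<le> acc g u \<sigma> \<and> acc g u \<sigma> \<le> Q ^ a u"
    "(\<Sum>u\<in>insert n U. a u) + card U = n" using b unfolding bounded_def by blast
  have cn: "c < n" using c U by auto
  have qU: "q \<in> insert n (U - {c})"
    using q low[of q] K_lt[OF cn, of q] by (auto simp: is_parent_def K_def)
  have msg: "0 \<le> msg g c \<sigma> \<and> msg g c \<sigma> \<le> Q ^ (a c + 1)" if \<sigma>: "\<sigma> \<in> conf UNIV" for \<sigma>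
  proof -
    have t: "0 \<le> lc c (\<sigma>(c := s)) * acc g c (\<sigma>(c := s)) \<and>
        4 * (lc c (\<sigma>(c := s)) * acc g c (\<sigma>(c := s))) \<le> Q ^ (a c + 1)" if "s < 4" for s
    proof -
      have s: "\<sigma>(c := s) \<in> conf UNIV" using \<sigma> that by (auto simp: conf_def)
      have l: "0 \<le> lc c (\<sigma>(c := s))" "4 * lc c (\<sigma>(c := s)) \<le> Q" using lc[OF s] by auto
      have g: "0 \<le> acc g c (\<sigma>(c := s))" "acc g c (\<sigma>(c := s)) \<le> Q ^ a c" using a(1)[of c, OF _ s] c by auto
      have "(4 * lc c (\<sigma>(c := s))) * acc g c (\<sigma>(c := s)) \<le> Q * Q ^ a c"
        using l g Q by (intro mult_mono) auto
      thus ?thesis using l g by (simp add: mult.assoc)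
    qed
    have "4 * msg g c \<sigma> = (\<Sum>s<4. 4 * (lc c (\<sigma>(c := s)) * acc g c (\<sigma>(c := s))))"
      by (simp only: msg_def sum_distrib_left)
    also have "\<dots> \<le> (\<Sum>s<(4::nat). Q ^ (a c + 1))" using t by (intro sum_mono) auto
    finally show ?thesis using t unfolding msg_def by (auto intro: sum_nonneg)
  qed
  \<comment> \<open>The parent inherits the count of \<open>c\<close>, and \<open>c\<close> itself
    is added.\<close>
  define a' where "a' = a(q := a q + (a c + 1))"
  have "0 \<le> acc g' u \<sigma> \<and> acc g' u \<sigma> \<le> Q ^ a' u" if u: "u \<in> insert n (U - {c})" and \<sigma>: "\<sigma> \<in> conf UNIV" for u \<sigma>
  proof (cases "u = q")
    case True
    have "acc g q \<sigma> * msg g c \<sigma> \<le> Q ^ a q * Q ^ (a c + 1)"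
      using a(1)[of q \<sigma>] qU msg[OF \<sigma>] \<sigma> Q by (intro mult_mono) auto
    moreover have "0 \<le> acc g q \<sigma> * msg g c \<sigma>" using a(1)[of q \<sigma>] qU msg[OF \<sigma>] \<sigma> by auto
    ultimately show ?thesis using True g'[OF u \<sigma>] by (simp add: a'_def power_add mult.left_commute)
  next
    case False
    with g'[OF u \<sigma>] a(1)[of u \<sigma>] u \<sigma> show ?thesis by (auto simp: a'_def)
  qed
  moreover have "(\<Sum>u\<in>insert n (U - {c}). a' u) + card (U - {c}) = n"
  proof -
    have fin: "finite (insert n (U - {c}))" using U by simp
    have "(\<Sum>u\<in>insert n (U - {c}). a' u) = a' q + (\<Sum>u\<in>insert n (U - {c}) - {q}. a' u)"
      by (rule sum.remove[OF fin qU])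
    also have "(\<Sum>u\<in>insert n (U - {c}) - {q}. a' u) = (\<Sum>u\<in>insert n (U - {c}) - {q}. a u)"
      by (rule sum.cong) (auto simp: a'_def)
    also have "a' q + (\<Sum>u\<in>insert n (U - {c}) - {q}. a u) = (a c + 1) + (\<Sum>u\<in>insert n (U - {c}). a u)"
      by (simp only: sum.remove[OF fin qU, of a]) (simp add: a'_def)
    finally have "(\<Sum>u\<in>insert n (U - {c}). a' u) = (a c + (\<Sum>u\<in>insert n (U - {c}). a u)) + 1" by simp
    moreover have "(\<Sum>u\<in>insert n U. a u) = a c + (\<Sum>u\<in>insert n (U - {c}). a u)"
    proof -
      have "insert n U - {c} = insert n (U - {c})" using cn by auto
      thus ?thesis using sum.remove[of "insert n U" c a] U c by simp
    qed
    moreover have "card U = Suc (card (U - {c}))" using U(1) c by (rule card.remove)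
    ultimately show ?thesis using a(2) by simp
  qed
  ultimately show ?thesis unfolding bounded_def by blast
qed

lemma initial:
  shows "total {..<n} (\<lambda>_. 0) = (\<Sum>\<sigma>\<in>conf {..<n}. \<Prod>c<n. lc c \<sigma>)" "bounded Q {..<n} (\<lambda>_. 0)"
proof -
  show "total {..<n} (\<lambda>_. 0) = (\<Sum>\<sigma>\<in>conf {..<n}. \<Prod>c<n. lc c \<sigma>)" by (simp add: total_def acc_def)
  show "bounded Q {..<n} (\<lambda>_. 0)" unfolding bounded_def by (rule exI[of _ "\<lambda>_. 0"]) (simp add: acc_def)
qed

lemma final: "total {} g = g (int (n * 4 ^ n)) + 1"
  by (simp add: total_def conf_empty acc_def bagset_def code_def)

end

section \<open>Derived instructions and binary multiplication\<close>

lemma upd_apply [simp]: "upd s x i v y j = (if y = x \<and> j = i then v else s y j)"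
  by (simp add: upd_def)

lemma upd_other [simp]: "y \<noteq> x \<Longrightarrow> upd s x i v y = s y"
  by (simp add: upd_def)

abbreviation Le :: "aexp \<Rightarrow> aexp \<Rightarrow> bexp" where "Le a b \<equiv> Neg (Less b a)"

abbreviation Pos :: "aexp \<Rightarrow> bexp" where "Pos a \<equiv> Less (Const 0) a"

abbreviation If_then :: "bexp \<Rightarrow> com \<Rightarrow> com" where "If_then b c \<equiv> IfElse b c Skip"

abbreviation Incr :: "string \<Rightarrow> aexp \<Rightarrow> com" where "Incr x e \<equiv> x ::= Add (Var x) e"

abbreviation Double :: "aexp \<Rightarrow> aexp" where "Double a \<equiv> Add a a"

text \<open>Repeated addition, linear in the value of \<open>e\<close>, and hence suitable for
  multipliers of order \<open>n\<close> only. Table entries are multiplied by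
  \<open>Mul\<close>.\<close>

definition Times :: "string \<Rightarrow> aexp \<Rightarrow> aexp \<Rightarrow> com" where
  "Times z a e = z ::= Const 0 ;; For ''it'' e (Incr z a)"

text \<open>Tabulated multiples replace products in address computations. Entry 0 is left to the
  cleared memory.\<close>

definition Table :: "string \<Rightarrow> aexp \<Rightarrow> aexp \<Rightarrow> com" where
  "Table z a e = For ''it'' e (Assign z (Add (Var ''it'') (Const 1)) (Add (Cell z (Var ''it'')) a))"

lemma writes_Times [simp]: "writes (Times z a e) = {z, ''it''}"
  by (auto simp: Times_def)

lemma writes_Table [simp]: "writes (Table z a e) = {z, ''it''}"
  by (auto simp: Table_def)

lemma wp_Times:
  assumes a: "\<And>s'. same {z, ''it''} s s' \<Longrightarrow> aval a s' = x" and e: "\<And>s'. same {z, ''it''} s s' \<Longrightarrow> aval e s' = int m"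
    and z: "z \<noteq> ''it''"
  shows "wp (m * 5 + 5) (Times z a e) (\<lambda>s'. s' z 0 = x * int m) s"
proof -
  have "wp (m * (1 + 4) + 3) (For ''it'' e (Incr z a)) (\<lambda>s'. s' z 0 = x * int m) (upd s z 0 0)"
  proof (rule wp_For[where I = "\<lambda>k s'. s' z 0 = x * int k"])
    fix s' assume "same (insert ''it'' (writes (Incr z a))) (upd s z 0 0) s'"
    thus "aval e s' = int m" by (intro e) (auto simp: same_def upd_def)
  next
    fix k s' assume *: "s' z 0 = x * int k" "same (insert ''it'' (writes (Incr z a))) (upd s z 0 0) s'"
    have "aval a s' = x" using *(2) by (intro a) (auto simp: same_def upd_def)
    thus "wp 1 (Incr z a) (\<lambda>s'. upd s' ''it'' 0 (int (Suc k)) z 0 = x * int (Suc k)) s'"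
      using * z by (intro wp_simple) (auto simp: algebra_simps)
  qed (use z in auto)
  hence "wp 1 (z ::= Const 0) (wp (m * 5 + 3) (For ''it'' e (Incr z a)) (\<lambda>s'. s' z 0 = x * int m)) s"
    by (intro wp_Assign) simp
  from wp_Then[OF this] show ?thesis unfolding Times_def by (rule wp_conseq) auto
qed

lemma wp_Table:
  assumes a: "\<And>s'. same {z, ''it''} s s' \<Longrightarrow> aval a s' = x" and e: "\<And>s'. same {z, ''it''} s s' \<Longrightarrow> aval e s' = int m"
    and z: "z \<noteq> ''it''" and s: "s z 0 = 0"
  shows "wp (m * 5 + 3) (Table z a e) (\<lambda>s'. \<forall>j\<le>m. s' z (int j) = int j * x) s"
proof -
  have "wp (m * (1 + 4) + 3) (Table z a e) (\<lambda>s'. \<forall>j\<le>m. s' z (int j) = int j * x) s"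
    unfolding Table_def
  proof (rule wp_For[where I = "\<lambda>k s'. \<forall>j\<le>k. s' z (int j) = int j * x"])
    fix s' assume "same (insert ''it'' (writes (Assign z (Add (Var ''it'') (Const 1)) (Add (Cell z (Var ''it'')) a)))) s s'"
    thus "aval e s' = int m" by (intro e) (auto simp: same_def insert_commute)
  next
    fix k s' assume *: "\<forall>j\<le>k. s' z (int j) = int j * x" "s' ''it'' 0 = int k"
      "same (insert ''it'' (writes (Assign z (Add (Var ''it'') (Const 1)) (Add (Cell z (Var ''it'')) a)))) s s'"
    have "aval a s' = x" using *(3) by (intro a) (auto simp: same_def insert_commute)
    thus "wp 1 (Assign z (Add (Var ''it'') (Const 1)) (Add (Cell z (Var ''it'')) a))
       (\<lambda>s'. \<forall>j\<le>Suc k. upd s' ''it'' 0 (int (Suc k)) z (int j) = int j * x) s'"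
      using * z by (intro wp_simple) (auto simp: algebra_simps le_Suc_eq)
  qed (use z s in auto)
  thus ?thesis by simp
qed

text \<open>Doubling and adding, from the most significant bit of \<open>mb\<close> downwards. Bits
  are found by comparison with the tabulated powers, since the machine has no shift; the time is
  linear in \<open>L\<close>.\<close>

definition Mul :: com where
  "Mul = ''mr'' ::= Const 0 ;;
    For ''mi'' (Add (Var ''L'') (Const 1)) (
      Incr ''mr'' (Var ''mr'') ;;
      ''mh'' ::= Sub (Var ''L'') (Var ''mi'') ;;
      If_then (Le (Cell ''pw'' (Var ''mh'')) (Var ''mb''))
        (Incr ''mb'' (Sub (Const 0) (Cell ''pw'' (Var ''mh''))) ;; Incr ''mr'' (Var ''ma'')))"

lemma writes_Mul [simp]: "writes Mul = {''mr'', ''mi'', ''mh'', ''mb''}"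
  by (auto simp: Mul_def)

text \<open>Lowering the splitting position by one moves the top bit of the remainder to the
  quotient.\<close>

lemma digit_step:
  fixes b :: int
  shows "2 ^ h \<le> b mod 2 ^ Suc h \<Longrightarrow> b mod 2 ^ h = b mod 2 ^ Suc h - 2 ^ h \<and> b div 2 ^ h = 2 * (b div 2 ^ Suc h) + 1"
    and "\<not> 2 ^ h \<le> b mod 2 ^ Suc h \<Longrightarrow> b mod 2 ^ h = b mod 2 ^ Suc h \<and> b div 2 ^ h = 2 * (b div 2 ^ Suc h)"
proof -
  define q r where "q = b div 2 ^ Suc h" and "r = b mod 2 ^ Suc h"
  have b: "b = q * 2 ^ Suc h + r" by (simp only: q_def r_def div_mult_mod_eq)
  have r: "0 \<le> r" "r < 2 ^ Suc h" by (simp_all add: r_def del: power_Suc)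
  show "b mod 2 ^ h = b mod 2 ^ Suc h - 2 ^ h \<and> b div 2 ^ h = 2 * (b div 2 ^ Suc h) + 1" if "2 ^ h \<le> b mod 2 ^ Suc h"
    using int_div_pos_eq[of b "2 ^ h" "2 * q + 1" "r - 2 ^ h"] int_mod_pos_eq[of b "2 ^ h" "2 * q + 1" "r - 2 ^ h"] that r b
    unfolding q_def[symmetric] r_def[symmetric] by (simp add: algebra_simps)
  show "b mod 2 ^ h = b mod 2 ^ Suc h \<and> b div 2 ^ h = 2 * (b div 2 ^ Suc h)" if "\<not> 2 ^ h \<le> b mod 2 ^ Suc h"
    using int_div_pos_eq[of b "2 ^ h" "2 * q" r] int_mod_pos_eq[of b "2 ^ h" "2 * q" r] that r b
    unfolding q_def[symmetric] r_def[symmetric] by (simp add: algebra_simps)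
qed

definition powers :: "nat \<Rightarrow> store \<Rightarrow> bool" where
  "powers L s \<longleftrightarrow> s ''L'' 0 = int L \<and> (\<forall>i\<le>L. s ''pw'' (int i) = 2 ^ i)"

lemma wp_Mul:
  assumes p: "powers L s" and b: "0 \<le> s ''mb'' 0" "s ''mb'' 0 \<le> 2 ^ L"
  shows "wp (13 * L + 20) Mul (\<lambda>s'. s' ''mr'' 0 = s ''ma'' 0 * s ''mb'' 0) s"
proof -
  define a b where "a = s ''ma'' 0" and "b = s ''mb'' 0"
  let ?body = "Incr ''mr'' (Var ''mr'') ;;
      ''mh'' ::= Sub (Var ''L'') (Var ''mi'') ;;
      If_then (Le (Cell ''pw'' (Var ''mh'')) (Var ''mb''))
        (Incr ''mb'' (Sub (Const 0) (Cell ''pw'' (Var ''mh''))) ;; Incr ''mr'' (Var ''ma''))"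
  let ?I = "\<lambda>k s'. s' ''mr'' 0 = a * (b div 2 ^ (L + 1 - k)) \<and> s' ''mb'' 0 = b mod 2 ^ (L + 1 - k)"
  let ?s = "upd s ''mr'' 0 0"
  have "wp ((L + 1) * (8 + 4) + 3) (For ''mi'' (Add (Var ''L'') (Const 1)) ?body) (\<lambda>s'. s' ''mr'' 0 = a * b) ?s"
  proof (rule wp_For[where I = ?I])
    \<comment> \<open>The bound on \<open>mb\<close> is not strict, so position \<open>L\<close>
      itself can be occupied and \<open>L + 1\<close> rounds are made.\<close>
    have "(2::int) ^ L < 2 ^ (L + 1)" by simp
    with b(2) have "b < 2 ^ (L + 1)" unfolding b_def by (rule le_less_trans)
    thus "?I 0 (upd ?s ''mi'' 0 0)" using b by (simp add: b_def[symmetric] del: power_Suc)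
  next
    fix s' assume "same (insert ''mi'' (writes ?body)) ?s s'"
    thus "aval (Add (Var ''L'') (Const 1)) s' = int (L + 1)" using p by (simp add: same_def powers_def)
  next
    fix k s' assume k: "k < L + 1" and I: "?I k s'" "s' ''mi'' 0 = int k" and sm: "same (insert ''mi'' (writes ?body)) ?s s'"
    define h where "h = L - k"
    have h: "L + 1 - k = Suc h" "L + 1 - Suc k = h" "h \<le> L" "int L - int k = int h" using k by (auto simp: h_def)
    have fr: "s' ''L'' 0 = int L" "s' ''pw'' (int h) = 2 ^ h" "s' ''ma'' 0 = a"
      using sm p h by (auto simp: same_def powers_def a_def upd_def)
    have I: "s' ''mr'' 0 = a * (b div 2 ^ Suc h)" "s' ''mb'' 0 = b mod 2 ^ Suc h" "s' ''mi'' 0 = int k"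
      using I by (simp_all only: h)
    show "wp 8 ?body (\<lambda>s'. ?I (Suc k) (upd s' ''mi'' 0 (int (Suc k)))) s'"
    proof (cases "2 ^ h \<le> b mod 2 ^ Suc h")
      case True
      show ?thesis
        by (rule wp_simple)
           (use True digit_step(1)[OF True] in \<open>simp_all add: I fr h(2,4) h_def[symmetric] algebra_simps del: power_Suc\<close>)
    next
      case False
      show ?thesis
        by (rule wp_simple)
           (use False digit_step(2)[OF False] in \<open>simp_all add: I fr h(2,4) h_def[symmetric] algebra_simps del: power_Suc\<close>)
    qed
  next
    fix s' assume "?I (L + 1) s'"
    thus "s' ''mr'' 0 = a * b" by simp
  qed auto
  hence "wp 1 (''mr'' ::= Const 0) (wp (12 * L + 15) (For ''mi'' (Add (Var ''L'') (Const 1)) ?body) (\<lambda>s'. s' ''mr'' 0 = a * b)) s"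
    by (intro wp_Assign) (simp add: algebra_simps)
  from wp_Then[OF this] show ?thesis unfolding Mul_def a_def b_def by (rule wp_conseq) auto
qed

section \<open>The elimination program\<close>

text \<open>A local factor is 0, a power of two or \<open>d - 1\<close>. It is therefore represented
  by a flag \<open>zf\<close> for zero and an exponent \<open>e\<close>, and becomes a number by one
  access to \<open>pw\<close> at the end.\<close>

definition Local_init :: com where
  "Local_init =
    (''zf'' ::= Const 0 ;; ''e'' ::= Const 0 ;;
     IfElse (Less (Var ''st'') (Const 2))
       (''e'' ::= Cell ''xe'' (Var ''c'') ;;
        If_then (Conj (Pos (Var ''st'')) (Conj (Le (Var ''c'') (Var ''v0'')) (Le (Var ''v0'') (Var ''c''))))
          (''zf'' ::= Const 1))
       (If_then (Pos (Cell ''S'' (Var ''c''))) (''zf'' ::= Const 1) ;;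
        If_then (Less (Var ''st'') (Const 3)) (''e'' ::= Var ''bD'')))"

definition Local_step :: com where
  "Local_step =
    If_then (Conj (Pos (Cell ''kf'' (Var ''u''))) (Pos (Cell ''adj'' (Add (Cell ''arow'' (Var ''c'')) (Var ''u'')))))
      (IfElse (Less (Var ''st'') (Const 2))
        (If_then (Conj (Less (Cell ''sig'' (Var ''u'')) (Const 2))
            (Neg (Conj (Le (Var ''st'') (Cell ''sig'' (Var ''u''))) (Le (Cell ''sig'' (Var ''u'')) (Var ''st'')))))
          (''zf'' ::= Const 1))
        (If_then (Less (Const 1) (Cell ''sig'' (Var ''u'')))
          (IfElse (Conj (Less (Const 2) (Var ''st'')) (Less (Const 2) (Cell ''sig'' (Var ''u''))))
            (Incr ''e'' (Double (Var ''bD''))) (''zf'' ::= Const 1))))"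

definition Local_final :: com where
  "Local_final =
    IfElse (Pos (Var ''zf'')) (''loc'' ::= Const 0)
      (''loc'' ::= Cell ''pw'' (Var ''e'') ;;
       If_then (Conj (Less (Const 1) (Var ''st'')) (Less (Var ''st'') (Const 3))) (Incr ''loc'' (Const (-1))))"

definition Local :: com where
  "Local = Local_init ;; For ''u'' (Var ''n'') Local_step ;; Local_final"

text \<open>Moves one unit of the base 4 digit at \<open>vv\<close> from \<open>z\<close> to
  \<open>sig\<close>; three repetitions exhaust a digit. In \<open>y\<close> only the digits of
  \<open>K c\<close> are collected, which gives the index without the other vertices of the
  bag.\<close>

definition Digit :: com where
  "Digit =
    If_then (Le (Cell ''pw'' (Double (Var ''vv''))) (Var ''z''))
      (Incr ''z'' (Sub (Const 0) (Cell ''pw'' (Double (Var ''vv'')))) ;;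
       Assign ''sig'' (Var ''vv'') (Add (Cell ''sig'' (Var ''vv'')) (Const 1)) ;;
       If_then (Pos (Cell ''kf'' (Var ''vv''))) (Incr ''y'' (Cell ''pw'' (Double (Var ''vv'')))))"

definition Decode :: com where
  "Decode =
    (''z'' ::= Var ''x'' ;; ''y'' ::= Const 0) ;;
    For ''i'' (Var ''n'')
      (''vv'' ::= Sub (Sub (Var ''n'') (Const 1)) (Var ''i'') ;;
       Assign ''sig'' (Var ''vv'') (Const 0) ;; Digit ;; Digit ;; Digit)"

text \<open>Adding \<open>4^c\<close> to \<open>y\<close> advances the digit of \<open>c\<close>, so
  the four rounds visit the four extensions of the configuration in the table of
  \<open>c\<close>.\<close>

definition Message :: com where
  "Message =
    ''val'' ::= Const 0 ;;
    For ''st'' (Const 4)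
      (Local ;;
       (''ma'' ::= Var ''loc'' ;;
        ''mb'' ::= Add (Cell ''acc'' (Add (Cell ''off'' (Var ''c'')) (Var ''y''))) (Const 1)) ;;
       Mul ;;
       (Incr ''val'' (Var ''mr'') ;; Incr ''y'' (Cell ''pw'' (Double (Var ''c'')))))"

definition Update :: com where
  "Update =
    ''x'' ::= Cell ''cfg'' (Var ''j'') ;; Decode ;; Message ;;
    (''ma'' ::= Var ''val'' ;;
     ''mb'' ::= Add (Cell ''acc'' (Add (Cell ''off'' (Var ''pr'')) (Var ''x''))) (Const 1)) ;;
    Mul ;;
    Assign ''acc'' (Add (Cell ''off'' (Var ''pr'')) (Var ''x'')) (Sub (Var ''mr'') (Const 1))"

text \<open>\<open>lim\<close> is the key of the vertex eliminated last, so the remaining vertices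
  are those with keys below \<open>lim\<close> and no list of them has to be kept. The value -1 lies
  below all their keys.\<close>

definition Select :: com where
  "Select =
    ''best'' ::= Const (-1) ;;
    For ''v'' (Var ''n'')
      (If_then (Conj (Less (Var ''best'') (Cell ''key'' (Var ''v''))) (Less (Cell ''key'' (Var ''v'')) (Var ''lim'')))
        (''c'' ::= Var ''v'' ;; ''best'' ::= Cell ''key'' (Var ''v''))) ;;
    ''lim'' ::= Var ''best''"

text \<open>If \<open>K c\<close> is empty, the initial value \<open>n\<close> of \<open>pr\<close>
  survives, which is the additional root.\<close>

definition Parent :: com where
  "Parent =
    (''best'' ::= Const (-1) ;; ''pr'' ::= Var ''n'') ;;
    For ''v'' (Var ''n'')
      (Assign ''kf'' (Var ''v'') (Const 0) ;;
       If_then (Conj (Pos (Cell ''bag'' (Add (Cell ''row'' (Cell ''top'' (Var ''c''))) (Var ''v''))))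
           (Less (Cell ''key'' (Var ''v'')) (Cell ''key'' (Var ''c''))))
        (Assign ''kf'' (Var ''v'') (Const 1) ;;
         If_then (Less (Var ''best'') (Cell ''key'' (Var ''v'')))
           (''pr'' ::= Var ''v'' ;; ''best'' ::= Cell ''key'' (Var ''v''))))"

definition Extend :: com where
  "Extend =
    For ''i'' (Var ''len'')
      (''z'' ::= Add (Cell ''cfg'' (Var ''i'')) (Cell ''pw'' (Double (Var ''v''))) ;;
       Assign ''cfg'' (Add (Var ''len'') (Var ''i'')) (Var ''z'') ;;
       Incr ''z'' (Cell ''pw'' (Double (Var ''v''))) ;;
       Assign ''cfg'' (Add (Double (Var ''len'')) (Var ''i'')) (Var ''z'') ;;
       Incr ''z'' (Cell ''pw'' (Double (Var ''v''))) ;;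
       Assign ''cfg'' (Add (Add (Double (Var ''len'')) (Var ''len'')) (Var ''i'')) (Var ''z'')) ;;
    ''len'' ::= Double (Double (Var ''len''))"

text \<open>For the additional root the stored key is -1, so that the second test fails for every
  vertex and only the empty configuration is listed, whatever the other test reads.\<close>

definition Enumerate :: com where
  "Enumerate =
    (Assign ''cfg'' (Const 0) (Const 0) ;; ''len'' ::= Const 1) ;;
    For ''v'' (Var ''n'')
      (If_then (Conj (Pos (Cell ''bag'' (Add (Cell ''row'' (Cell ''top'' (Var ''pr''))) (Var ''v''))))
           (Le (Cell ''key'' (Var ''v'')) (Cell ''key'' (Var ''pr''))))
        Extend)"

definition Eliminate :: com where
  "Eliminate = Select ;; Parent ;; Enumerate ;; For ''j'' (Var ''len'') Update"

lemmas com_defs = Local_init_def Local_step_def Local_final_def Local_def Digit_def Decode_def Message_def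
  Update_def Select_def Parent_def Extend_def Enumerate_def Eliminate_def

lemma writes_elimination:
  "writes Local_init = {''zf'', ''e''}" "writes Local_step = {''zf'', ''e''}" "writes Local_final = {''loc''}"
  "writes Local = {''zf'', ''e'', ''u'', ''loc''}"
  "writes Digit = {''z'', ''sig'', ''y''}"
  "writes Decode = {''z'', ''y'', ''i'', ''vv'', ''sig''}"
  "writes Message = {''val'', ''st'', ''zf'', ''e'', ''u'', ''loc'', ''ma'', ''mb'', ''mr'', ''mi'', ''mh'', ''y''}"
  "writes Update = {''x'', ''z'', ''y'', ''i'', ''vv'', ''sig'', ''val'', ''st'', ''zf'', ''e'', ''u'', ''loc'',
     ''ma'', ''mb'', ''mr'', ''mi'', ''mh'', ''acc''}"
  "writes Select = {''best'', ''v'', ''c'', ''lim''}"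
  "writes Parent = {''best'', ''pr'', ''v'', ''kf''}"
  "writes Extend = {''i'', ''z'', ''cfg'', ''len''}"
  "writes Enumerate = {''cfg'', ''len'', ''v'', ''i'', ''z''}"
  by (auto simp: com_defs)

lemma writes_Eliminate: "writes Eliminate = writes Update \<union> {''j'', ''best'', ''v'', ''c'', ''lim'', ''pr'', ''kf'', ''cfg'', ''len''}"
  unfolding Eliminate_def by (auto simp: writes_elimination)

section \<open>Correctness of one elimination step\<close>

lemma exec_Local_step:
  fixes s :: store
  assumes "s ''st'' 0 = int t" "s ''c'' 0 = c" "s ''u'' 0 = u" "s ''sig'' u = int g"
    "s ''kf'' u = of_bool P" "s ''adj'' (s ''arow'' c + u) = of_bool Q"
  shows "exec Local_step s ''zf'' 0 = (if P \<and> Q \<and> (t < 2 \<and> g < 2 \<and> t \<noteq> g \<or> 2 \<le> t \<and> 1 < g \<and> \<not> (2 < t \<and> 2 < g)) then 1 else s ''zf'' 0)"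
    and "exec Local_step s ''e'' 0 = s ''e'' 0 + (if P \<and> Q \<and> 2 < t \<and> 2 < g then 2 * s ''bD'' 0 else 0)"
  using assms by (cases P; cases Q; auto simp: Local_step_def)+

lemma simple_Local_step: "simple Local_step" "cost Local_step \<le> 7"
  by (simp_all add: Local_step_def)

lemma wp_Local:
  assumes p: "powers L s" and n: "s ''n'' 0 = int n" and t: "s ''st'' 0 = int t" "t < 4"
    and c: "s ''c'' 0 = int c" and v0: "s ''v0'' 0 = int v0" and bD: "s ''bD'' 0 = int bD"
    and xe: "s ''xe'' (int c) = int (xe c)" and S: "s ''S'' (int c) = of_bool (c \<in> S)"
    and adj: "\<And>u. u < n \<Longrightarrow> s ''adj'' (s ''arow'' (int c) + int u) = of_bool (adj c u)"
    and kf: "\<And>u. u < n \<Longrightarrow> s ''kf'' (int u) = of_bool (u \<in> K c)"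
    and sig: "\<And>u. u < n \<Longrightarrow> s ''sig'' (int u) = int (\<sigma> u)" and \<sigma>: "\<sigma> \<in> conf UNIV"
    and K: "K c \<subseteq> {..<n}" "c \<notin> K c"
    and bd: "xe c \<le> L" "bD \<le> L" "2 * bD * card (K c) \<le> L"
  shows "wp (11 * n + 20) Local (\<lambda>s'. s' ''loc'' 0 =
      loc adj K S v0 (2 ^ bD) (\<lambda>v. 2 ^ xe v) c (\<sigma>(c := t))) s"
proof -
  have finK: "finite (K c)" using K finite_subset by blast
  have \<sigma>4: "\<sigma> u < 4" for u using \<sigma> by (auto simp: conf_def)
  \<comment> \<open>\<open>bad\<close> and \<open>ex\<close> are the zero flag and the exponent
    after inspecting the vertices below \<open>k\<close>.\<close>
  define bad where "bad k \<longleftrightarrow> (t = 1 \<and> c = v0) \<or> (2 \<le> t \<and> c \<in> S) \<or> (\<exists>u<k. u \<in> K c \<and> adj c u \<and> \<not> agree t (\<sigma> u))" for k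
  define ex where "ex k = (if t < 2 then xe c else if t = 2 then bD else 2 * bD * card {u \<in> K c. u < k \<and> adj c u \<and> \<sigma> u = 3})" for k
  define J where "J k s' \<longleftrightarrow> s' ''zf'' 0 = of_bool (bad k) \<and> s' ''e'' 0 = int (ex k)" for k and s' :: store
  have "wp 10 Local_init (J 0) s"
    by (rule wp_simple) (use t c v0 bD xe S in \<open>auto simp: Local_init_def J_def bad_def ex_def\<close>)
  hence "wp 10 Local_init (wp (11 * n + 3) (For ''u'' (Var ''n'') Local_step) (wp 5 Local_final
      (\<lambda>s'. s' ''loc'' 0 = loc adj K S v0 (2 ^ bD) (\<lambda>v. 2 ^ xe v) c (\<sigma>(c := t))))) s"
  proof (rule wp_conseq)
    fix s1 assume J1: "J 0 s1" and sm1: "same (writes Local_init) s s1"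
    have f1: "s1 y = s y" if "y \<notin> {''zf'', ''e''}" for y
      using sm1 that by (simp add: same_def writes_elimination)
    have "wp (n * (7 + 4) + 3) (For ''u'' (Var ''n'') Local_step) (wp 5 Local_final
      (\<lambda>s'. s' ''loc'' 0 = loc adj K S v0 (2 ^ bD) (\<lambda>v. 2 ^ xe v) c (\<sigma>(c := t)))) s1"
    proof (rule wp_For[where I = J])
      fix s' assume "same (insert ''u'' (writes Local_step)) s1 s'"
      thus "aval (Var ''n'') s' = int n" using f1 n by (simp add: same_def writes_elimination)
    next
      show "J 0 (upd s1 ''u'' 0 0)" using J1 by (simp add: J_def)
    next
      show "''u'' \<notin> writes Local_step" by (simp add: writes_elimination)
    next
      fix k s' assume k: "k < n" and Jk: "J k s'" and u: "s' ''u'' 0 = int k"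
        and sm: "same (insert ''u'' (writes Local_step)) s1 s'"
      have f: "s' y = s y" if "y \<notin> {''zf'', ''e'', ''u''}" for y
        using sm f1[of y] that by (simp add: same_def writes_elimination)
      have bad_Suc: "bad (Suc k) \<longleftrightarrow> bad k \<or> (k \<in> K c \<and> adj c k \<and> \<not> agree t (\<sigma> k))"
        unfolding bad_def by (auto simp: less_Suc_eq)
      have ex_Suc: "ex (Suc k) = ex k + (if t = 3 \<and> k \<in> K c \<and> adj c k \<and> \<sigma> k = 3 then 2 * bD else 0)"
      proof -
        have "{u \<in> K c. u < Suc k \<and> adj c u \<and> \<sigma> u = 3} = (if k \<in> K c \<and> adj c k \<and> \<sigma> k = 3 then insert k else id) {u \<in> K c. u < k \<and> adj c u \<and> \<sigma> u = 3}"
          by (auto simp: less_Suc_eq)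
        thus ?thesis using t(2) finK by (auto simp: ex_def)
      qed
      have fr: "s' ''st'' 0 = int t" "s' ''c'' 0 = int c" "s' ''kf'' (int k) = of_bool (k \<in> K c)"
        "s' ''adj'' (s' ''arow'' (int c) + int k) = of_bool (adj c k)" "s' ''sig'' (int k) = int (\<sigma> k)"
        "s' ''bD'' 0 = int bD" using f t c kf adj sig bD k by simp_all
      have zf: "s' ''zf'' 0 = of_bool (bad k)" "s' ''e'' 0 = int (ex k)" using Jk by (simp_all add: J_def)
      have disagree: "\<not> agree t (\<sigma> k) \<longleftrightarrow> t < 2 \<and> \<sigma> k < 2 \<and> t \<noteq> \<sigma> k \<or> 2 \<le> t \<and> 1 < \<sigma> k \<and> \<not> (2 < t \<and> 2 < \<sigma> k)"
        using t(2) \<sigma>4[of k] unfolding agree_def by linarith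
      have eq3: "t = 3 \<longleftrightarrow> 2 < t" "\<sigma> k = 3 \<longleftrightarrow> 2 < \<sigma> k" using t(2) \<sigma>4[of k] by linarith+
      have "exec Local_step s' ''zf'' 0 = of_bool (bad k \<or> (k \<in> K c \<and> adj c k \<and> \<not> agree t (\<sigma> k)))"
        unfolding disagree exec_Local_step(1)[OF fr(1,2) u fr(5,3,4)] zf by simp
      moreover have "exec Local_step s' ''e'' 0 = int (ex k + (if t = 3 \<and> k \<in> K c \<and> adj c k \<and> \<sigma> k = 3 then 2 * bD else 0))"
        unfolding eq3 exec_Local_step(2)[OF fr(1,2) u fr(5,3,4)] zf fr(6) by auto
      ultimately have "exec Local_step s' ''zf'' 0 = of_bool (bad k \<or> (k \<in> K c \<and> adj c k \<and> \<not> agree t (\<sigma> k))) \<and>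
          exec Local_step s' ''e'' 0 = int (ex k + (if t = 3 \<and> k \<in> K c \<and> adj c k \<and> \<sigma> k = 3 then 2 * bD else 0))" ..
      thus "wp 7 Local_step (\<lambda>s'. J (Suc k) (upd s' ''u'' 0 (int (Suc k)))) s'"
        unfolding J_def bad_Suc ex_Suc by (intro wp_simple) (simp_all add: simple_Local_step)
    next
      fix s2 assume J2: "J n s2" and sm: "same (insert ''u'' (writes Local_step)) s1 s2"
      have f: "s2 y = s y" if "y \<notin> {''zf'', ''e'', ''u''}" for y
        using sm f1[of y] that by (simp add: same_def writes_elimination)
      have setK: "{u \<in> K c. u < n \<and> adj c u \<and> \<sigma> u = 3} = {u \<in> K c. adj c u \<and> (\<sigma>(c := t)) u = 3}"
        using K by auto
      have "card {u \<in> K c. u < n \<and> adj c u \<and> \<sigma> u = 3} \<le> card (K c)" using finK by (intro card_mono) auto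
      hence "2 * bD * card {u \<in> K c. u < n \<and> adj c u \<and> \<sigma> u = 3} \<le> 2 * bD * card (K c)" by (rule mult_left_mono) simp
      hence "2 * bD * card {u \<in> K c. u < n \<and> adj c u \<and> \<sigma> u = 3} \<le> L" using bd(3) by (rule order_trans)
      hence exL: "ex n \<le> L" using bd(1,2) unfolding ex_def by (simp only: split: if_split) blast
      have badn: "bad n \<longleftrightarrow> \<not> ((\<forall>u\<in>K c. adj c u \<longrightarrow> agree t ((\<sigma>(c := t)) u)) \<and> (t < 2 \<or> c \<notin> S) \<and> \<not> (t = 1 \<and> c = v0))"
        using K unfolding bad_def by (auto simp: not_less)
      have "loc adj K S v0 (2 ^ bD) (\<lambda>v. 2 ^ xe v) c (\<sigma>(c := t)) =
          (if bad n then 0 else if t = 2 then 2 ^ ex n - 1 else 2 ^ ex n)"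
      proof -
        have h: "(\<sigma>(c := t)) c = t" by simp
        have "loc adj K S v0 (2 ^ bD) (\<lambda>v. 2 ^ xe v) c (\<sigma>(c := t)) = (if \<not> bad n then
            (if t < 2 then 2 ^ xe c else if t = 2 then 2 ^ bD - 1 else (2 ^ bD) ^ (2 * card {u \<in> K c. u < n \<and> adj c u \<and> \<sigma> u = 3})) else 0)"
          unfolding loc_def h badn not_not setK by (rule refl)
        also have "(2 ^ bD) ^ (2 * card {u \<in> K c. u < n \<and> adj c u \<and> \<sigma> u = 3}) =
            (2::int) ^ (2 * bD * card {u \<in> K c. u < n \<and> adj c u \<and> \<sigma> u = 3})"
          by (simp only: power_mult[symmetric] mult.assoc mult.left_commute)
        finally have e: "loc adj K S v0 (2 ^ bD) (\<lambda>v. 2 ^ xe v) c (\<sigma>(c := t)) = (if \<not> bad n then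
            (if t < 2 then 2 ^ xe c else if t = 2 then 2 ^ bD - 1 else 2 ^ (2 * bD * card {u \<in> K c. u < n \<and> adj c u \<and> \<sigma> u = 3})) else 0)" .
        show ?thesis unfolding e ex_def by simp
      qed
      moreover have "s2 ''pw'' (int (ex n)) = 2 ^ ex n" using f p exL by (simp add: powers_def)
      moreover have "s2 ''st'' 0 = int t" using f t by simp
      ultimately show "wp 5 Local_final
        (\<lambda>s'. s' ''loc'' 0 = loc adj K S v0 (2 ^ bD) (\<lambda>v. 2 ^ xe v) c (\<sigma>(c := t))) s2"
        using J2 t(2) by (intro wp_simple) (auto simp: Local_final_def J_def)
    qed
    thus "wp (11 * n + 3) (For ''u'' (Var ''n'') Local_step) (wp 5 Local_final
      (\<lambda>s'. s' ''loc'' 0 = loc adj K S v0 (2 ^ bD) (\<lambda>v. 2 ^ xe v) c (\<sigma>(c := t)))) s1"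
      by (simp add: mult.commute)
  qed simp
  from wp_Then[OF wp_conseq[OF this order_refl, OF wp_Then]]
  show ?thesis unfolding Local_def by (rule wp_conseq) auto
qed

lemma simple_Digit: "simple Digit" "cost Digit = 7"
  by (simp_all add: Digit_def)

text \<open>The digit at \<open>v\<close> has value \<open>g\<close>, of which \<open>a\<close>
  units have been read; \<open>zl\<close> is the part of \<open>z\<close> below this digit, and
  \<open>y0\<close> the value of \<open>y\<close> before it.\<close>

definition digits_read :: "nat \<Rightarrow> nat \<Rightarrow> int \<Rightarrow> int \<Rightarrow> int \<Rightarrow> bool \<Rightarrow> store \<Rightarrow> nat \<Rightarrow> store \<Rightarrow> bool" where
  "digits_read v g P zl y0 b s a s' \<longleftrightarrow> a \<le> g \<and> s' ''vv'' 0 = int v \<and> s' ''pw'' (int v + int v) = P \<and>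
     s' ''kf'' (int v) = of_bool b \<and> s' ''z'' 0 = zl + int (g - a) * P \<and> s' ''sig'' (int v) = int a \<and>
     s' ''y'' 0 = y0 + of_bool b * (int a * P) \<and> (\<forall>u. u \<noteq> v \<longrightarrow> s' ''sig'' (int u) = s ''sig'' (int u))"

lemma digits_read_Digit:
  assumes "digits_read v g P zl y0 b s a s'" "0 \<le> zl" "zl < P"
  shows "digits_read v g P zl y0 b s (min g (Suc a)) (exec Digit s')"
proof (cases "a < g")
  case True
  hence g: "int (g - a) = int (g - Suc a) + 1" "min g (Suc a) = Suc a" by auto
  have "P \<le> zl + int (g - a) * P" unfolding g using assms by (simp add: algebra_simps)
  with assms(1) True show ?thesis unfolding digits_read_def g by (auto simp: Digit_def algebra_simps)
next
  case False
  with assms show ?thesis unfolding digits_read_def by (auto simp: Digit_def)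
qed

lemma wp_Decode:
  assumes p: "powers L s" and n: "s ''n'' 0 = int n" and L: "2 * n \<le> L"
    and A: "A \<subseteq> {..<n}" and x: "s ''x'' 0 = int (code A \<sigma>)" and \<sigma>: "\<sigma> \<in> conf UNIV"
    and kf: "\<And>u. u < n \<Longrightarrow> s ''kf'' (int u) = of_bool (u \<in> B)" and B: "B \<subseteq> A"
  shows "wp (34 * n + 7) Decode (\<lambda>s'. s' ''y'' 0 = int (code B \<sigma>) \<and>
     (\<forall>u<n. s' ''sig'' (int u) = (if u \<in> A then int (\<sigma> u) else 0))) s"
proof -
  let ?body = "''vv'' ::= Sub (Sub (Var ''n'') (Const 1)) (Var ''i'') ;;
       Assign ''sig'' (Var ''vv'') (Const 0) ;; Digit ;; Digit ;; Digit"
  define s1 where "s1 = upd (upd s ''z'' 0 (s ''x'' 0)) ''y'' 0 0"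
  define \<tau> where "\<tau> u = (if u \<in> A then \<sigma> u else 0)" for u
  have \<tau>4: "\<tau> u < 4" for u using \<sigma> by (auto simp: conf_def \<tau>_def)
  define J where "J k s' \<longleftrightarrow> s' ''z'' 0 = int (code (A \<inter> {..<n - k}) \<sigma>) \<and>
     s' ''y'' 0 + int (code (B \<inter> {..<n - k}) \<sigma>) = int (code B \<sigma>) \<and> (\<forall>u<n. n - k \<le> u \<longrightarrow> s' ''sig'' (int u) = int (\<tau> u))"
    for k and s' :: store
  have fB: "code (A \<inter> {..<n}) \<sigma> = code A \<sigma>" "code (B \<inter> {..<n}) \<sigma> = code B \<sigma>" using A B by (auto intro: arg_cong[of _ _ "\<lambda>A. code A \<sigma>"])
  have "wp (n * (30 + 4) + 3) (For ''i'' (Var ''n'') ?body) (J n) s1"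
  proof (rule wp_For[where I = J])
    fix s' assume "same (insert ''i'' (writes ?body)) s1 s'"
    thus "aval (Var ''n'') s' = int n" using n by (simp add: same_def writes_elimination s1_def)
  next
    show "J 0 (upd s1 ''i'' 0 0)" using x fB by (simp add: J_def s1_def)
  next
    show "''i'' \<notin> writes ?body" by (simp add: writes_elimination)
  next
    fix k s' assume k: "k < n" and Jk: "J k s'" and i: "s' ''i'' 0 = int k"
      and sm: "same (insert ''i'' (writes ?body)) s1 s'"
    define v where "v = n - Suc k"
    have v: "n - k = Suc v" "v < n" "int n - 1 - int k = int v" "n - Suc k = v" using k by (auto simp: v_def)
    have f: "s' y = s1 y" if "y \<notin> {''i'', ''vv'', ''sig'', ''z'', ''y''}" for y
      using sm that by (simp add: same_def writes_elimination)
    define P :: int where "P = 4 ^ v"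
    have "2 * v \<le> L" using v(2) L by simp
    hence "s ''pw'' (int (2 * v)) = 2 ^ (2 * v)" using p unfolding powers_def by blast
    hence "s' ''pw'' (int (2 * v)) = 2 ^ (2 * v)" using f[of "''pw''"] by (simp add: s1_def)
    moreover have "int (2 * v) = int v + int v" by simp
    moreover have "(2::int) ^ (2 * v) = P" unfolding P_def power_mult by simp
    ultimately have pw: "s' ''pw'' (int v + int v) = P" by (simp only:)
    have kfv: "s' ''kf'' (int v) = of_bool (v \<in> B)" "s' ''n'' 0 = int n"
      using f[of "''kf''"] f[of "''n''"] kf[OF v(2)] n unfolding s1_def by simp_all
    define zl where "zl = int (code (A \<inter> {..<v}) \<sigma>)"
    have "int (code (A \<inter> {..<v}) \<sigma>) < int (4 ^ v)" using code_less[OF \<sigma>, of A v] by (simp only: of_nat_less_iff)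
    hence zl: "0 \<le> zl" "zl < P" by (simp_all add: zl_def P_def)
    have Jz: "s' ''z'' 0 = int (code (A \<inter> {..<Suc v}) \<sigma>)"
      and Jy: "s' ''y'' 0 + int (code (B \<inter> {..<Suc v}) \<sigma>) = int (code B \<sigma>)"
      and Js: "\<And>u. u < n \<Longrightarrow> Suc v \<le> u \<Longrightarrow> s' ''sig'' (int u) = int (\<tau> u)"
    proof -
      from Jk[unfolded J_def v(1)] show "s' ''z'' 0 = int (code (A \<inter> {..<Suc v}) \<sigma>)" by (rule conjunct1)
      from Jk[unfolded J_def v(1)] show "s' ''y'' 0 + int (code (B \<inter> {..<Suc v}) \<sigma>) = int (code B \<sigma>)" by (elim conjE)
      from Jk[unfolded J_def v(1)] have "\<forall>u<n. Suc v \<le> u \<longrightarrow> s' ''sig'' (int u) = int (\<tau> u)" by (elim conjE)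
      thus "s' ''sig'' (int u) = int (\<tau> u)" if "u < n" "Suc v \<le> u" for u using that by simp
    qed
    have z: "s' ''z'' 0 = zl + int (\<tau> v) * P"
      unfolding Jz code_Suc by (simp add: zl_def \<tau>_def P_def)
    define y0 where "y0 = s' ''y'' 0"
    have y: "y0 + (int (code (B \<inter> {..<v}) \<sigma>) + of_bool (v \<in> B) * (int (\<tau> v) * P)) = int (code B \<sigma>)"
      using Jy B unfolding code_Suc y0_def[symmetric] by (cases "v \<in> B") (auto simp: \<tau>_def P_def)
    define s2 where "s2 = upd (upd s' ''vv'' 0 (int v)) ''sig'' (int v) 0"
    have "digits_read v (\<tau> v) P zl y0 (v \<in> B) s2 0 s2"
      using pw kfv z by (simp add: digits_read_def s2_def y0_def)
    \<comment> \<open>A digit is at most 3, so after three rounds \<open>min\<close> has reached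
      \<open>\<tau> v\<close>.\<close>
    from digits_read_Digit[OF digits_read_Digit[OF digits_read_Digit[OF this zl] zl] zl]
    have "digits_read v (\<tau> v) P zl y0 (v \<in> B) s2 (\<tau> v) (exec Digit (exec Digit (exec Digit s2)))"
      using \<tau>4[of v] by (simp add: min_def split: if_splits)
    moreover have "exec ?body s' = exec Digit (exec Digit (exec Digit s2))"
      using kfv i v(3) by (simp add: s2_def)
    ultimately have "digits_read v (\<tau> v) P zl y0 (v \<in> B) s2 (\<tau> v) (exec ?body s')" by (simp only:)
    moreover define s3 where "s3 = exec ?body s'"
    ultimately have "digits_read v (\<tau> v) P zl y0 (v \<in> B) s2 (\<tau> v) s3" by (simp only:)
    hence s3: "s3 ''z'' 0 = zl" "s3 ''y'' 0 = y0 + of_bool (v \<in> B) * (int (\<tau> v) * P)" "s3 ''sig'' (int v) = int (\<tau> v)"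
      "\<And>u. u \<noteq> v \<Longrightarrow> s3 ''sig'' (int u) = s' ''sig'' (int u)"
      by (simp_all add: digits_read_def s2_def)
    have "s3 ''sig'' (int u) = int (\<tau> u)" if "u < n" "v \<le> u" for u
      using s3(3) s3(4)[of u] Js[of u] that by (cases "u = v") auto
    hence "J (Suc k) (upd (exec ?body s') ''i'' 0 (int (Suc k)))"
      using s3(1,2) y v(4) unfolding s3_def[symmetric] J_def by (simp add: zl_def)
    thus "wp 30 ?body (\<lambda>s'. J (Suc k) (upd s' ''i'' 0 (int (Suc k)))) s'"
      by (intro wp_simple) (simp_all add: simple_Digit del: exec.simps)
  qed auto
  hence w: "wp (34 * n + 3) (For ''i'' (Var ''n'') ?body) (J n) s1" by (simp add: mult.commute)
  have "wp 3 (''z'' ::= Var ''x'' ;; ''y'' ::= Const 0) (wp (34 * n + 3) (For ''i'' (Var ''n'') ?body) (J n)) s"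
    by (rule wp_simple) (use w in \<open>simp_all add: s1_def\<close>)
  from wp_Then[OF this] show ?thesis unfolding Decode_def
    by (rule wp_conseq) (auto simp: J_def code_def \<tau>_def)
qed

lemma wp_seq:
  assumes "wp t c P s" "\<And>s'. P s' \<Longrightarrow> same (writes c) s s' \<Longrightarrow> wp u d Q s'" "t + u + 1 \<le> T"
  shows "wp T (Then c d) Q s"
  using wp_conseq[OF wp_Then[OF wp_conseq[OF assms(1) order_refl assms(2)]] assms(3)] by blast

lemma code_inj:
  assumes "\<sigma> \<in> conf UNIV" "\<tau> \<in> conf UNIV" "code (A \<inter> {..<k}) \<sigma> = code (A \<inter> {..<k}) \<tau>" "v \<in> A" "v < k"
  shows "\<sigma> v = \<tau> v"
  using assms(3,5)
proof (induction k)
  case (Suc k)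
  have less: "code (A \<inter> {..<k}) \<sigma> < 4 ^ k" "code (A \<inter> {..<k}) \<tau> < 4 ^ k" using code_less assms by blast+
  define a b where "a = (if k \<in> A then \<sigma> k else 0)" and "b = (if k \<in> A then \<tau> k else 0)"
  have eq: "code (A \<inter> {..<k}) \<sigma> + a * 4 ^ k = code (A \<inter> {..<k}) \<tau> + b * 4 ^ k"
    using Suc.prems(1) by (auto simp: code_Suc a_def b_def)
  have "a = b" using arg_cong[OF eq, of "\<lambda>x. x div 4 ^ k"] less by simp
  moreover have "code (A \<inter> {..<k}) \<sigma> = code (A \<inter> {..<k}) \<tau>" using eq \<open>a = b\<close> by simp
  ultimately show ?case using Suc assms(4) by (cases "v = k") (auto simp: a_def b_def)
qed simp

text \<open>\<open>P1\<close> bounds the sizes of the scopes. All exponents in local factors are at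
  most \<open>2 * bD * P1\<close>; two further bits pay for the four states, and \<open>n\<close>
  vertices give \<open>L\<close>.\<close>

locale machine = counting +
  fixes bD L P1 :: nat and xe :: "nat \<Rightarrow> nat"
  assumes d: "d = 2 ^ bD" and x: "x = (\<lambda>v. 2 ^ xe v)" and xe_le: "c < n \<Longrightarrow> xe c \<le> 2 * bD"
    and K_card_less: "c < n \<Longrightarrow> card (K c) < P1" and L: "L = n * (2 * bD * P1 + 2)" and n: "0 < n"
begin

abbreviation Q :: int where "Q \<equiv> 2 ^ (2 * bD * P1 + 2)"

lemma L_ge: "2 * n \<le> L" "2 * bD * P1 \<le> L" "Q ^ n = 2 ^ L"
proof -
  have "n * 2 \<le> n * (2 * bD * P1 + 2)" by (intro mult_le_mono2) simp
  thus "2 * n \<le> L" by (simp only: L mult.commute)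
  have "1 * (2 * bD * P1) \<le> n * (2 * bD * P1 + 2)" using n by (intro mult_le_mono) auto
  thus "2 * bD * P1 \<le> L" by (simp only: L mult_1)
  show "Q ^ n = 2 ^ L" by (simp only: L power_mult[symmetric] mult.commute)
qed

lemma P1: "1 \<le> P1"
  using K_card_less[OF n] by simp

lemma lc_bound: "c < n \<Longrightarrow> 0 \<le> lc c \<sigma> \<and> 4 * lc c \<sigma> \<le> Q"
proof -
  assume c: "c < n"
  have fin: "finite (K c)" using K_lt[OF c] finite_subset[of "K c" "{..<n}"] by auto
  have "card {u \<in> K c. adj c u \<and> \<sigma> u = 3} \<le> card (K c)" using fin by (intro card_mono) auto
  hence "bD * (2 * card {u \<in> K c. adj c u \<and> \<sigma> u = 3}) \<le> bD * (2 * P1)" using K_card_less[OF c] by (intro mult_left_mono) auto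
  hence e: "bD * (2 * card {u \<in> K c. adj c u \<and> \<sigma> u = 3}) \<le> 2 * bD * P1" by simp
  have x': "xe c \<le> 2 * bD * P1" using xe_le[OF c] P1 by (metis le_trans mult.right_neutral mult_le_mono2)
  have d': "bD \<le> 2 * bD * P1" using P1 by (simp add: Suc_le_eq)
  have "0 \<le> lc c \<sigma> \<and> lc c \<sigma> \<le> 2 ^ (2 * bD * P1)"
  proof -
    have "(2::int) ^ xe c \<le> 2 ^ (2 * bD * P1)" using x' by (intro power_increasing) auto
    moreover have "(2::int) ^ bD - 1 \<le> 2 ^ (2 * bD * P1)"
    proof -
      have "(2::int) ^ bD \<le> 2 ^ (2 * bD * P1)" using d' by (intro power_increasing) auto
      thus ?thesis by linarith
    qed
    moreover have "((2::int) ^ bD) ^ (2 * card {u \<in> K c. adj c u \<and> \<sigma> u = 3}) \<le> 2 ^ (2 * bD * P1)"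
      using e unfolding power_mult[symmetric] by (intro power_increasing) auto
    ultimately show ?thesis unfolding loc_def d x by simp
  qed
  thus ?thesis by (simp add: power_add)
qed

definition table_names :: "string set" where
  "table_names = {''L'', ''pw'', ''n'', ''v0'', ''bD'', ''xe'', ''S'', ''adj'', ''arow'', ''off'', ''key'', ''bag'', ''row'', ''top''}"

text \<open>The memory that the main loop only reads. The table of \<open>u\<close> has
  \<open>4^n\<close> cells from position \<open>off\<close> of \<open>u\<close> on, and the key of
  the additional root is the sentinel -1.\<close>

definition tables :: "store \<Rightarrow> bool" where
  "tables s \<longleftrightarrow> powers L s \<and> s ''n'' 0 = int n \<and> s ''v0'' 0 = int v0 \<and> s ''bD'' 0 = int bD \<and>
    (\<forall>c<n. s ''xe'' (int c) = int (xe c) \<and> s ''S'' (int c) = of_bool (c \<in> S) \<and> s ''key'' (int c) = int (key c)) \<and>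
    (\<forall>c<n. \<forall>u<n. s ''adj'' (s ''arow'' (int c) + int u) = of_bool (adj c u)) \<and>
    (\<forall>u\<le>n. s ''off'' (int u) = int (u * 4 ^ n)) \<and> s ''key'' (int n) = -1 \<and>
    (\<forall>c<n. \<forall>u<n. s ''bag'' (s ''row'' (s ''top'' (int c)) + int u) = of_bool (u \<in> X (top c)))"

lemma tables_same:
  assumes "same W s s'" "W \<inter> table_names = {}" "tables s"
  shows "tables s'"
proof -
  have "s' y = s y" if "y \<in> table_names" for y using assms(1,2) that by (auto simp: same_def)
  thus ?thesis using assms(3) by (simp add: tables_def powers_def table_names_def)
qed

lemma wp_Message:
  assumes T: "tables s" and c: "c < n" "s ''c'' 0 = int c" and y: "s ''y'' 0 = int (code (K c) \<sigma>)"
    and sig: "\<And>u. u < n \<Longrightarrow> s ''sig'' (int u) = int (\<sigma> u)" and \<sigma>: "\<sigma> \<in> conf UNIV"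
    and kf: "\<And>u. u < n \<Longrightarrow> s ''kf'' (int u) = of_bool (u \<in> K c)"
    and bd: "\<And>\<tau>. \<tau> \<in> conf UNIV \<Longrightarrow> 0 \<le> acc (s ''acc'') c \<tau> \<and> acc (s ''acc'') c \<tau> \<le> 2 ^ L"
  shows "wp (44 * n + 52 * L + 250) Message (\<lambda>s'. s' ''val'' 0 = msg (s ''acc'') c \<sigma>) s"
proof -
  define g where "g = s ''acc''"
  let ?arg = "''ma'' ::= Var ''loc'' ;; ''mb'' ::= Add (Cell ''acc'' (Add (Cell ''off'' (Var ''c'')) (Var ''y''))) (Const 1)"
  let ?fin = "Incr ''val'' (Var ''mr'') ;; Incr ''y'' (Cell ''pw'' (Double (Var ''c'')))"
  let ?body = "Local ;; ?arg ;; Mul ;; ?fin"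
  let ?J = "\<lambda>k s'. s' ''val'' 0 = (\<Sum>t<k. lc c (\<sigma>(c := t)) * acc g c (\<sigma>(c := t))) \<and>
      s' ''y'' 0 = int (code (K c) \<sigma> + k * 4 ^ c)"
  define s1 where "s1 = upd s ''val'' 0 0"
  have finK: "finite (K c)" using K_lt[OF c(1)] finite_subset[of "K c" "{..<n}"] by auto
  have "wp (4 * ((11 * n + 13 * L + 51) + 4) + 3) (For ''st'' (Const 4) ?body) (\<lambda>s'. s' ''val'' 0 = msg g c \<sigma>) s1"
  proof (rule wp_For[where I = ?J])
    show "?J 0 (upd s1 ''st'' 0 0)" using y by (simp add: s1_def)
  next
    show "''st'' \<notin> writes ?body" by (simp add: writes_elimination)
  next
    fix s' assume "?J 4 s'" thus "s' ''val'' 0 = msg g c \<sigma>" by (simp add: msg_def)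
  next
    fix k s' assume k: "k < 4" and J: "?J k s'" and st: "s' ''st'' 0 = int k"
      and sm: "same (insert ''st'' (writes ?body)) s1 s'"
    have f: "s' z = s z" if "z \<notin> writes Message" for z
      using sm that by (simp add: same_def writes_elimination s1_def)
    have T': "tables s'" using T unfolding tables_def powers_def by (simp add: f writes_elimination)
    define \<tau> where "\<tau> = \<sigma>(c := k)"
    have \<tau>: "\<tau> \<in> conf UNIV" using \<sigma> k by (auto simp: conf_def \<tau>_def)
    have idx: "c * 4 ^ n + (code (K c) \<sigma> + k * 4 ^ c) = c * 4 ^ n + code (bagset c) \<tau>"
    proof -
      have "code (K c) \<tau> = code (K c) \<sigma>" by (rule code_cong) (use K_notin in \<open>auto simp: \<tau>_def\<close>)
      thus ?thesis using c(1) finK K_notin by (simp add: bagset_def code_insert \<tau>_def)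
    qed
    show "wp (11 * n + 13 * L + 51) ?body (\<lambda>s'. ?J (Suc k) (upd s' ''st'' 0 (int (Suc k)))) s'"
    proof (rule wp_seq)
      show "wp (11 * n + 20) Local (\<lambda>s'. s' ''loc'' 0 = lc c \<tau>) s'"
        unfolding \<tau>_def d x
      proof (rule wp_Local[where L = L and t = k])
        show "powers L s'" "s' ''n'' 0 = int n" "s' ''v0'' 0 = int v0" "s' ''bD'' 0 = int bD"
          "s' ''xe'' (int c) = int (xe c)" "s' ''S'' (int c) = of_bool (c \<in> S)"
          using T' c by (simp_all add: tables_def)
        show "s' ''adj'' (s' ''arow'' (int c) + int u) = of_bool (adj c u)" if "u < n" for u
          using T' c that by (simp add: tables_def)
        show "s' ''c'' 0 = int c" using f c by (simp add: writes_elimination)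
        show "s' ''kf'' (int u) = of_bool (u \<in> K c)" if "u < n" for u using f kf that by (simp add: writes_elimination)
        show "s' ''sig'' (int u) = int (\<sigma> u)" if "u < n" for u using f sig that by (simp add: writes_elimination)
        show "K c \<subseteq> {..<n}" "c \<notin> K c" using K_lt[OF c(1)] K_notin by auto
        have "2 * bD * 1 \<le> 2 * bD * P1" using P1 by (intro mult_le_mono2)
        hence "2 * bD \<le> L" unfolding mult_1_right using L_ge(2) by (rule order_trans)
        thus "xe c \<le> L" "bD \<le> L" using xe_le[OF c(1)] by linarith+
        have "2 * bD * card (K c) \<le> 2 * bD * P1" using K_card_less[OF c(1)] by (intro mult_left_mono) auto
        thus "2 * bD * card (K c) \<le> L" using L_ge(2) by (rule order_trans)
      qed (use k st \<sigma> in auto)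
    next
      fix s2 assume l: "s2 ''loc'' 0 = lc c \<tau>" and sm2: "same (writes Local) s' s2"
      show "wp (13 * L + 30) (?arg ;; Mul ;; ?fin) (\<lambda>s'. ?J (Suc k) (upd s' ''st'' 0 (int (Suc k)))) s2"
      proof (rule wp_seq)
        have "s2 ''acc'' = g" "s2 ''off'' (int c) = int (c * 4 ^ n)" "s2 ''c'' 0 = int c" "s2 ''y'' 0 = int (code (K c) \<sigma> + k * 4 ^ c)"
          using sm2 f J T c by (simp_all add: same_def writes_elimination g_def tables_def)
        moreover from this have "s2 ''acc'' (s2 ''off'' (int c) + s2 ''y'' 0) = g (int (c * 4 ^ n + code (bagset c) \<tau>))"
          unfolding idx[symmetric] by (simp only: of_nat_add)
        ultimately show "wp 3 ?arg (\<lambda>s'. s' ''ma'' 0 = lc c \<tau> \<and> s' ''mb'' 0 = acc g c \<tau>) s2"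
          using l by (intro wp_simple) (simp_all only: simple.simps cost.simps exec.simps aval.simps upd_apply acc_def, simp_all)
      next
        fix s3 assume s3: "s3 ''ma'' 0 = lc c \<tau> \<and> s3 ''mb'' 0 = acc g c \<tau>" and sm3: "same (writes ?arg) s2 s3"
        have f3: "s3 z = s' z" if "z \<notin> {''zf'', ''e'', ''u'', ''loc'', ''ma'', ''mb''}" for z
          using sm2 sm3 that by (simp add: same_def writes_elimination)
        have T3: "tables s3" using T' unfolding tables_def powers_def by (simp add: f3)
        show "wp (13 * L + 25) (Mul ;; ?fin) (\<lambda>s'. ?J (Suc k) (upd s' ''st'' 0 (int (Suc k)))) s3"
        proof (rule wp_seq)
          show "wp (13 * L + 20) Mul (\<lambda>s'. s' ''mr'' 0 = lc c \<tau> * acc g c \<tau>) s3"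
            using wp_Mul[of L s3] T3 s3 bd[OF \<tau>] by (simp add: tables_def g_def)
        next
          fix s4 assume m: "s4 ''mr'' 0 = lc c \<tau> * acc g c \<tau>" and sm4: "same (writes Mul) s3 s4"
          have f4: "s4 z = s' z" if "z \<notin> {''zf'', ''e'', ''u'', ''loc'', ''ma'', ''mb'', ''mr'', ''mi'', ''mh''}" for z
            using sm4 f3 that by (simp add: same_def)
          have "2 * c \<le> L" using L_ge c by linarith
          hence "s' ''pw'' (int (2 * c)) = 2 ^ (2 * c)" using T' unfolding tables_def powers_def by blast
          hence "s4 ''pw'' (int (2 * c)) = 2 ^ (2 * c)" by (simp add: f4)
          moreover have "int (2 * c) = int c + int c" by simp
          moreover have "(2::int) ^ (2 * c) = 4 ^ c" unfolding power_mult by simp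
          ultimately have pw: "s4 ''pw'' (int c + int c) = 4 ^ c" by (simp only:)
          show "wp 4 ?fin (\<lambda>s'. ?J (Suc k) (upd s' ''st'' 0 (int (Suc k)))) s4"
            using J m pw f[of "''c''"] c
            by (intro wp_simple) (simp_all add: f4 writes_elimination \<tau>_def algebra_simps)
        qed simp
      qed simp
    qed simp
  qed auto
  hence w: "wp (44 * n + 52 * L + 223) (For ''st'' (Const 4) ?body) (\<lambda>s'. s' ''val'' 0 = msg g c \<sigma>) s1"
    by (rule wp_conseq) auto
  show ?thesis unfolding Message_def g_def[symmetric]
    by (rule wp_seq[where P = "\<lambda>s'. s' = s1", OF wp_Assign]) (use w in \<open>auto simp: s1_def\<close>)
qed

lemma wp_Update:
  assumes T: "tables s" and c: "c < n" "s ''c'' 0 = int c" and q: "q \<le> n" "s ''pr'' 0 = int q" "K c \<subseteq> bagset q"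
    and cfg: "s ''cfg'' (s ''j'' 0) = int (code (bagset q) \<sigma>)" and \<sigma>: "\<sigma> \<in> conf UNIV"
    and kf: "\<And>u. u < n \<Longrightarrow> s ''kf'' (int u) = of_bool (u \<in> K c)"
    and bd: "\<And>u \<tau>. \<tau> \<in> conf UNIV \<Longrightarrow> 0 \<le> acc (s ''acc'') c \<tau> \<and> acc (s ''acc'') c \<tau> \<le> 2 ^ L"
    and bdq: "0 \<le> acc (s ''acc'') q \<sigma> \<and> acc (s ''acc'') q \<sigma> \<le> 2 ^ L"
  shows "wp (78 * n + 65 * L + 300) Update (\<lambda>s'. s' ''acc'' = (s ''acc'')
     (int (q * 4 ^ n + code (bagset q) \<sigma>) := msg (s ''acc'') c \<sigma> * acc (s ''acc'') q \<sigma> - 1)) s"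
proof -
  define g where "g = s ''acc''"
  \<comment> \<open>\<open>Decode\<close> yields 0 outside the bag of \<open>q\<close>. On
    \<open>K c\<close>, which determines the message, \<open>\<tau>\<close> agrees with
    \<open>\<sigma>\<close>.\<close>
  define \<tau> where "\<tau> u = (if u \<in> bagset q then \<sigma> u else 0)" for u
  have \<tau>: "\<tau> \<in> conf UNIV" using \<sigma> by (auto simp: conf_def \<tau>_def)
  have y\<tau>: "code (K c) \<tau> = code (K c) \<sigma>" by (rule code_cong) (use q in \<open>auto simp: \<tau>_def\<close>)
  have m\<tau>: "msg g c \<tau> = msg g c \<sigma>" by (rule msg_cong) (use q in \<open>auto simp: \<tau>_def\<close>)
  let ?arg = "''ma'' ::= Var ''val'' ;; ''mb'' ::= Add (Cell ''acc'' (Add (Cell ''off'' (Var ''pr'')) (Var ''x''))) (Const 1)"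
  let ?fin = "Assign ''acc'' (Add (Cell ''off'' (Var ''pr'')) (Var ''x'')) (Sub (Var ''mr'') (Const 1))"
  let ?Post = "\<lambda>s'. s' ''acc'' = g (int (q * 4 ^ n + code (bagset q) \<sigma>) := msg g c \<sigma> * acc g q \<sigma> - 1)"
  define V where "V = writes Update - {''acc''}"
  have V: "''acc'' \<notin> V" "''c'' \<notin> V" "''pr'' \<notin> V" "''kf'' \<notin> V" "V \<inter> table_names = {}"
    by (auto simp: V_def writes_elimination table_names_def)
  have sub: "writes Decode \<subseteq> V" "writes Message \<subseteq> V" "writes ?arg \<subseteq> V" "writes Mul \<subseteq> V" "{''x''} \<subseteq> V"
    by (auto simp: V_def writes_elimination)
  have "wp (78 * n + 65 * L + 300) Update ?Post s" unfolding Update_def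
  proof (rule wp_seq)
    show "wp 1 (''x'' ::= Cell ''cfg'' (Var ''j'')) (\<lambda>s'. s' ''x'' 0 = int (code (bagset q) \<sigma>)) s"
      using cfg by (intro wp_Assign) simp
  next
    fix s1 assume x1: "s1 ''x'' 0 = int (code (bagset q) \<sigma>)" and "same (writes (''x'' ::= Cell ''cfg'' (Var ''j''))) s s1"
    hence "same {''x''} s s1" by (simp only: writes.simps)
    hence sm1: "same V s s1" using sub(5) by (rule same_mono)
    show "wp (78 * n + 65 * L + 298) (Decode ;; Message ;; ?arg ;; Mul ;; ?fin) ?Post s1"
    proof (rule wp_seq)
      show "wp (34 * n + 7) Decode (\<lambda>s'. s' ''y'' 0 = int (code (K c) \<sigma>) \<and>
        (\<forall>u<n. s' ''sig'' (int u) = (if u \<in> bagset q then int (\<sigma> u) else 0))) s1"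
      proof (rule wp_Decode[where L = L])
        have T1: "tables s1" by (rule tables_same[OF sm1 V(5) T])
        show "powers L s1" "s1 ''n'' 0 = int n" using T1 by (simp_all add: tables_def)
        show "s1 ''kf'' (int u) = of_bool (u \<in> K c)" if "u < n" for u
          using sameD[OF sm1 V(4)] kf[OF that] by simp
      qed (use L_ge(1) bagset_subset x1 \<sigma> q(3) in auto)
    next
      fix s2 assume D: "s2 ''y'' 0 = int (code (K c) \<sigma>) \<and> (\<forall>u<n. s2 ''sig'' (int u) = (if u \<in> bagset q then int (\<sigma> u) else 0))"
        and w2: "same (writes Decode) s1 s2"
      have sm2: "same V s s2" using same_trans[OF sm1 same_mono[OF w2 sub(1)]] .
      have x2: "s2 ''x'' 0 = int (code (bagset q) \<sigma>)" using x1 w2 by (simp add: same_def writes_elimination)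
      have g2: "s2 ''acc'' = g" using sm2 V by (simp add: same_def g_def)
      show "wp (44 * n + 65 * L + 288) (Message ;; ?arg ;; Mul ;; ?fin) ?Post s2"
      proof (rule wp_seq)
        show "wp (44 * n + 52 * L + 250) Message (\<lambda>s'. s' ''val'' 0 = msg (s2 ''acc'') c \<tau>) s2"
        proof (rule wp_Message)
          show "tables s2" by (rule tables_same[OF sm2 V(5) T])
          show "s2 ''c'' 0 = int c" using sameD[OF sm2 V(2)] c by simp
          show "s2 ''y'' 0 = int (code (K c) \<tau>)" using D y\<tau> by simp
          show "s2 ''sig'' (int u) = int (\<tau> u)" if "u < n" for u using D that by (simp add: \<tau>_def)
          show "s2 ''kf'' (int u) = of_bool (u \<in> K c)" if "u < n" for u
            using sameD[OF sm2 V(4)] kf[OF that] by simp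
          show "0 \<le> acc (s2 ''acc'') c \<tau>' \<and> acc (s2 ''acc'') c \<tau>' \<le> 2 ^ L" if "\<tau>' \<in> conf UNIV" for \<tau>'
            using bd[OF that] g2 by (simp add: g_def)
        qed (use c \<tau> in auto)
      next
        fix s3 assume v3: "s3 ''val'' 0 = msg (s2 ''acc'') c \<tau>" and w3: "same (writes Message) s2 s3"
        have sm3: "same V s s3" using same_trans[OF sm2 same_mono[OF w3 sub(2)]] .
        have x3: "s3 ''x'' 0 = int (code (bagset q) \<sigma>)" using x2 w3 by (simp add: same_def writes_elimination)
        have T3: "tables s3" using tables_same[OF sm3 V(5) T] .
        have f3: "s3 ''acc'' = g" "s3 ''pr'' 0 = int q" using sm3 V q by (simp_all add: same_def g_def)
        show "wp (13 * L + 36) (?arg ;; Mul ;; ?fin) ?Post s3"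
        proof (rule wp_seq)
          show "wp 3 ?arg (\<lambda>s'. s' ''ma'' 0 = msg g c \<sigma> \<and> s' ''mb'' 0 = acc g q \<sigma>) s3"
            using v3 g2 m\<tau> x3 f3 T3 q by (intro wp_simple) (simp_all add: tables_def acc_def)
        next
          fix s4 assume a4: "s4 ''ma'' 0 = msg g c \<sigma> \<and> s4 ''mb'' 0 = acc g q \<sigma>" and w4: "same (writes ?arg) s3 s4"
          have sm4: "same V s s4" using same_trans[OF sm3 same_mono[OF w4 sub(3)]] .
          have x4: "s4 ''x'' 0 = int (code (bagset q) \<sigma>)" using x3 w4 by (simp add: same_def)
          show "wp (13 * L + 31) (Mul ;; ?fin) ?Post s4"
          proof (rule wp_seq)
            show "wp (13 * L + 20) Mul (\<lambda>s'. s' ''mr'' 0 = msg g c \<sigma> * acc g q \<sigma>) s4"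
              using wp_Mul[of L s4] tables_same[OF sm4 V(5) T] a4 bdq by (simp add: tables_def g_def)
          next
            fix s5 assume m: "s5 ''mr'' 0 = msg g c \<sigma> * acc g q \<sigma>" and w5: "same (writes Mul) s4 s5"
            have sm5: "same V s s5" using same_trans[OF sm4 same_mono[OF w5 sub(4)]] .
            have "s5 ''x'' 0 = int (code (bagset q) \<sigma>)" using x4 w5 by (simp add: same_def)
            moreover have "s5 ''off'' (int q) = int (q * 4 ^ n)" using tables_same[OF sm5 V(5) T] q by (simp add: tables_def)
            moreover have "s5 ''acc'' = g" "s5 ''pr'' 0 = int q" using sm5 V q by (simp_all add: same_def g_def)
            ultimately show "wp 1 ?fin ?Post s5"
              using m by (intro wp_simple) (simp_all add: upd_def)
          qed simp
        qed simp
      qed simp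
    qed simp
  qed simp
  thus ?thesis by (simp add: g_def)
qed

lemma wp_Select:
  assumes T: "tables s" and l: "\<And>v. v < n \<Longrightarrow> v \<in> U \<longleftrightarrow> int (key v) < s ''lim'' 0" and U: "U \<subseteq> {..<n}" "U \<noteq> {}"
  shows "wp (8 * n + 8) Select (\<lambda>s'. \<exists>c\<in>U. (\<forall>v\<in>U. key v \<le> key c) \<and> s' ''c'' 0 = int c \<and> s' ''lim'' 0 = int (key c)) s"
proof -
  let ?body = "If_then (Conj (Less (Var ''best'') (Cell ''key'' (Var ''v''))) (Less (Cell ''key'' (Var ''v'')) (Var ''lim'')))
        (''c'' ::= Var ''v'' ;; ''best'' ::= Cell ''key'' (Var ''v''))"
  let ?loop = "For ''v'' (Var ''n'') ?body"
  let ?C = "\<lambda>s' c. s' ''c'' 0 = int c \<and> s' ''best'' 0 = int (key c)"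
  define J where "J k s' \<longleftrightarrow> (s' ''best'' 0 = -1 \<and> (\<forall>v<k. v \<notin> U)) \<or>
      (\<exists>c\<in>U. ?C s' c \<and> (\<forall>v<k. v \<in> U \<longrightarrow> key v \<le> key c))" for k and s' :: store
  define s1 where "s1 = upd s ''best'' 0 (-1)"
  have fin: "\<exists>c\<in>U. (\<forall>v\<in>U. key v \<le> key c) \<and> ?C s' c" if "J n s'" for s'
    using that U unfolding J_def by blast
  have loop: "wp (n * (4 + 4) + 3) ?loop (J n) s1"
  proof (rule wp_For[where I = J])
    fix s' assume "same (insert ''v'' (writes ?body)) s1 s'"
    thus "aval (Var ''n'') s' = int n" using T by (simp add: same_def s1_def tables_def)
  next
    show "J 0 (upd s1 ''v'' 0 0)" by (simp add: J_def s1_def)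
  next
    fix k s' assume k: "k < n" and Jk: "J k s'" and v: "s' ''v'' 0 = int k"
      and sm: "same (insert ''v'' (writes ?body)) s1 s'"
    have f: "s' ''key'' (int k) = int (key k)" "s' ''lim'' 0 = s ''lim'' 0"
      using sm T k by (simp_all add: same_def s1_def tables_def)
    show "wp 4 ?body (\<lambda>s'. J (Suc k) (upd s' ''v'' 0 (int (Suc k)))) s'"
    proof (cases "s' ''best'' 0 < int (key k) \<and> int (key k) < s ''lim'' 0")
      case True
      hence kU: "k \<in> U" using l k by simp
      have "\<forall>v<k. v \<in> U \<longrightarrow> key v \<le> key k" using Jk True unfolding J_def by fastforce
      hence "J (Suc k) (upd (exec ?body s') ''v'' 0 (int (Suc k)))"
        using True kU unfolding J_def by (intro disjI2 bexI[of _ k]) (simp_all add: v f less_Suc_eq)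
      thus ?thesis by (intro wp_simple) simp_all
    next
      case False
      have "J (Suc k) s'"
      proof (cases "k \<in> U")
        case True
        hence b: "int (key k) \<le> s' ''best'' 0" using False l k by auto
        with Jk show ?thesis unfolding J_def by (auto simp: less_Suc_eq)
      next
        case F: False
        with Jk show ?thesis unfolding J_def by (auto simp: less_Suc_eq)
      qed
      moreover have "exec ?body s' = s'" using False by (auto simp: v f)
      ultimately have "J (Suc k) (upd (exec ?body s') ''v'' 0 (int (Suc k)))" by (simp add: J_def)
      thus ?thesis by (intro wp_simple) simp_all
    qed
  qed auto
  show ?thesis unfolding Select_def
  proof (rule wp_seq)
    show "wp 1 (''best'' ::= Const (-1)) (\<lambda>s'. s' = s1) s" by (rule wp_Assign) (simp add: s1_def)
  next
    fix s' assume "s' = s1"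
    show "wp (8 * n + 5) (?loop ;; ''lim'' ::= Var ''best'') (\<lambda>s'. \<exists>c\<in>U. (\<forall>v\<in>U. key v \<le> key c) \<and> s' ''c'' 0 = int c \<and> s' ''lim'' 0 = int (key c)) s'"
      unfolding \<open>s' = s1\<close>
    proof (rule wp_seq[OF loop])
      fix s2 assume "J n s2"
      then obtain c where "c \<in> U" "\<forall>v\<in>U. key v \<le> key c" "?C s2 c" using fin by blast
      thus "wp 1 (''lim'' ::= Var ''best'') (\<lambda>s'. \<exists>c\<in>U. (\<forall>v\<in>U. key v \<le> key c) \<and> s' ''c'' 0 = int c \<and> s' ''lim'' 0 = int (key c)) s2"
        by (intro wp_Assign bexI[of _ c]) auto
    qed simp
  qed simp
qed

lemma wp_Parent:
  assumes T: "tables s" and c: "c < n" "s ''c'' 0 = int c"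
  shows "wp (14 * n + 7) Parent (\<lambda>s'. \<exists>q. is_parent c q \<and> s' ''pr'' 0 = int q \<and>
     (\<forall>u<n. s' ''kf'' (int u) = of_bool (u \<in> K c))) s"
proof -
  let ?cond = "Conj (Pos (Cell ''bag'' (Add (Cell ''row'' (Cell ''top'' (Var ''c''))) (Var ''v''))))
           (Less (Cell ''key'' (Var ''v'')) (Cell ''key'' (Var ''c'')))"
  let ?body = "Assign ''kf'' (Var ''v'') (Const 0) ;;
       If_then ?cond
        (Assign ''kf'' (Var ''v'') (Const 1) ;;
         If_then (Less (Var ''best'') (Cell ''key'' (Var ''v'')))
           (''pr'' ::= Var ''v'' ;; ''best'' ::= Cell ''key'' (Var ''v'')))"
  let ?C = "\<lambda>s' q. s' ''pr'' 0 = int q \<and> s' ''best'' 0 = int (key q)"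
  define B where "B k s' \<longleftrightarrow> (s' ''best'' 0 = -1 \<and> s' ''pr'' 0 = int n \<and> (\<forall>v<k. v \<notin> K c)) \<or>
      (\<exists>q\<in>K c. ?C s' q \<and> (\<forall>v<k. v \<in> K c \<longrightarrow> key v \<le> key q))" for k and s' :: store
  define J where "J k s' \<longleftrightarrow> B k s' \<and> (\<forall>u<k. s' ''kf'' (int u) = of_bool (u \<in> K c))" for k and s' :: store
  define s1 where "s1 = upd (upd s ''best'' 0 (-1)) ''pr'' 0 (int n)"
  have nn: "s ''n'' 0 = int n" using T by (simp add: tables_def)
  have loop: "wp (n * (10 + 4) + 3) (For ''v'' (Var ''n'') ?body) (\<lambda>s'. \<exists>q. is_parent c q \<and> s' ''pr'' 0 = int q \<and>
     (\<forall>u<n. s' ''kf'' (int u) = of_bool (u \<in> K c))) s1"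
  proof (rule wp_For[where I = J])
    fix s' assume "same (insert ''v'' (writes ?body)) s1 s'"
    thus "aval (Var ''n'') s' = int n" using nn by (simp add: same_def s1_def)
  next
    show "J 0 (upd s1 ''v'' 0 0)" by (simp add: J_def B_def s1_def)
  next
    fix k s' assume k: "k < n" and Jk: "J k s'" and v: "s' ''v'' 0 = int k"
      and sm: "same (insert ''v'' (writes ?body)) s1 s'"
    have f: "s' ''key'' (int k) = int (key k)" "s' ''key'' (int c) = int (key c)" "s' ''c'' 0 = int c"
      "s' ''bag'' (s' ''row'' (s' ''top'' (int c)) + int k) = of_bool (k \<in> X (top c))"
      using sm T k c by (simp_all add: same_def s1_def tables_def)
    have Kk: "k \<in> K c \<longleftrightarrow> k \<in> X (top c) \<and> int (key k) < int (key c)" by (simp add: K_def)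
    have Jf: "B k s'" "\<And>u. u < k \<Longrightarrow> s' ''kf'' (int u) = of_bool (u \<in> K c)" using Jk by (simp_all add: J_def)
    define s3 where "s3 = exec ?body s'"
    have ex: "s3 ''kf'' = (s' ''kf'')(int k := of_bool (k \<in> K c))"
      "s3 ''pr'' 0 = (if k \<in> K c \<and> s' ''best'' 0 < int (key k) then int k else s' ''pr'' 0)"
      "s3 ''best'' 0 = (if k \<in> K c \<and> s' ''best'' 0 < int (key k) then int (key k) else s' ''best'' 0)"
      unfolding s3_def Kk by (cases "k \<in> X (top c)"; simp add: v f fun_eq_iff)+
    have kf3: "\<forall>u<Suc k. s3 ''kf'' (int u) = of_bool (u \<in> K c)" using Jf(2) ex(1) by (auto simp: less_Suc_eq)
    have "B (Suc k) s3"
    proof (cases "k \<in> K c \<and> s' ''best'' 0 < int (key k)")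
      case True
      have "\<forall>v<k. v \<in> K c \<longrightarrow> key v \<le> key k" using Jf(1) True unfolding B_def by fastforce
      thus ?thesis using True ex unfolding B_def by (intro disjI2 bexI[of _ k]) (simp_all add: less_Suc_eq)
    next
      case False
      have e: "s3 ''pr'' 0 = s' ''pr'' 0" "s3 ''best'' 0 = s' ''best'' 0" using False ex(2,3) by (simp_all only: if_False)
      show ?thesis
      proof (cases "k \<in> K c")
        case True
        hence b: "int (key k) \<le> s' ''best'' 0" using False by auto
        with Jf(1) show ?thesis unfolding B_def e by (auto simp: less_Suc_eq)
      next
        case F: False
        with Jf(1) show ?thesis unfolding B_def e by (auto simp: less_Suc_eq)
      qed
    qed
    hence "J (Suc k) (upd s3 ''v'' 0 (int (Suc k)))" using kf3 by (simp add: J_def B_def)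
    thus "wp 10 ?body (\<lambda>s'. J (Suc k) (upd s' ''v'' 0 (int (Suc k)))) s'"
      unfolding s3_def by (intro wp_simple) simp_all
  next
    fix s' assume J: "J n s'"
    hence B: "B n s'" and kf: "\<forall>u<n. s' ''kf'' (int u) = of_bool (u \<in> K c)" by (simp_all add: J_def)
    have Kn: "v < n" if "v \<in> K c" for v using K_lt[OF c(1) that] .
    have "\<exists>q. is_parent c q \<and> s' ''pr'' 0 = int q" using B Kn unfolding B_def is_parent_def by blast
    thus "\<exists>q. is_parent c q \<and> s' ''pr'' 0 = int q \<and> (\<forall>u<n. s' ''kf'' (int u) = of_bool (u \<in> K c))" using kf by blast
  qed auto
  show ?thesis unfolding Parent_def
  proof (rule wp_seq)
    show "wp 3 (''best'' ::= Const (-1) ;; ''pr'' ::= Var ''n'') (\<lambda>s'. s' = s1) s"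
      by (rule wp_simple) (simp_all add: s1_def nn)
  next
    fix s' assume "s' = s1"
    show "wp (14 * n + 3) (For ''v'' (Var ''n'') ?body) (\<lambda>s'. \<exists>q. is_parent c q \<and> s' ''pr'' 0 = int q \<and>
     (\<forall>u<n. s' ''kf'' (int u) = of_bool (u \<in> K c))) s'"
      unfolding \<open>s' = s1\<close> using loop by (rule wp_conseq) simp_all
  qed simp
qed

definition lists_cfg :: "store \<Rightarrow> nat list \<Rightarrow> bool" where
  "lists_cfg s cs \<longleftrightarrow> s ''len'' 0 = int (length cs) \<and> (\<forall>t<length cs. s ''cfg'' (int t) = int (cs ! t))"

text \<open>The new blocks lie behind the old list, so that every round reads an entry that is still
  unchanged.\<close>

lemma wp_Extend:
  assumes p: "powers L s" "2 * v \<le> L" and v: "s ''v'' 0 = int v" and cs: "lists_cfg s cs"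
  shows "wp (15 * length cs + 5) Extend (\<lambda>s'. lists_cfg s' (cs @ map (\<lambda>x. x + 4 ^ v) cs @
     map (\<lambda>x. x + 2 * 4 ^ v) cs @ map (\<lambda>x. x + 3 * 4 ^ v) cs)) s"
proof -
  define m where "m = length cs"
  define P :: int where "P = 4 ^ v"
  let ?body = "''z'' ::= Add (Cell ''cfg'' (Var ''i'')) (Cell ''pw'' (Double (Var ''v''))) ;;
       Assign ''cfg'' (Add (Var ''len'') (Var ''i'')) (Var ''z'') ;;
       Incr ''z'' (Cell ''pw'' (Double (Var ''v''))) ;;
       Assign ''cfg'' (Add (Double (Var ''len'')) (Var ''i'')) (Var ''z'') ;;
       Incr ''z'' (Cell ''pw'' (Double (Var ''v''))) ;;
       Assign ''cfg'' (Add (Add (Double (Var ''len'')) (Var ''len'')) (Var ''i'')) (Var ''z'')"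
  let ?new = "cs @ map (\<lambda>x. x + 4 ^ v) cs @ map (\<lambda>x. x + 2 * 4 ^ v) cs @ map (\<lambda>x. x + 3 * 4 ^ v) cs"
  have pw: "s ''pw'' (int v + int v) = P"
  proof -
    have "s ''pw'' (int (2 * v)) = 2 ^ (2 * v)" using p unfolding powers_def by blast
    moreover have "int (2 * v) = int v + int v" by simp
    moreover have "(2::int) ^ (2 * v) = P" unfolding P_def power_mult by simp
    ultimately show ?thesis by (simp only:)
  qed
  define J where "J k s' \<longleftrightarrow> (\<forall>t<m. s' ''cfg'' (int t) = int (cs ! t)) \<and>
     (\<forall>t<k. s' ''cfg'' (int m + int t) = int (cs ! t) + P \<and> s' ''cfg'' (2 * int m + int t) = int (cs ! t) + 2 * P \<and>
        s' ''cfg'' (3 * int m + int t) = int (cs ! t) + 3 * P)" for k and s' :: store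
  have ln: "s ''len'' 0 = int m" using cs by (simp add: lists_cfg_def m_def)
  have loop: "wp (m * (11 + 4) + 3) (For ''i'' (Var ''len'') ?body) (\<lambda>s'. J m s' \<and> s' ''len'' 0 = int m) s"
  proof (rule wp_For[where I = J])
    fix s' assume "same (insert ''i'' (writes ?body)) s s'"
    thus "aval (Var ''len'') s' = int m" using ln by (simp add: same_def)
  next
    show "J 0 (upd s ''i'' 0 0)" using cs by (simp add: J_def lists_cfg_def m_def)
  next
    fix k s' assume k: "k < m" and Jk: "J k s'" and i: "s' ''i'' 0 = int k"
      and sm: "same (insert ''i'' (writes ?body)) s s'"
    have f: "s' ''len'' 0 = int m" "s' ''pw'' (int v + int v) = P" "s' ''v'' 0 = int v"
      using sm ln pw v by (simp_all add: same_def)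
    hence pw': "s' ''pw'' (2 * int v) = P" by simp
    have ck: "s' ''cfg'' (int k) = int (cs ! k)" using Jk k by (simp add: J_def)
    define s3 where "s3 = exec ?body s'"
    have e: "s3 ''cfg'' = (s' ''cfg'')(int m + int k := int (cs ! k) + P, 2 * int m + int k := int (cs ! k) + 2 * P,
        3 * int m + int k := int (cs ! k) + 3 * P)"
      unfolding s3_def using k by (simp add: i f pw' ck fun_eq_iff)
    have "J (Suc k) (upd s3 ''i'' 0 (int (Suc k)))"
    proof -
      have "s3 ''cfg'' (int t) = int (cs ! t)" if "t < m" for t using Jk that k unfolding e J_def by simp
      moreover have "s3 ''cfg'' (int m + int t) = int (cs ! t) + P \<and> s3 ''cfg'' (2 * int m + int t) = int (cs ! t) + 2 * P \<and>
        s3 ''cfg'' (3 * int m + int t) = int (cs ! t) + 3 * P" if "t < Suc k" for t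
      proof (cases "t = k")
        case True
        thus ?thesis unfolding e using k by simp
      next
        case False
        hence "t < k" using that by simp
        thus ?thesis using Jk k unfolding e J_def by simp
      qed
      ultimately show ?thesis by (simp add: J_def)
    qed
    thus "wp 11 ?body (\<lambda>s'. J (Suc k) (upd s' ''i'' 0 (int (Suc k)))) s'"
      unfolding s3_def by (intro wp_simple) simp_all
  next
    fix s' assume "J m s'" "same (insert ''i'' (writes ?body)) s s'"
    thus "J m s' \<and> s' ''len'' 0 = int m" using ln by (simp add: same_def)
  qed auto
  show ?thesis unfolding Extend_def
  proof (rule wp_seq[OF loop])
    fix s' assume J: "J m s' \<and> s' ''len'' 0 = int m"
    have "s' ''cfg'' (int t) = int (?new ! t)" if t: "t < 4 * m" for t
    proof -
      consider "t < m" | t' where "t = m + t'" "t' < m" | t' where "t = 2 * m + t'" "t' < m" | t' where "t = 3 * m + t'" "t' < m"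
      proof -
        have "t < m \<or> (t = m + (t - m) \<and> t - m < m) \<or> (t = 2 * m + (t - 2 * m) \<and> t - 2 * m < m) \<or> (t = 3 * m + (t - 3 * m) \<and> t - 3 * m < m)"
          using t by linarith
        thus ?thesis using that by blast
      qed
      thus ?thesis
      proof cases
        case 1
        thus ?thesis using J by (simp add: J_def nth_append m_def)
      next
        case 2
        have "?new ! t = cs ! t' + 4 ^ v" using 2 by (simp add: nth_append m_def)
        thus ?thesis using J 2 by (simp add: J_def P_def)
      next
        case 3
        have "?new ! t = cs ! t' + 2 * 4 ^ v" using 3 by (simp add: nth_append m_def)
        thus ?thesis using J 3 by (simp add: J_def P_def)
      next
        case 4
        have "?new ! t = cs ! t' + 3 * 4 ^ v" using 4 by (simp add: nth_append m_def)
        thus ?thesis using J 4 by (simp add: J_def P_def)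
      qed
    qed
    moreover have "length ?new = 4 * m" by (simp add: m_def)
    ultimately show "wp 1 (''len'' ::= Double (Double (Var ''len''))) (\<lambda>s'. lists_cfg s' ?new) s'"
      using J by (intro wp_Assign) (simp add: lists_cfg_def)
  qed (simp add: m_def)
qed

lemma wp_Enumerate:
  assumes T: "tables s" and q: "q \<le> n" "s ''pr'' 0 = int q" and card: "card (bagset q) \<le> P1"
  shows "wp (n * (15 * 4 ^ P1 + 11) + 7) Enumerate (\<lambda>s'. lists_cfg s' (codes (bagset q) n)) s"
proof -
  let ?cond = "Conj (Pos (Cell ''bag'' (Add (Cell ''row'' (Cell ''top'' (Var ''pr''))) (Var ''v''))))
           (Le (Cell ''key'' (Var ''v'')) (Cell ''key'' (Var ''pr'')))"
  let ?J = "\<lambda>k s'. lists_cfg s' (codes (bagset q) k)"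
  define s1 where "s1 = upd (upd s ''cfg'' 0 0) ''len'' 0 1"
  have len: "length (codes (bagset q) k) \<le> 4 ^ P1" for k
  proof -
    have "card (bagset q \<inter> {..<k}) \<le> card (bagset q)" using finite_bagset by (intro card_mono) auto
    thus ?thesis unfolding length_codes using card by (intro power_increasing) auto
  qed
  have loop: "wp (n * ((15 * 4 ^ P1 + 6) + 4) + 3) (For ''v'' (Var ''n'') (If_then ?cond Extend)) (?J n) s1"
  proof (rule wp_For[where I = ?J])
    fix s' assume "same (insert ''v'' (writes (If_then ?cond Extend))) s1 s'"
    thus "aval (Var ''n'') s' = int n" using T by (simp add: same_def s1_def tables_def writes_elimination)
  next
    show "?J 0 (upd s1 ''v'' 0 0)" by (simp add: lists_cfg_def s1_def)
  next
    show "''v'' \<notin> writes (If_then ?cond Extend)" by (simp add: writes_elimination)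
  next
    fix k s' assume k: "k < n" and Jk: "?J k s'" and v: "s' ''v'' 0 = int k"
      and sm: "same (insert ''v'' (writes (If_then ?cond Extend))) s1 s'"
    have f: "s' y = s y" if "y \<notin> {''v'', ''i'', ''z'', ''cfg'', ''len''}" for y
      using sm that by (simp add: same_def writes_elimination s1_def)
    have p: "powers L s'" "2 * k \<le> L" using T L_ge k by (simp_all add: tables_def powers_def f)
    have "bval ?cond s' \<longleftrightarrow> k \<in> bagset q"
    proof (cases "q = n")
      case True
      thus ?thesis using T k q by (simp add: f v tables_def bagset_def)
    next
      case False
      hence qn: "q < n" using q by simp
      have "k \<in> bagset q \<longleftrightarrow> k \<in> X (top q) \<and> key k \<le> key q"
        using qn in_top[OF qn] key_inj[OF k qn] by (auto simp: bagset_def K_def le_less)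
      thus ?thesis using T k q qn by (simp add: f v tables_def not_less)
    qed
    moreover have "wp (15 * length (codes (bagset q) k) + 5) Extend (\<lambda>s'. ?J (Suc k) (upd s' ''v'' 0 (int (Suc k)))) s'"
      if "k \<in> bagset q"
      by (rule wp_conseq[OF wp_Extend[OF p v Jk]]) (use that in \<open>simp_all add: lists_cfg_def\<close>)
    ultimately have "wp ((15 * 4 ^ P1 + 5) + 1) (If_then ?cond Extend) (\<lambda>s'. ?J (Suc k) (upd s' ''v'' 0 (int (Suc k)))) s'"
    proof (intro wp_IfElse, goal_cases)
      case 1
      show ?case by (rule wp_conseq[OF 1(2)]) (use 1 len[of k] in auto)
    next
      case 2
      thus ?case using Jk by (intro wp_Skip) (simp add: lists_cfg_def)
    qed
    thus "wp (15 * 4 ^ P1 + 6) (If_then ?cond Extend) (\<lambda>s'. ?J (Suc k) (upd s' ''v'' 0 (int (Suc k)))) s'"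
      by (rule wp_conseq) auto
  qed auto
  show ?thesis unfolding Enumerate_def
  proof (rule wp_seq)
    show "wp 3 (Assign ''cfg'' (Const 0) (Const 0) ;; ''len'' ::= Const 1) (\<lambda>s'. s' = s1) s"
      by (rule wp_simple) (simp_all add: s1_def)
  next
    fix s' assume "s' = s1"
    show "wp (n * (15 * 4 ^ P1 + 10) + 3) (For ''v'' (Var ''n'') (If_then ?cond Extend)) (?J n) s'"
      unfolding \<open>s' = s1\<close> using loop by (rule wp_conseq) (simp_all add: algebra_simps)
  qed (simp add: algebra_simps)
qed

end

section \<open>The main loop\<close>

definition Main_loop :: com where
  "Main_loop = For ''round'' (Var ''n'') Eliminate"

context machine
begin

lemma Q_ge_1: "1 \<le> Q"
  by (rule one_le_power) simp

definition mul_time :: nat where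
  "mul_time = 78 * n + 65 * L + 304"

definition eliminate_time :: nat where
  "eliminate_time = 4 ^ P1 * mul_time + n * (15 * 4 ^ P1 + 33) + 35"

text \<open>The table of \<open>q\<close> is updated in place. This is sound because the listed
  codes are distinct, so an entry is multiplied once, and because \<open>q \<noteq> c\<close> keeps
  intact the table of \<open>c\<close>, from which the messages are computed.\<close>

lemma wp_Update_loop:
  assumes T: "tables s" and c: "c < n" "s ''c'' 0 = int c" and q: "q \<le> n" "s ''pr'' 0 = int q" "K c \<subseteq> bagset q" "q \<noteq> c"
    and cfg: "lists_cfg s (codes (bagset q) n)" and P: "card (bagset q) \<le> P1"
    and kf: "\<And>u. u < n \<Longrightarrow> s ''kf'' (int u) = of_bool (u \<in> K c)"
    and bd: "\<And>u \<tau>. u = c \<or> u = q \<Longrightarrow> \<tau> \<in> conf UNIV \<Longrightarrow> 0 \<le> acc (s ''acc'') u \<tau> \<and> acc (s ''acc'') u \<tau> \<le> 2 ^ L"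
  shows "wp (4 ^ P1 * mul_time + 3) (For ''j'' (Var ''len'') Update) (\<lambda>s'. \<forall>u \<sigma>. u \<le> n \<longrightarrow> \<sigma> \<in> conf UNIV \<longrightarrow>
     acc (s' ''acc'') u \<sigma> = (if u = q then acc (s ''acc'') q \<sigma> * msg (s ''acc'') c \<sigma> else acc (s ''acc'') u \<sigma>)) s"
proof -
  define g where "g = s ''acc''"
  define cs where "cs = codes (bagset q) n"
  have "\<forall>t<length cs. \<exists>\<sigma>\<in>conf UNIV. cs ! t = code (bagset q) \<sigma>"
  proof (intro allI impI)
    fix t assume "t < length cs"
    hence "cs ! t \<in> code (bagset q \<inter> {..<n}) ` conf UNIV" unfolding cs_def set_codes[symmetric] by (rule nth_mem)
    thus "\<exists>\<sigma>\<in>conf UNIV. cs ! t = code (bagset q) \<sigma>" using bagset_subset by (auto simp: Int_absorb2)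
  qed
  then obtain \<tau> where \<tau>: "\<And>t. t < length cs \<Longrightarrow> \<tau> t \<in> conf UNIV" "\<And>t. t < length cs \<Longrightarrow> cs ! t = code (bagset q) (\<tau> t)"
    by metis
  define pos where "pos t = int (q * 4 ^ n + cs ! t)" for t
  have pos_inj: "t = t'" if "pos t = pos t'" "t < length cs" "t' < length cs" for t t'
    using that distinct_codes[of "bagset q" n] nth_eq_iff_index_eq[of cs t t'] unfolding pos_def cs_def[symmetric] by simp
  define J where "J k s' \<longleftrightarrow> (\<forall>t<k. s' ''acc'' (pos t) = msg g c (\<tau> t) * acc g q (\<tau> t) - 1) \<and>
      (\<forall>i. (\<forall>t<k. i \<noteq> pos t) \<longrightarrow> s' ''acc'' i = g i)" for k and s' :: store
  \<comment> \<open>Codes are below \<open>4^n\<close>, so tables of different vertices occupy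
    disjoint blocks.\<close>
  have other: "acc g' u \<sigma> = acc g u \<sigma>"
    if "\<forall>i. (\<forall>t<k. i \<noteq> pos t) \<longrightarrow> g' i = g i" "k \<le> length cs" "u \<noteq> q" "\<sigma> \<in> conf UNIV" for g' u \<sigma> k
  proof -
    have "int (u * 4 ^ n + code (bagset u) \<sigma>) \<noteq> pos t" if "t < k" for t
    proof
      assume "int (u * 4 ^ n + code (bagset u) \<sigma>) = pos t"
      hence e: "u * 4 ^ n + code (bagset u) \<sigma> = q * 4 ^ n + cs ! t" unfolding pos_def by (simp only: of_nat_eq_iff)
      have "code (bagset u) \<sigma> < 4 ^ n" using code_less'[OF \<open>\<sigma> \<in> conf UNIV\<close> bagset_subset] .
      moreover have "cs ! t < 4 ^ n"
        using codes_less[of "cs ! t" "bagset q" n] \<open>t < k\<close> \<open>k \<le> length cs\<close> unfolding cs_def[symmetric] by simp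
      ultimately have "u = q" using arg_cong[OF e, of "\<lambda>x. x div 4 ^ n"] by simp
      thus False using \<open>u \<noteq> q\<close> by simp
    qed
    with that(1) show ?thesis by (simp add: acc_def)
  qed
  have msg_other: "msg g' c \<sigma> = msg g c \<sigma>"
    if "\<forall>i. (\<forall>t<k. i \<noteq> pos t) \<longrightarrow> g' i = g i" "k \<le> length cs" "\<sigma> \<in> conf UNIV" for g' \<sigma> k
    unfolding msg_def
  proof (rule sum.cong[OF refl])
    fix t :: nat assume "t \<in> {..<4}"
    hence "\<sigma>(c := t) \<in> conf UNIV" using \<open>\<sigma> \<in> conf UNIV\<close> by (auto simp: conf_def)
    thus "lc c (\<sigma>(c := t)) * acc g' c (\<sigma>(c := t)) = lc c (\<sigma>(c := t)) * acc g c (\<sigma>(c := t))"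
      using other[OF that(1,2)] q(4) by simp
  qed
  have len: "length cs \<le> 4 ^ P1"
  proof -
    have "card (bagset q \<inter> {..<n}) \<le> P1" using P bagset_subset by (simp add: Int_absorb2)
    thus ?thesis unfolding cs_def length_codes by (intro power_increasing) auto
  qed
  have "wp (length cs * ((78 * n + 65 * L + 300) + 4) + 3) (For ''j'' (Var ''len'') Update) (J (length cs)) s"
  proof (rule wp_For[where I = J])
    fix s' assume "same (insert ''j'' (writes Update)) s s'"
    thus "aval (Var ''len'') s' = int (length cs)" using cfg by (simp add: same_def lists_cfg_def writes_elimination cs_def)
  next
    show "J 0 (upd s ''j'' 0 0)" by (simp add: J_def g_def)
  next
    show "''j'' \<notin> writes Update" by (simp add: writes_elimination)
  next
    fix k s' assume k: "k < length cs" and Jk: "J k s'" and j: "s' ''j'' 0 = int k"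
      and sm: "same (insert ''j'' (writes Update)) s s'"
    define g' where "g' = s' ''acc''"
    have T': "tables s'" by (rule tables_same[OF sm _ T]) (simp add: writes_elimination table_names_def)
    have f: "s' ''c'' 0 = int c" "s' ''pr'' 0 = int q" "s' ''cfg'' (s' ''j'' 0) = int (code (bagset q) (\<tau> k))"
      "\<And>u. u < n \<Longrightarrow> s' ''kf'' (int u) = of_bool (u \<in> K c)"
      using sm c q cfg j k kf \<tau>(2)[OF k] by (simp_all add: same_def writes_elimination lists_cfg_def cs_def)
    have keep: "\<forall>i. (\<forall>t<k. i \<noteq> pos t) \<longrightarrow> g' i = g i" using Jk by (simp add: J_def g'_def)
    have pk: "g' (pos k) = g (pos k)"
    proof -
      have "\<forall>t<k. pos k \<noteq> pos t" using pos_inj k by (metis less_irrefl order.strict_trans)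
      thus ?thesis using keep by blast
    qed
    have pos_k: "pos k = int (q * 4 ^ n + code (bagset q) (\<tau> k))" using \<tau>(2)[OF k] by (simp add: pos_def)
    have aq: "acc g' q (\<tau> k) = acc g q (\<tau> k)" using pk unfolding acc_def pos_k by simp
    have ac: "acc g' c \<sigma> = acc g c \<sigma>" if "\<sigma> \<in> conf UNIV" for \<sigma>
      using other[OF keep _ _ that] k q(4) by simp
    have m: "msg g' c (\<tau> k) = msg g c (\<tau> k)" using msg_other[OF keep _ \<tau>(1)[OF k]] k by simp
    have U: "wp (78 * n + 65 * L + 300) Update (\<lambda>s'. s' ''acc'' = g'(int (q * 4 ^ n + code (bagset q) (\<tau> k)) := msg g' c (\<tau> k) * acc g' q (\<tau> k) - 1)) s'"
      unfolding g'_def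
      by (rule wp_Update[OF T' c(1) f(1) q(1) f(2) q(3) f(3) \<tau>(1)[OF k] f(4)])
         (use bd \<tau>(1)[OF k] ac aq in \<open>simp_all add: g'_def[symmetric] g_def[symmetric]\<close>)
    show "wp (78 * n + 65 * L + 300) Update (\<lambda>s'. J (Suc k) (upd s' ''j'' 0 (int (Suc k)))) s'"
    proof (rule wp_conseq[OF U order_refl])
      fix s2 assume "s2 ''acc'' = g'(int (q * 4 ^ n + code (bagset q) (\<tau> k)) := msg g' c (\<tau> k) * acc g' q (\<tau> k) - 1)"
      hence a: "s2 ''acc'' = g'(pos k := msg g c (\<tau> k) * acc g q (\<tau> k) - 1)" unfolding pos_k m aq .
      have "s2 ''acc'' (pos t) = msg g c (\<tau> t) * acc g q (\<tau> t) - 1" if "t < Suc k" for t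
      proof (cases "t = k")
        case True
        thus ?thesis by (simp add: a)
      next
        case False
        hence "t < k" using that by simp
        moreover from this have "pos t \<noteq> pos k" using pos_inj[of t k] k by auto
        ultimately show ?thesis using Jk by (simp add: a J_def g'_def)
      qed
      moreover have "s2 ''acc'' i = g i" if "\<forall>t<Suc k. i \<noteq> pos t" for i using that keep by (simp add: a)
      ultimately show "J (Suc k) (upd s2 ''j'' 0 (int (Suc k)))" by (simp add: J_def)
    qed
  qed auto
  thus ?thesis
  proof (rule wp_conseq)
    have "length cs * mul_time \<le> 4 ^ P1 * mul_time" using len by (rule mult_le_mono1)
    moreover have "(78 * n + 65 * L + 300) + 4 = mul_time" by (simp add: mul_time_def)
    ultimately show "length cs * ((78 * n + 65 * L + 300) + 4) + 3 \<le> 4 ^ P1 * mul_time + 3" by (simp only: add_le_mono1)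
  next
    fix s' assume Jn: "J (length cs) s'"
    have keep: "\<forall>i. (\<forall>t<length cs. i \<noteq> pos t) \<longrightarrow> s' ''acc'' i = g i" using Jn by (simp add: J_def)
    show "\<forall>u \<sigma>. u \<le> n \<longrightarrow> \<sigma> \<in> conf UNIV \<longrightarrow>
      acc (s' ''acc'') u \<sigma> = (if u = q then acc (s ''acc'') q \<sigma> * msg (s ''acc'') c \<sigma> else acc (s ''acc'') u \<sigma>)"
    proof (intro allI impI)
      fix u \<sigma> assume u: "u \<le> n" and \<sigma>: "\<sigma> \<in> conf UNIV"
      show "acc (s' ''acc'') u \<sigma> = (if u = q then acc (s ''acc'') q \<sigma> * msg (s ''acc'') c \<sigma> else acc (s ''acc'') u \<sigma>)"
      proof (cases "u = q")
        case False
        thus ?thesis using other[OF keep order_refl False \<sigma>] by (simp add: g_def)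
      next
        case True
        have bi: "bagset q \<inter> {..<n} = bagset q" using bagset_subset by blast
        have "code (bagset q) \<sigma> \<in> set cs" unfolding cs_def set_codes bi using \<sigma> by blast
        then obtain t where t: "t < length cs" "cs ! t = code (bagset q) \<sigma>" by (auto simp: in_set_conv_nth)
        \<comment> \<open>The listed representative \<open>\<tau> t\<close> agrees with
          \<open>\<sigma>\<close> on the bag only, which determines both the table entry and the
          message.\<close>
        have eq: "\<tau> t v = \<sigma> v" if "v \<in> bagset q" for v
          using code_inj[OF \<tau>(1)[OF t(1)] \<sigma>, of "bagset q" n v] \<tau>(2)[OF t(1)] t(2) that bagset_subset bi by auto
        have "acc (s' ''acc'') q \<sigma> = s' ''acc'' (pos t) + 1" by (simp add: acc_def pos_def t(2))
        also have "\<dots> = msg g c (\<tau> t) * acc g q (\<tau> t)" using Jn t(1) by (simp add: J_def)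
        also have "msg g c (\<tau> t) = msg g c \<sigma>" by (rule msg_cong) (use eq q(3) in auto)
        also have "acc g q (\<tau> t) = acc g q \<sigma>" by (rule acc_cong) (use eq in auto)
        finally show ?thesis using True by (simp add: g_def)
      qed
    qed
  qed
qed

lemma wp_Eliminate:
  assumes T: "tables s" and U: "U = {v. v < n \<and> int (key v) < s ''lim'' 0}" "U \<noteq> {}"
    and bd: "bounded Q U (s ''acc'')"
  shows "wp eliminate_time Eliminate (\<lambda>s'. \<exists>U'. U' = {v. v < n \<and> int (key v) < s' ''lim'' 0} \<and> card U = Suc (card U') \<and>
     bounded Q U' (s' ''acc'') \<and> total U' (s' ''acc'') = total U (s ''acc'')) s"
proof -
  have Un: "U \<subseteq> {..<n}" "finite U" using U by auto
  define g where "g = s ''acc''"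
  let ?Post = "\<lambda>s'. \<exists>U'. U' = {v. v < n \<and> int (key v) < s' ''lim'' 0} \<and> card U = Suc (card U') \<and>
     bounded Q U' (s' ''acc'') \<and> total U' (s' ''acc'') = total U g"
  have "wp eliminate_time Eliminate ?Post s" unfolding Eliminate_def
  proof (rule wp_seq)
    show "wp (8 * n + 8) Select (\<lambda>s'. \<exists>c\<in>U. (\<forall>v\<in>U. key v \<le> key c) \<and> s' ''c'' 0 = int c \<and> s' ''lim'' 0 = int (key c)) s"
      by (rule wp_Select[OF T]) (use U Un in auto)
  next
    fix s1 assume "\<exists>c\<in>U. (\<forall>v\<in>U. key v \<le> key c) \<and> s1 ''c'' 0 = int c \<and> s1 ''lim'' 0 = int (key c)" and sm1: "same (writes Select) s s1"
    then obtain c where cU: "c \<in> U" "\<And>v. v \<in> U \<Longrightarrow> key v \<le> key c" and c1: "s1 ''c'' 0 = int c" "s1 ''lim'' 0 = int (key c)" by auto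
    have c: "c < n" "int (key c) < s ''lim'' 0" using cU U by auto
    have low: "u \<in> U" if "u < n" "key u < key c" for u using that c U by auto
    \<comment> \<open>Keys are injective, so lowering \<open>lim\<close> to the largest key removes
      exactly \<open>c\<close>.\<close>
    have U': "U - {c} = {v. v < n \<and> int (key v) < int (key c)}"
    proof (intro set_eqI iffI)
      fix v assume v: "v \<in> U - {c}"
      hence "v < n" "key v \<le> key c" "v \<noteq> c" using cU Un by auto
      thus "v \<in> {v. v < n \<and> int (key v) < int (key c)}" using key_inj[of v c] c by (cases "key v = key c") auto
    qed (use low in auto)
    have T1: "tables s1" by (rule tables_same[OF sm1 _ T]) (simp add: writes_elimination table_names_def)
    show "wp (4 ^ P1 * mul_time + n * (15 * 4 ^ P1 + 25) + 25) (Parent ;; Enumerate ;; For ''j'' (Var ''len'') Update) ?Post s1"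
    proof (rule wp_seq[OF wp_Parent[OF T1 c(1) c1(1)]])
      fix s2 assume "\<exists>q. is_parent c q \<and> s2 ''pr'' 0 = int q \<and> (\<forall>u<n. s2 ''kf'' (int u) = of_bool (u \<in> K c))"
        and sm2: "same (writes Parent) s1 s2"
      then obtain q where q: "is_parent c q" and q2: "s2 ''pr'' 0 = int q" "\<And>u. u < n \<Longrightarrow> s2 ''kf'' (int u) = of_bool (u \<in> K c)" by auto
      have q': "q \<le> n" "q \<noteq> c" using q K_lt[OF c(1), of q] K_notin c(1) by (auto simp: is_parent_def)
      have T2: "tables s2" by (rule tables_same[OF sm2 _ T1]) (simp add: writes_elimination table_names_def)
      have card: "card (bagset q) \<le> P1"
      proof (cases "q < n")
        case True
        hence "finite (K q)" using K_lt[OF True] finite_subset[of "K q" "{..<n}"] by auto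
        thus ?thesis using True K_card_less[OF True] K_notin by (simp add: bagset_def)
      qed (simp add: bagset_def)
      show "wp (4 ^ P1 * mul_time + n * (15 * 4 ^ P1 + 11) + 11) (Enumerate ;; For ''j'' (Var ''len'') Update) ?Post s2"
      proof (rule wp_seq[OF wp_Enumerate[OF T2 q'(1) q2(1) card]])
        fix s3 assume cfg: "lists_cfg s3 (codes (bagset q) n)" and sm3: "same (writes Enumerate) s2 s3"
        have T3: "tables s3" by (rule tables_same[OF sm3 _ T2]) (simp add: writes_elimination table_names_def)
        have f3: "s3 ''c'' 0 = int c" "s3 ''pr'' 0 = int q" "\<And>u. u < n \<Longrightarrow> s3 ''kf'' (int u) = of_bool (u \<in> K c)"
          "s3 ''acc'' = g" "s3 ''lim'' 0 = int (key c)"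
          using sm1 sm2 sm3 c1 q2 by (simp_all add: same_def writes_elimination g_def)
        have cq: "c \<in> insert n U" "q \<in> insert n U"
          using cU q low[of q] K_lt[OF c(1), of q] by (auto simp: is_parent_def K_def)
        have bd3: "0 \<le> acc (s3 ''acc'') u \<tau> \<and> acc (s3 ''acc'') u \<tau> \<le> 2 ^ L" if "u = c \<or> u = q" "\<tau> \<in> conf UNIV" for u \<tau>
        proof -
          have "u \<in> insert n U" using that(1) cq by blast
          from bounded_le[OF bd this that(2) Q_ge_1 Un(2)] show ?thesis unfolding f3(4) g_def L_ge(3) ..
        qed
        show "wp (4 ^ P1 * mul_time + 3) (For ''j'' (Var ''len'') Update) ?Post s3"
        proof (rule wp_conseq[OF wp_Update_loop[OF T3 c(1) f3(1) q'(1) f3(2) parent_bag[OF c(1) q] q'(2) cfg card f3(3) bd3] order_refl])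
          fix s4 assume a: "\<forall>u \<sigma>. u \<le> n \<longrightarrow> \<sigma> \<in> conf UNIV \<longrightarrow> acc (s4 ''acc'') u \<sigma> =
              (if u = q then acc (s3 ''acc'') q \<sigma> * msg (s3 ''acc'') c \<sigma> else acc (s3 ''acc'') u \<sigma>)"
            and sm4: "same (writes (For ''j'' (Var ''len'') Update)) s3 s4"
          have lim: "s4 ''lim'' 0 = int (key c)" using sm4 f3(5) by (simp add: same_def writes_elimination)
          have g': "acc (s4 ''acc'') u \<sigma> = (if u = q then acc g q \<sigma> * msg g c \<sigma> else acc g u \<sigma>)"
            if "u \<in> insert n (U - {c})" "\<sigma> \<in> conf UNIV" for u \<sigma>
            using a that Un f3(4) by auto
          have "total (U - {c}) (s4 ''acc'') = total U g"
            by (rule total_eliminate[OF Un(2,1) cU(1) cU(2) low q g'])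
          moreover have "bounded Q (U - {c}) (s4 ''acc'')"
            by (rule bounded_eliminate[OF bd[folded g_def] Un(2,1) cU(1) low q lc_bound[OF c(1)] Q_ge_1 g'])
          moreover have "card U = Suc (card (U - {c}))" using Un(2) cU(1) by (rule card.remove)
          ultimately show "?Post s4" using U' lim by auto
        qed
      qed simp
    qed (simp add: algebra_simps)
  qed (simp add: eliminate_time_def algebra_simps)
  thus ?thesis by (simp add: g_def)
qed

text \<open>The range of the result is recorded for \<open>Read_bits\<close>, which extracts bits up
  to position \<open>L\<close>.\<close>

lemma wp_Main_loop:
  assumes T: "tables s" and lim: "\<And>v. v < n \<Longrightarrow> int (key v) < s ''lim'' 0" and acc0: "s ''acc'' = (\<lambda>_. 0)"
  shows "wp (n * (eliminate_time + 4) + 3) Main_loop (\<lambda>s'. s' ''acc'' (int (n * 4 ^ n)) + 1 = (\<Sum>\<sigma>\<in>conf {..<n}. \<Prod>c<n. lc c \<sigma>) \<and>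
     0 \<le> s' ''acc'' (int (n * 4 ^ n)) + 1 \<and> s' ''acc'' (int (n * 4 ^ n)) + 1 \<le> 2 ^ L) s"
proof -
  define Z where "Z = (\<Sum>\<sigma>\<in>conf {..<n}. \<Prod>c<n. lc c \<sigma>)"
  define J where "J k s' \<longleftrightarrow> (\<exists>U. U = {v. v < n \<and> int (key v) < s' ''lim'' 0} \<and> card U = n - k \<and>
     bounded Q U (s' ''acc'') \<and> total U (s' ''acc'') = Z)" for k and s' :: store
  have J_upd: "J k (upd s' ''round'' 0 a) = J k s'" for k s' a by (simp add: J_def)
  show ?thesis unfolding Main_loop_def Z_def[symmetric]
  proof (rule wp_For[where I = J])
    fix s' assume "same (insert ''round'' (writes Eliminate)) s s'"
    thus "aval (Var ''n'') s' = int n" using T by (simp add: same_def writes_Eliminate writes_elimination tables_def)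
  next
    have "{v. v < n \<and> int (key v) < s ''lim'' 0} = {..<n}" using lim by auto
    thus "J 0 (upd s ''round'' 0 0)" unfolding J_upd J_def using initial acc0 by (simp add: Z_def)
  next
    show "''round'' \<notin> writes Eliminate" by (simp add: writes_Eliminate writes_elimination)
  next
    fix k s' assume k: "k < n" and "J k s'" and sm: "same (insert ''round'' (writes Eliminate)) s s'"
    then obtain U where U: "U = {v. v < n \<and> int (key v) < s' ''lim'' 0}" "card U = n - k" "bounded Q U (s' ''acc'')"
      "total U (s' ''acc'') = Z" by (auto simp: J_def)
    have T': "tables s'" by (rule tables_same[OF sm _ T]) (simp add: writes_Eliminate writes_elimination table_names_def)
    have "U \<noteq> {}" using U(2) k by auto
    show "wp eliminate_time Eliminate (\<lambda>s'. J (Suc k) (upd s' ''round'' 0 (int (Suc k)))) s'"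
      unfolding J_upd
      by (rule wp_conseq[OF wp_Eliminate[OF T' U(1) \<open>U \<noteq> {}\<close> U(3)] order_refl]) (use U(2,4) in \<open>auto simp: J_def\<close>)
  next
    fix s' assume "J n s'"
    then obtain U where U: "U = {v. v < n \<and> int (key v) < s' ''lim'' 0}" "card U = n - n" "bounded Q U (s' ''acc'')" "total U (s' ''acc'') = Z"
      unfolding J_def by blast
    have "finite U" using U(1) by simp
    hence "U = {}" using U(2) by simp
    hence e: "s' ''acc'' (int (n * 4 ^ n)) + 1 = Z" "bounded Q {} (s' ''acc'')" using U(3,4) final by simp_all
    have "(\<lambda>_. 0) \<in> conf UNIV" by (simp add: conf_def)
    from bounded_le[OF e(2) _ this Q_ge_1, of n]
    have "0 \<le> acc (s' ''acc'') n (\<lambda>_. 0)" "acc (s' ''acc'') n (\<lambda>_. 0) \<le> 2 ^ L" unfolding L_ge(3) by simp_all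
    moreover have "acc (s' ''acc'') n (\<lambda>_. 0) = s' ''acc'' (int (n * 4 ^ n)) + 1"
      by (simp add: acc_def bagset_def code_def)
    ultimately show "s' ''acc'' (int (n * 4 ^ n)) + 1 = Z \<and> 0 \<le> s' ''acc'' (int (n * 4 ^ n)) + 1 \<and>
      s' ''acc'' (int (n * 4 ^ n)) + 1 \<le> 2 ^ L" using e(1) by simp
  qed
qed

end

section \<open>Preprocessing\<close>

text \<open>\<open>R = 2^lg\<close> is the number of possible weights of a vertex, and
  \<open>nr\<close> the number of coins for all weights.\<close>

definition Bits_size :: com where
  "Bits_size =
    ''R'' ::= Const 1 ;;
    While (Less (Var ''R'') (Double (Var ''n''))) (Incr ''R'' (Var ''R'') ;; Incr ''lg'' (Const 1)) ;;
    Times ''nr'' (Var ''lg'') (Var ''n'')"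

definition Weights :: com where
  "Weights =
    ''q'' ::= Const 0 ;;
    For ''v'' (Var ''n'')
      (For ''i'' (Var ''lg'')
        (Assign ''w'' (Var ''v'') (Add (Double (Cell ''w'' (Var ''v''))) (Cell ''rnd'' (Var ''q''))) ;;
         Incr ''q'' (Const 1)))"

definition in_bag :: "aexp \<Rightarrow> bexp" where
  "in_bag i = Pos (Cell ''bag'' (Add (Cell ''row'' i) (Var ''v'')))"

definition Bag_size :: com where
  "Bag_size =
    For ''u'' (Var ''N'')
      (''cnt'' ::= Const 0 ;;
       For ''v'' (Var ''n'') (If_then (in_bag (Var ''u'')) (Incr ''cnt'' (Const 1))) ;;
       If_then (Less (Var ''p1'') (Var ''cnt'')) (''p1'' ::= Var ''cnt''))"

text \<open>The root is its own parent and has to be exempted from the test of the parent's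
  bag.\<close>

definition Tops :: com where
  "Tops =
    For ''u'' (Var ''N'')
      (For ''v'' (Var ''n'')
        (If_then (Conj (in_bag (Var ''u''))
            (Neg (Conj (in_bag (Cell ''parent'' (Var ''u'')))
              (Neg (Conj (Le (Var ''u'') (Var ''root'')) (Le (Var ''root'') (Var ''u'')))))))
          (Assign ''top'' (Var ''v'') (Var ''u''))))"

text \<open>Depths are found by walking to the root, adding \<open>n\<close> for each edge. A walk
  has fewer than \<open>N\<close> edges, so the \<open>n\<close> walks take time proportional to
  \<open>N * n\<close>.\<close>

definition Keys :: com where
  "Keys =
    For ''v'' (Var ''n'')
      ((Assign ''key'' (Var ''v'') (Var ''v'') ;; ''u'' ::= Cell ''top'' (Var ''v'')) ;;
       While (Neg (Conj (Le (Var ''u'') (Var ''root'')) (Le (Var ''root'') (Var ''u''))))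
         (''u'' ::= Cell ''parent'' (Var ''u'') ;;
          Assign ''key'' (Var ''v'') (Add (Cell ''key'' (Var ''v'')) (Var ''n'')))) ;;
    Assign ''key'' (Var ''n'') (Const (-1))"

definition Find_v0 :: com where
  "Find_v0 = For ''v'' (Var ''n'') (If_then (Pos (Cell ''S'' (Var ''v''))) (''v0'' ::= Var ''v''))"

definition Exponents :: com where
  "Exponents =
    For ''v'' (Var ''n'')
      (Times ''t'' (Add (Add (Var ''D'') (Var ''M'')) (Cell ''w'' (Var ''v''))) (Var ''b'') ;;
       Assign ''xe'' (Var ''v'') (Var ''t''))"

definition Powers :: com where
  "Powers =
    Assign ''pw'' (Const 0) (Const 1) ;;
    For ''i'' (Var ''L'') (Assign ''pw'' (Add (Var ''i'') (Const 1)) (Double (Cell ''pw'' (Var ''i''))))"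

lemma writes_preprocessing:
  "writes Bits_size = {''R'', ''lg'', ''nr'', ''it''}" "writes Weights = {''q'', ''v'', ''i'', ''w''}"
  "writes Bag_size = {''u'', ''cnt'', ''v'', ''p1''}" "writes Tops = {''u'', ''v'', ''top''}"
  "writes Keys = {''v'', ''key'', ''u''}" "writes Find_v0 = {''v'', ''v0''}"
  "writes Exponents = {''v'', ''t'', ''it'', ''xe''}" "writes Powers = {''pw'', ''i''}"
  by (auto simp: Bits_size_def Weights_def Bag_size_def Tops_def Keys_def Find_v0_def Exponents_def Powers_def)

text \<open>The logarithm is that of \<open>2 * n\<close>, rounded up, so that the failure bound
  \<open>n / 2^r\<close> of the isolation is at most 1/2.\<close>

definition log2_ceil :: "nat \<Rightarrow> nat" where
  "log2_ceil n = (LEAST r. 2 * n \<le> 2 ^ r)"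

lemma log2_ceil:
  assumes "0 < n"
  shows "2 * n \<le> 2 ^ log2_ceil n" "log2_ceil n \<le> 2 * n" "2 ^ log2_ceil n \<le> 4 * n" "r < log2_ceil n \<Longrightarrow> 2 ^ r < 2 * n"
proof -
  have ex: "2 * n \<le> 2 ^ (2 * n)" by (rule less_imp_le) (rule less_exp)
  show "2 * n \<le> 2 ^ log2_ceil n" unfolding log2_ceil_def by (rule LeastI[of "\<lambda>r. 2 * n \<le> 2 ^ r", OF ex])
  show "log2_ceil n \<le> 2 * n" unfolding log2_ceil_def by (rule Least_le[of "\<lambda>r. 2 * n \<le> 2 ^ r", OF ex])
  have less: "2 ^ r < 2 * n" if "r < log2_ceil n" for r
    using not_less_Least[of r "\<lambda>r. 2 * n \<le> 2 ^ r"] that unfolding log2_ceil_def by simp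
  show "2 ^ r < 2 * n" if "r < log2_ceil n" by (rule less[OF that])
  show "2 ^ log2_ceil n \<le> 4 * n"
  proof (cases "log2_ceil n")
    case (Suc r)
    thus ?thesis using less[of r] by simp
  qed (use assms in simp)
qed

section \<open>Correctness of the preprocessing\<close>

lemma wp_Bits_size:
  assumes n: "s ''n'' 0 = int n" "0 < n" and lg: "s ''lg'' 0 = 0"
  shows "wp (15 * n + 10) Bits_size (\<lambda>s'. s' ''lg'' 0 = int (log2_ceil n) \<and> s' ''R'' 0 = 2 ^ log2_ceil n \<and>
     s' ''nr'' 0 = int (n * log2_ceil n)) s"
proof -
  define r where "r = log2_ceil n"
  let ?body = "Incr ''R'' (Var ''R'') ;; Incr ''lg'' (Const 1)"
  let ?W = "While (Less (Var ''R'') (Double (Var ''n''))) ?body"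
  define I where "I k s' \<longleftrightarrow> k \<le> r \<and> s' ''n'' 0 = int n \<and> s' ''lg'' 0 = int (r - k) \<and> s' ''R'' 0 = 2 ^ (r - k)" for k and s' :: store
  have while: "wp (r * (3 + 2) + 1) ?W (I 0) (upd s ''R'' 0 1)"
  proof (rule wp_While[where I = I])
    show "I r (upd s ''R'' 0 1)" using n lg by (simp add: I_def)
  next
    fix k s' assume I: "I (Suc k) s'"
    hence "k < r" by (simp add: I_def)
    hence e: "r - k = Suc (r - Suc k)" by (rule Suc_diff_Suc[symmetric])
    have "2 ^ (r - Suc k) < 2 * n" using log2_ceil(4)[OF n(2), of "r - Suc k"] I by (simp add: r_def I_def)
    hence "int (2 ^ (r - Suc k)) < int (2 * n)" by (simp only: of_nat_less_iff)
    hence "bval (Less (Var ''R'') (Double (Var ''n''))) s'" using I by (simp add: I_def)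
    moreover have "wp 3 ?body (I k) s'" using I e by (intro wp_simple) (simp_all add: I_def)
    ultimately show "bval (Less (Var ''R'') (Double (Var ''n''))) s' \<and> wp 3 ?body (I k) s'" ..
  next
    fix s' assume I: "I 0 s'"
    have "int (2 * n) \<le> int (2 ^ r)" using log2_ceil(1)[OF n(2)] by (simp only: of_nat_le_iff r_def)
    thus "\<not> bval (Less (Var ''R'') (Double (Var ''n''))) s' \<and> I 0 s'" using I by (simp add: I_def)
  qed
  have r: "r \<le> 2 * n" using log2_ceil(2)[OF n(2)] by (simp add: r_def)
  show ?thesis unfolding Bits_size_def r_def[symmetric]
  proof (rule wp_seq)
    show "wp 1 (''R'' ::= Const 1) (\<lambda>s'. s' = upd s ''R'' 0 1) s" by (rule wp_Assign) simp
  next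
    fix s1 assume s1: "s1 = upd s ''R'' 0 1"
    show "wp (15 * n + 8) (?W ;; Times ''nr'' (Var ''lg'') (Var ''n'')) (\<lambda>s'. s' ''lg'' 0 = int r \<and> s' ''R'' 0 = 2 ^ r \<and>
     s' ''nr'' 0 = int (n * r)) s1"
      unfolding s1
    proof (rule wp_seq[OF while])
      fix s2 assume I: "I 0 s2"
      show "wp (n * 5 + 5) (Times ''nr'' (Var ''lg'') (Var ''n'')) (\<lambda>s'. s' ''lg'' 0 = int r \<and> s' ''R'' 0 = 2 ^ r \<and>
     s' ''nr'' 0 = int (n * r)) s2"
        by (rule wp_conseq[OF wp_Times[where x = "int r" and m = n]]) (use I in \<open>auto simp: I_def same_def mult.commute\<close>)
    qed (use r in simp)
  qed simp
qed

lemma wp_Weights: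
  assumes n: "s ''n'' 0 = int n" and lg: "s ''lg'' 0 = int r" and w: "s ''w'' = (\<lambda>_. 0)"
    and rnd: "\<And>i. i < n * r \<Longrightarrow> s ''rnd'' (int i) = of_bool (f i)"
  shows "wp (n * (7 * r + 7) + 5) Weights (\<lambda>s'. \<forall>v<n. s' ''w'' (int v) = int (weight r f v)) s"
proof -
  let ?step = "Assign ''w'' (Var ''v'') (Add (Double (Cell ''w'' (Var ''v''))) (Cell ''rnd'' (Var ''q''))) ;; Incr ''q'' (Const 1)"
  let ?row = "For ''i'' (Var ''lg'') ?step"
  define J where "J v s' \<longleftrightarrow> s' ''q'' 0 = int (v * r) \<and> (\<forall>u. s' ''w'' (int u) = (if u < v then int (weight r f u) else 0))"
    for v and s' :: store
  define s1 where "s1 = upd s ''q'' 0 0"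
  have loop: "wp (n * ((r * (3 + 4) + 3) + 4) + 3) (For ''v'' (Var ''n'') ?row) (\<lambda>s'. \<forall>v<n. s' ''w'' (int v) = int (weight r f v)) s1"
  proof (rule wp_For[where I = J])
    fix s' assume "same (insert ''v'' (writes ?row)) s1 s'"
    thus "aval (Var ''n'') s' = int n" using n by (simp add: same_def s1_def)
  next
    show "J 0 (upd s1 ''v'' 0 0)" by (simp add: J_def s1_def w)
  next
    fix v s' assume v: "v < n" and J: "J v s'" and vv: "s' ''v'' 0 = int v" and sm: "same (insert ''v'' (writes ?row)) s1 s'"
    define I where "I k s2 \<longleftrightarrow> s2 ''q'' 0 = int (v * r + k) \<and> s2 ''w'' (int v) = int (hval f (v * r) k) \<and>
       (\<forall>u. u \<noteq> v \<longrightarrow> s2 ''w'' (int u) = s' ''w'' (int u))" for k and s2 :: store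
    have "wp (r * (3 + 4) + 3) ?row (I r) s'"
    proof (rule wp_For[where I = I])
      fix s2 assume "same (insert ''i'' (writes ?step)) s' s2"
      thus "aval (Var ''lg'') s2 = int r" using sm lg by (simp add: same_def s1_def)
    next
      show "I 0 (upd s' ''i'' 0 0)" using J by (simp add: I_def J_def)
    next
      fix k s2 assume k: "k < r" and I: "I k s2" and sm2: "same (insert ''i'' (writes ?step)) s' s2"
      have "Suc v * r \<le> n * r" using v by (intro mult_le_mono1) simp
      hence "v * r + k < n * r" using k by simp
      hence "s ''rnd'' (int (v * r + k)) = of_bool (f (v * r + k))" by (rule rnd)
      moreover have "s2 ''rnd'' = s ''rnd''" "s2 ''v'' 0 = int v" using sm sm2 vv by (simp_all add: same_def s1_def)
      ultimately have rn: "s2 ''rnd'' (s2 ''q'' 0) = of_bool (f (v * r + k))" "s2 ''v'' 0 = int v" using I by (simp_all add: I_def)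
      show "wp 3 ?step (\<lambda>s'. I (Suc k) (upd s' ''i'' 0 (int (Suc k)))) s2"
        using I rn by (intro wp_simple) (simp_all add: I_def)
    qed auto
    thus "wp (r * (3 + 4) + 3) ?row (\<lambda>s'. J (Suc v) (upd s' ''v'' 0 (int (Suc v)))) s'"
    proof (rule wp_conseq)
      fix s2 assume I: "I r s2"
      have "s2 ''w'' (int u) = (if u < Suc v then int (weight r f u) else 0)" for u
        using I J by (cases "u = v") (auto simp: I_def J_def weight_def)
      thus "J (Suc v) (upd s2 ''v'' 0 (int (Suc v)))" using I by (simp add: J_def I_def algebra_simps)
    qed simp
  qed (auto simp: J_def)
  show ?thesis unfolding Weights_def
  proof (rule wp_seq)
    show "wp 1 (''q'' ::= Const 0) (\<lambda>s'. s' = s1) s" by (rule wp_Assign) (simp add: s1_def)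
  next
    fix s' assume "s' = s1"
    thus "wp (n * ((r * (3 + 4) + 3) + 4) + 3) (For ''v'' (Var ''n'') ?row) (\<lambda>s'. \<forall>v<n. s' ''w'' (int v) = int (weight r f v)) s'"
      using loop by simp
  qed (simp add: algebra_simps)
qed

lemma wp_Powers:
  assumes L: "s ''L'' 0 = int L"
  shows "wp (5 * L + 5) Powers (powers L) s"
proof -
  let ?body = "Assign ''pw'' (Add (Var ''i'') (Const 1)) (Double (Cell ''pw'' (Var ''i'')))"
  define s1 where "s1 = upd s ''pw'' 0 1"
  let ?J = "\<lambda>k s'. \<forall>j\<le>k. s' ''pw'' (int j) = 2 ^ j"
  have loop: "wp (L * (1 + 4) + 3) (For ''i'' (Var ''L'') ?body) (powers L) s1"
  proof (rule wp_For[where I = ?J])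
    fix k s' assume "?J k s'" "s' ''i'' 0 = int k"
    thus "wp 1 ?body (\<lambda>s'. ?J (Suc k) (upd s' ''i'' 0 (int (Suc k)))) s'"
      by (intro wp_simple) (auto simp: le_Suc_eq)
  qed (use L in \<open>auto simp: s1_def same_def powers_def\<close>)
  show ?thesis unfolding Powers_def
  proof (rule wp_seq)
    show "wp 1 (Assign ''pw'' (Const 0) (Const 1)) (\<lambda>s'. s' = s1) s" by (rule wp_Assign) (simp add: s1_def)
  next
    fix s' assume "s' = s1"
    thus "wp (L * (1 + 4) + 3) (For ''i'' (Var ''L'') ?body) (powers L) s'" using loop by simp
  qed simp
qed

lemma wp_Exponents:
  assumes n: "s ''n'' 0 = int n" and D: "s ''D'' 0 = int D" and M: "s ''M'' 0 = int M" and b: "s ''b'' 0 = int b"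
    and w: "\<And>v. v < n \<Longrightarrow> s ''w'' (int v) = int (\<omega> v)"
  shows "wp (n * (5 * b + 11) + 3) Exponents (\<lambda>s'. \<forall>v<n. s' ''xe'' (int v) = int (b * (D + M + \<omega> v))) s"
proof -
  let ?T = "Times ''t'' (Add (Add (Var ''D'') (Var ''M'')) (Cell ''w'' (Var ''v''))) (Var ''b'')"
  let ?body = "?T ;; Assign ''xe'' (Var ''v'') (Var ''t'')"
  let ?J = "\<lambda>k s'. \<forall>v<k. s' ''xe'' (int v) = int (b * (D + M + \<omega> v))"
  have "wp (n * ((b * 5 + 7) + 4) + 3) (For ''v'' (Var ''n'') ?body) (?J n) s"
  proof (rule wp_For[where I = ?J])
    fix s' assume "same (insert ''v'' (writes ?body)) s s'"
    thus "aval (Var ''n'') s' = int n" using n by (simp add: same_def)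
  next
    fix k s' assume k: "k < n" and J: "?J k s'" and v: "s' ''v'' 0 = int k" and sm: "same (insert ''v'' (writes ?body)) s s'"
    show "wp (b * 5 + 7) ?body (\<lambda>s'. ?J (Suc k) (upd s' ''v'' 0 (int (Suc k)))) s'"
    proof (rule wp_seq)
      show "wp (b * 5 + 5) ?T (\<lambda>s'. s' ''t'' 0 = int (D + M + \<omega> k) * int b) s'"
        by (rule wp_Times) (use sm v D M b w[OF k] in \<open>auto simp: same_def\<close>)
    next
      fix s2 assume t: "s2 ''t'' 0 = int (D + M + \<omega> k) * int b" and sm2: "same (writes ?T) s' s2"
      have "s2 ''v'' 0 = int k" "s2 ''xe'' = s' ''xe''" using sm2 v by (simp_all add: same_def)
      thus "wp 1 (Assign ''xe'' (Var ''v'') (Var ''t'')) (\<lambda>s'. ?J (Suc k) (upd s' ''v'' 0 (int (Suc k)))) s2"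
        using J t by (intro wp_simple) (auto simp: less_Suc_eq mult.commute)
    qed simp
  qed auto
  thus ?thesis unfolding Exponents_def by (rule wp_conseq) (simp_all add: mult.commute)
qed

locale instance_data = decomposed "{..<N}" r par G n X
  for N r :: nat and par G n X +
  fixes S :: "nat set" and k :: int and p :: nat
  assumes S: "S \<subseteq> {..<n}" "S \<noteq> {}" and width: "width {..<N} X = p"
begin

definition inputs :: "store \<Rightarrow> bool" where
  "inputs s \<longleftrightarrow> s ''n'' 0 = int n \<and> s ''k'' 0 = k \<and> s ''N'' 0 = int N \<and> s ''root'' 0 = int r \<and>
     (\<forall>u<n. \<forall>v<n. s ''adj'' (int (u * n) + int v) = of_bool (adj u v)) \<and> (\<forall>v<n. s ''S'' (int v) = of_bool (v \<in> S)) \<and>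
     (\<forall>i<N. s ''parent'' (int i) = int (par i) \<and> (\<forall>v<n. s ''bag'' (int (i * n) + int v) = of_bool (v \<in> X i)))"

definition input_names :: "string set" where
  "input_names = {''n'', ''k'', ''N'', ''root'', ''adj'', ''S'', ''parent'', ''bag''}"

lemma inputs_same:
  assumes "same W s s'" "W \<inter> input_names = {}" "inputs s"
  shows "inputs s'"
proof -
  have "s' y = s y" if "y \<in> input_names" for y using assms(1,2) that by (auto simp: same_def)
  thus ?thesis using assms(3) by (simp add: inputs_def input_names_def)
qed

lemma n_pos: "0 < n"
  using S by auto

lemma N_pos: "0 < N"
  using r_in by auto

lemma X_less: "i < N \<Longrightarrow> X i \<subseteq> {..<n}"
  using bag_subset by simp

text \<open>Vertex 0 lies in some bag, so the maximum is positive and the truncated subtraction in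
  \<open>width\<close> can be undone.\<close>

lemma Max_card: "Max ((\<lambda>i. card (X i)) ` {..<N}) = p + 1"
proof -
  have "0 \<in> (\<Union>i\<in>{..<N}. X i)" unfolding cover using n_pos by simp
  then obtain i v where i: "i < N" "v \<in> X i" by blast
  have "finite (X i)" using X_less[OF i(1)] finite_subset by blast
  hence "1 \<le> card (X i)" using i(2) by (metis One_nat_def Suc_leI card_gt_0_iff empty_iff)
  also have "\<dots> \<le> Max ((\<lambda>i. card (X i)) ` {..<N})" using i by (intro Max_ge) auto
  finally show ?thesis using width by (simp add: width_def)
qed

lemma wp_Bag_size:
  assumes inp: "inputs s" and row: "\<And>i. i \<le> N \<Longrightarrow> s ''row'' (int i) = int (i * n)" and p1: "s ''p1'' 0 = 0"
  shows "wp (N * (7 * n + 13) + 3) Bag_size (\<lambda>s'. s' ''p1'' 0 = int (p + 1)) s"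
proof -
  let ?count = "If_then (in_bag (Var ''u'')) (Incr ''cnt'' (Const 1))"
  let ?row = "For ''v'' (Var ''n'') ?count"
  let ?upd = "If_then (Less (Var ''p1'') (Var ''cnt'')) (''p1'' ::= Var ''cnt'')"
  let ?body = "''cnt'' ::= Const 0 ;; ?row ;; ?upd"
  define J where "J i s' \<longleftrightarrow> s' ''p1'' 0 = int (Max (insert 0 ((\<lambda>i. card (X i)) ` {..<i})))" for i and s' :: store
  have "wp (N * ((7 * n + 9) + 4) + 3) (For ''u'' (Var ''N'') ?body) (J N) s"
  proof (rule wp_For[where I = J])
    fix s' assume "same (insert ''u'' (writes ?body)) s s'"
    thus "aval (Var ''N'') s' = int N" using inp by (simp add: same_def inputs_def)
  next
    show "J 0 (upd s ''u'' 0 0)" using p1 by (simp add: J_def)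
  next
    fix i s' assume i: "i < N" and J: "J i s'" and u: "s' ''u'' 0 = int i" and sm: "same (insert ''u'' (writes ?body)) s s'"
    show "wp (7 * n + 9) ?body (\<lambda>s'. J (Suc i) (upd s' ''u'' 0 (int (Suc i)))) s'"
    proof (rule wp_seq)
      show "wp 1 (''cnt'' ::= Const 0) (\<lambda>s2. s2 = upd s' ''cnt'' 0 0) s'" by (rule wp_Assign) simp
    next
      fix s1 assume s1: "s1 = upd s' ''cnt'' 0 0"
      show "wp (7 * n + 7) (?row ;; ?upd) (\<lambda>s'. J (Suc i) (upd s' ''u'' 0 (int (Suc i)))) s1"
      proof (rule wp_seq)
        let ?I = "\<lambda>k s2. s2 ''cnt'' 0 = int (card (X i \<inter> {..<k}))"
        show "wp (n * (3 + 4) + 3) ?row (?I n) s1"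
        proof (rule wp_For[where I = ?I])
          fix s2 assume "same (insert ''v'' (writes ?count)) s1 s2"
          thus "aval (Var ''n'') s2 = int n" using inp sm s1 by (simp add: same_def inputs_def)
        next
          show "?I 0 (upd s1 ''v'' 0 0)" by (simp add: s1)
        next
          fix v s2 assume v: "v < n" and I: "?I v s2" and vv: "s2 ''v'' 0 = int v" and sm2: "same (insert ''v'' (writes ?count)) s1 s2"
          have "s2 ''bag'' = s ''bag''" "s2 ''row'' = s ''row''" "s2 ''u'' 0 = int i" using sm2 sm u s1 by (simp_all add: same_def)
          hence "bval (in_bag (Var ''u'')) s2 \<longleftrightarrow> v \<in> X i" using inp row i v vv by (simp add: in_bag_def inputs_def)
          moreover have "X i \<inter> {..<Suc v} = (if v \<in> X i then insert v (X i \<inter> {..<v}) else X i \<inter> {..<v})" by (auto simp: less_Suc_eq)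
          ultimately show "wp 3 ?count (\<lambda>s'. ?I (Suc v) (upd s' ''v'' 0 (int (Suc v)))) s2"
            using I by (intro wp_simple) simp_all
        qed auto
      next
        fix s2 assume c: "s2 ''cnt'' 0 = int (card (X i \<inter> {..<n}))" and sm2: "same (writes ?row) s1 s2"
        have Xi: "X i \<inter> {..<n} = X i" using X_less[OF i] by blast
        define m where "m = Max (insert 0 ((\<lambda>i. card (X i)) ` {..<i}))"
        have "insert 0 ((\<lambda>i. card (X i)) ` {..<Suc i}) = insert (card (X i)) (insert 0 ((\<lambda>i. card (X i)) ` {..<i}))"
          by (auto simp: lessThan_Suc)
        hence M: "Max (insert 0 ((\<lambda>i. card (X i)) ` {..<Suc i})) = max (card (X i)) m" by (simp add: m_def)
        have "s2 ''p1'' 0 = int m" using J sm2 s1 by (simp add: same_def J_def m_def)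
        thus "wp 2 ?upd (\<lambda>s'. J (Suc i) (upd s' ''u'' 0 (int (Suc i)))) s2"
          using c unfolding Xi J_def M by (intro wp_simple) auto
      qed simp
    qed simp
  qed auto
  thus ?thesis unfolding Bag_size_def
  proof (rule wp_conseq)
    fix s' assume J: "J N s'"
    have "(\<lambda>i. card (X i)) ` {..<N} \<noteq> {}" using N_pos by auto
    hence "Max (insert 0 ((\<lambda>i. card (X i)) ` {..<N})) = p + 1" by (simp add: Max_card)
    thus "s' ''p1'' 0 = int (p + 1)" using J by (simp add: J_def)
  qed simp
qed

lemma wp_Tops:
  assumes inp: "inputs s" and row: "\<And>i. i \<le> N \<Longrightarrow> s ''row'' (int i) = int (i * n)"
  shows "wp (N * (6 * n + 7) + 3) Tops (\<lambda>s'. \<forall>v<n. s' ''top'' (int v) = int (top v)) s"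
proof -
  let ?cond = "Conj (in_bag (Var ''u''))
            (Neg (Conj (in_bag (Cell ''parent'' (Var ''u'')))
              (Neg (Conj (Le (Var ''u'') (Var ''root'')) (Le (Var ''root'') (Var ''u''))))))"
  let ?step = "If_then ?cond (Assign ''top'' (Var ''v'') (Var ''u''))"
  let ?body = "For ''v'' (Var ''n'') ?step"
  define J where "J i s' \<longleftrightarrow> (\<forall>v<n. top v < i \<longrightarrow> s' ''top'' (int v) = int (top v))" for i and s' :: store
  have "wp (N * ((n * (2 + 4) + 3) + 4) + 3) (For ''u'' (Var ''N'') ?body) (J N) s"
  proof (rule wp_For[where I = J])
    fix s' assume "same (insert ''u'' (writes ?body)) s s'"
    thus "aval (Var ''N'') s' = int N" using inp by (simp add: same_def inputs_def in_bag_def)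
  next
    show "J 0 (upd s ''u'' 0 0)" by (simp add: J_def)
  next
    fix i s' assume i: "i < N" and J: "J i s'" and u: "s' ''u'' 0 = int i" and sm: "same (insert ''u'' (writes ?body)) s s'"
    let ?I = "\<lambda>k s2. \<forall>v<n. (top v < i \<longrightarrow> s2 ''top'' (int v) = int (top v)) \<and> (v < k \<longrightarrow> top v = i \<longrightarrow> s2 ''top'' (int v) = int i)"
    have "wp (n * (2 + 4) + 3) ?body (?I n) s'"
    proof (rule wp_For[where I = ?I])
      fix s2 assume "same (insert ''v'' (writes ?step)) s' s2"
      thus "aval (Var ''n'') s2 = int n" using inp sm by (simp add: same_def inputs_def in_bag_def)
    next
      show "?I 0 (upd s' ''v'' 0 0)" using J by (simp add: J_def)
    next
      fix v s2 assume v: "v < n" and I: "?I v s2" and vv: "s2 ''v'' 0 = int v" and sm2: "same (insert ''v'' (writes ?step)) s' s2"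
      have f: "s2 ''bag'' = s ''bag''" "s2 ''row'' = s ''row''" "s2 ''u'' 0 = int i" "s2 ''parent'' = s ''parent''" "s2 ''root'' 0 = int r"
        using sm2 sm u inp by (simp_all add: same_def in_bag_def inputs_def)
      have pi: "par i < N" using par_in i by simp
      have "bval ?cond s2 \<longleftrightarrow> v \<in> X i \<and> \<not> (v \<in> X (par i) \<and> i \<noteq> r)"
        using inp row i v vv pi by (auto simp: f in_bag_def inputs_def)
      also have "\<dots> \<longleftrightarrow> is_top v i" using i by (auto simp: is_top_def)
      also have "\<dots> \<longleftrightarrow> top v = i" using is_top_iff[OF v] by auto
      finally have c: "bval ?cond s2 \<longleftrightarrow> top v = i" .
      have "exec ?step s2 = (if top v = i then upd s2 ''top'' (int v) (int i) else s2)"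
        using c vv f(3) by (simp del: bval.simps)
      hence "?I (Suc v) (upd (exec ?step s2) ''v'' 0 (int (Suc v)))" using I by (auto simp: less_Suc_eq)
      thus "wp 2 ?step (\<lambda>s'. ?I (Suc v) (upd s' ''v'' 0 (int (Suc v)))) s2" by (intro wp_simple) simp_all
    qed auto
    thus "wp (n * (2 + 4) + 3) ?body (\<lambda>s'. J (Suc i) (upd s' ''u'' 0 (int (Suc i)))) s'"
      by (rule wp_conseq) (auto simp: J_def less_Suc_eq)
  qed (auto simp: in_bag_def)
  thus ?thesis unfolding Tops_def
  proof (rule wp_conseq)
    fix s' assume "J N s'"
    thus "\<forall>v<n. s' ''top'' (int v) = int (top v)" using top_in by (simp add: J_def)
  qed simp
qed

lemma wp_Keys:
  assumes inp: "inputs s" and t: "\<And>v. v < n \<Longrightarrow> s ''top'' (int v) = int (top v)"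
  shows "wp (n * (5 * N + 9) + 5) Keys (\<lambda>s'. (\<forall>v<n. s' ''key'' (int v) = int (key v)) \<and> s' ''key'' (int n) = -1) s"
proof -
  let ?cond = "Neg (Conj (Le (Var ''u'') (Var ''root'')) (Le (Var ''root'') (Var ''u'')))"
  let ?init = "Assign ''key'' (Var ''v'') (Var ''v'') ;; ''u'' ::= Cell ''top'' (Var ''v'')"
  let ?step = "''u'' ::= Cell ''parent'' (Var ''u'') ;; Assign ''key'' (Var ''v'') (Add (Cell ''key'' (Var ''v'')) (Var ''n''))"
  let ?body = "?init ;; While ?cond ?step"
  let ?J = "\<lambda>k s'. \<forall>v<k. s' ''key'' (int v) = int (key v)"
  have loop: "wp (n * ((5 * N + 5) + 4) + 3) (For ''v'' (Var ''n'') ?body) (?J n) s"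
  proof (rule wp_For[where I = ?J])
    fix s' assume "same (insert ''v'' (writes ?body)) s s'"
    thus "aval (Var ''n'') s' = int n" using inp by (simp add: same_def inputs_def)
  next
    fix v s' assume v: "v < n" and J: "?J v s'" and vv: "s' ''v'' 0 = int v" and sm: "same (insert ''v'' (writes ?body)) s s'"
    have f: "s' ''parent'' = s ''parent''" "s' ''root'' 0 = int r" "s' ''n'' 0 = int n" "s' ''top'' = s ''top''"
      using sm inp by (simp_all add: same_def inputs_def)
    \<comment> \<open>The index is the remaining distance to the root; \<open>n\<close> times this
      distance is what the key still lacks.\<close>
    define I where "I m s2 \<longleftrightarrow> s2 ''v'' 0 = int v \<and> s2 ''parent'' = s ''parent'' \<and> s2 ''root'' 0 = int r \<and> s2 ''n'' 0 = int n \<and>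
       (\<forall>u<v. s2 ''key'' (int u) = int (key u)) \<and>
       (\<exists>i<N. s2 ''u'' 0 = int i \<and> depth i = m \<and> s2 ''key'' (int v) + int (n * m) = int (key v))" for m and s2 :: store
    have topN: "top v < N" "top v \<in> {..<N}" using top_in[OF v] by auto
    show "wp (5 * N + 5) ?body (\<lambda>s'. ?J (Suc v) (upd s' ''v'' 0 (int (Suc v)))) s'"
    proof (rule wp_seq)
      show "wp 3 ?init (I (depth (top v))) s'"
        using J vv f t[OF v] topN by (intro wp_simple) (simp_all add: I_def key_def)
    next
      fix s2 assume I2: "I (depth (top v)) s2"
      have "wp (depth (top v) * (3 + 2) + 1) (While ?cond ?step) (I 0) s2"
      proof (rule wp_While[where I = I])
        show "I (depth (top v)) s2" by (rule I2)
      next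
        fix m s3 assume "I (Suc m) s3"
        then obtain i where I3: "s3 ''v'' 0 = int v" "s3 ''parent'' = s ''parent''" "s3 ''root'' 0 = int r" "s3 ''n'' 0 = int n"
          "\<And>u. u < v \<Longrightarrow> s3 ''key'' (int u) = int (key u)"
          "i < N" "s3 ''u'' 0 = int i" "depth i = Suc m" "s3 ''key'' (int v) + int (n * Suc m) = int (key v)"
          by (auto simp: I_def)
        have "i \<noteq> r" using I3(8) depth_r by auto
        hence "bval ?cond s3" using I3 by auto
        moreover have "wp 3 ?step (I m) s3"
        proof (rule wp_simple)
          have pi: "par i < N" "depth (par i) = m" using par_in depth_par'[of i] I3(6,8) by auto
          have "s3 ''parent'' (int i) = int (par i)" using inp I3 by (simp add: inputs_def)
          thus "I m (exec ?step s3)" using I3 pi unfolding I_def by (simp add: algebra_simps)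
        qed simp_all
        ultimately show "bval ?cond s3 \<and> wp 3 ?step (I m) s3" ..
      next
        fix s3 assume I3: "I 0 s3"
        hence "s3 ''u'' 0 = s3 ''root'' 0" using depth_0 by (auto simp: I_def)
        thus "\<not> bval ?cond s3 \<and> I 0 s3" using I3 by simp
      qed
      thus "wp (5 * N + 1) (While ?cond ?step) (\<lambda>s'. ?J (Suc v) (upd s' ''v'' 0 (int (Suc v)))) s2"
      proof (rule wp_conseq)
        show "depth (top v) * (3 + 2) + 1 \<le> 5 * N + 1" using depth_less[OF topN(2)] by simp
      qed (auto simp: I_def less_Suc_eq)
    qed simp
  qed auto
  show ?thesis unfolding Keys_def
  proof (rule wp_seq[OF loop])
    fix s' assume J: "?J n s'" and sm: "same (writes (For ''v'' (Var ''n'') ?body)) s s'"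
    have "s' ''n'' 0 = int n" using sm inp by (simp add: same_def inputs_def)
    thus "wp 1 (Assign ''key'' (Var ''n'') (Const (-1))) (\<lambda>s'. (\<forall>v<n. s' ''key'' (int v) = int (key v)) \<and> s' ''key'' (int n) = -1) s'"
      using J by (intro wp_Assign) auto
  qed (simp add: algebra_simps)
qed

lemma wp_Find_v0:
  assumes inp: "inputs s"
  shows "wp (6 * n + 3) Find_v0 (\<lambda>s'. \<exists>v0\<in>S. s' ''v0'' 0 = int v0) s"
proof -
  let ?body = "If_then (Pos (Cell ''S'' (Var ''v''))) (''v0'' ::= Var ''v'')"
  let ?J = "\<lambda>k s'. S \<inter> {..<k} \<noteq> {} \<longrightarrow> (\<exists>v0\<in>S. s' ''v0'' 0 = int v0)"
  have "wp (n * (2 + 4) + 3) (For ''v'' (Var ''n'') ?body) (?J n) s"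
  proof (rule wp_For[where I = ?J])
    fix s' assume "same (insert ''v'' (writes ?body)) s s'"
    thus "aval (Var ''n'') s' = int n" using inp by (simp add: same_def inputs_def)
  next
    fix k s' assume k: "k < n" and J: "?J k s'" and v: "s' ''v'' 0 = int k" and sm: "same (insert ''v'' (writes ?body)) s s'"
    have Sk: "s' ''S'' (int k) = of_bool (k \<in> S)" using sm inp k by (simp add: same_def inputs_def)
    show "wp 2 ?body (\<lambda>s'. ?J (Suc k) (upd s' ''v'' 0 (int (Suc k)))) s'"
    proof (cases "k \<in> S")
      case True
      thus ?thesis using Sk v by (intro wp_simple) auto
    next
      case False
      hence "S \<inter> {..<Suc k} = S \<inter> {..<k}" by (auto simp: less_Suc_eq)
      thus ?thesis using False Sk J v by (intro wp_simple) auto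
    qed
  qed auto
  moreover have "S \<inter> {..<n} \<noteq> {}" using S by blast
  ultimately have "wp (n * (2 + 4) + 3) Find_v0 (\<lambda>s'. \<exists>v0\<in>S. s' ''v0'' 0 = int v0) s" by (simp add: Find_v0_def)
  thus ?thesis by (rule wp_conseq) simp_all
qed

end

section \<open>Random bits and the answer\<close>

definition Flips :: com where
  "Flips = For ''i'' (Var ''nr'') (Flip ''coin'' ;; Assign ''rnd'' (Var ''i'') (Var ''coin''))"

lemma writes_Flips: "writes Flips = {''i'', ''coin'', ''rnd''}"
  by (auto simp: Flips_def)

lemma ends_While_True:
  assumes "bval b s" "ends t c s Q" "\<And>s'. s' \<in> set_pmf Q \<Longrightarrow> ends u (While b c) s' (R s')"
  shows "ends (t + u + 2) (While b c) s (bind_pmf Q R)"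
proof -
  have "ends (Suc (t + u + 1)) (While b c) s (bind_pmf (step (While b c, s)) (\<lambda>_. bind_pmf Q R))"
    by (rule ends_step) (use assms ends_Then[of t c s Q u "While b c" R] in auto)
  thus ?thesis by (simp add: bind_return_pmf)
qed

lemma ends_Flip: "ends 1 (Flip x) s (map_pmf (\<lambda>b. upd s x 0 (of_bool b)) (bernoulli_pmf (1 / 2)))"
  by (simp add: ends_def map_pmf_comp bind_return_pmf bind_return_pmf')

lemma ends_simple: "simple c \<Longrightarrow> cost c \<le> t \<Longrightarrow> ends t c s (return_pmf (exec c s))"
  using wp_simple[of c t "\<lambda>s'. s' = exec c s" s] by (auto simp: wp_def)

text \<open>All randomness is in the bit vector \<open>f\<close>: the final store is a function
  \<open>st\<close> of it, which makes the remaining program deterministic for each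
  \<open>f\<close>. The induction splits off the coin of cell \<open>k\<close>.\<close>

lemma ends_Flips_from:
  fixes s :: store
  assumes "k \<le> m" "s ''i'' 0 = int k" "s ''nr'' 0 = int m"
  shows "\<exists>st. ends (7 * (m - k) + 1)
      (While (Less (Var ''i'') (Var ''nr'')) ((Flip ''coin'' ;; Assign ''rnd'' (Var ''i'') (Var ''coin'')) ;; ''i'' ::= Add (Var ''i'') (Const 1)))
      s (map_pmf st (Pi_pmf {k..<m} False (\<lambda>_. bernoulli_pmf (1 / 2)))) \<and>
    (\<forall>f j. k \<le> j \<longrightarrow> j < m \<longrightarrow> st f ''rnd'' (int j) = of_bool (f j)) \<and>
    (\<forall>f j. j < k \<longrightarrow> st f ''rnd'' (int j) = s ''rnd'' (int j))"
  using assms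
proof (induction "m - k" arbitrary: k s)
  case 0
  hence "k = m" by simp
  moreover have "ends 1 (While b c) s (return_pmf s)" if "\<not> bval b s" for b c
    using wp_While_False[of b s "\<lambda>s'. s' = s" c] that by (auto simp: wp_def)
  ultimately show ?case using 0 by (intro exI[of _ "\<lambda>_. s"]) simp
next
  case (Suc l)
  let ?body = "(Flip ''coin'' ;; Assign ''rnd'' (Var ''i'') (Var ''coin'')) ;; ''i'' ::= Add (Var ''i'') (Const 1)"
  let ?W = "While (Less (Var ''i'') (Var ''nr'')) ?body"
  let ?B = "bernoulli_pmf (1 / 2)" and ?P = "Pi_pmf {Suc k..<m} False (\<lambda>_. bernoulli_pmf (1 / 2))"
  define nx where "nx b = upd (upd (upd s ''coin'' 0 (of_bool b)) ''rnd'' (int k) (of_bool b)) ''i'' 0 (int (Suc k))" for b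
  have km: "k < m" "l = m - Suc k" using Suc by auto
  have body: "ends 5 ?body s (map_pmf nx ?B)"
  proof -
    have "ends (1 + 1 + 1) (Flip ''coin'' ;; Assign ''rnd'' (Var ''i'') (Var ''coin'')) s
       (bind_pmf (map_pmf (\<lambda>b. upd s ''coin'' 0 (of_bool b)) ?B) (\<lambda>s'. return_pmf (exec (Assign ''rnd'' (Var ''i'') (Var ''coin'')) s')))"
      by (rule ends_Then[OF ends_Flip]) (rule ends_simple, simp_all)
    from ends_Then[OF this, of 1 "''i'' ::= Add (Var ''i'') (Const 1)" "\<lambda>s'. return_pmf (exec (''i'' ::= Add (Var ''i'') (Const 1)) s')"]
    have "ends 5 ?body s (bind_pmf (bind_pmf (map_pmf (\<lambda>b. upd s ''coin'' 0 (of_bool b)) ?B)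
        (\<lambda>s'. return_pmf (exec (Assign ''rnd'' (Var ''i'') (Var ''coin'')) s')))
        (\<lambda>s'. return_pmf (exec (''i'' ::= Add (Var ''i'') (Const 1)) s')))"
      using ends_simple[of "''i'' ::= Add (Var ''i'') (Const 1)" 1] by (simp add: numeral_eq_Suc)
    thus ?thesis using Suc.prems by (simp add: bind_map_pmf bind_assoc_pmf bind_return_pmf map_pmf_def nx_def add.commute)
  qed
  have "\<exists>st. ends (7 * (m - Suc k) + 1) ?W (nx b) (map_pmf st ?P) \<and>
    (\<forall>f j. Suc k \<le> j \<longrightarrow> j < m \<longrightarrow> st f ''rnd'' (int j) = of_bool (f j)) \<and>
    (\<forall>f j. j < Suc k \<longrightarrow> st f ''rnd'' (int j) = nx b ''rnd'' (int j))" for b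
    by (rule Suc.hyps(1)) (use km Suc.prems in \<open>auto simp: nx_def\<close>)
  then obtain st where st: "\<And>b. ends (7 * (m - Suc k) + 1) ?W (nx b) (map_pmf (st b) ?P)"
    "\<And>b f j. Suc k \<le> j \<Longrightarrow> j < m \<Longrightarrow> st b f ''rnd'' (int j) = of_bool (f j)"
    "\<And>b f j. j < Suc k \<Longrightarrow> st b f ''rnd'' (int j) = nx b ''rnd'' (int j)" by metis
  \<comment> \<open>The induction hypothesis samples vectors that are \<open>False\<close> at
    \<open>k\<close>, hence the reset of this bit.\<close>
  define st' where "st' f = st (f k) (f(k := False))" for f
  have inj: "nx b = nx b' \<Longrightarrow> b = b'" for b b'
    by (drule fun_cong[of _ _ "''coin''"], drule fun_cong[of _ _ 0]) (simp add: nx_def of_bool_eq_iff)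
  \<comment> \<open>Continuations depend on the store, not on the coin; \<open>un\<close> reads the
    coin back from the store.\<close>
  define un where "un s' = (THE b. nx b = s')" for s'
  have un: "un (nx b) = b" for b
    unfolding un_def
  proof (rule the_equality)
    fix b' assume "nx b' = nx b"
    thus "b' = b" by (rule inj)
  qed simp
  have "ends (5 + (7 * (m - Suc k) + 1) + 2) ?W s (bind_pmf (map_pmf nx ?B) (\<lambda>s'. map_pmf (st (un s')) ?P))"
    by (rule ends_While_True[OF _ body]) (use Suc.prems km st(1) un in auto)
  moreover have "bind_pmf (map_pmf nx ?B) (\<lambda>s'. map_pmf (st (un s')) ?P) = map_pmf st' (Pi_pmf {k..<m} False (\<lambda>_. ?B))"
  proof -
    have "{k..<m} = insert k {Suc k..<m}" using km by auto
    hence "Pi_pmf {k..<m} False (\<lambda>_. ?B) = map_pmf (\<lambda>(b, f). f(k := b)) (pair_pmf ?B ?P)"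
      by (simp add: Pi_pmf_insert)
    hence "map_pmf st' (Pi_pmf {k..<m} False (\<lambda>_. ?B)) = bind_pmf ?B (\<lambda>b. map_pmf (\<lambda>f. st' (f(k := b))) ?P)"
      by (simp add: map_pmf_comp pair_pmf_def map_bind_pmf map_pmf_def bind_assoc_pmf bind_return_pmf)
    also have "\<dots> = bind_pmf ?B (\<lambda>b. map_pmf (st b) ?P)"
    proof (intro bind_pmf_cong refl map_pmf_cong)
      fix b f assume "f \<in> set_pmf ?P"
      hence "f \<in> {f. \<forall>x. x \<notin> {Suc k..<m} \<longrightarrow> \<not> f x}"
        using set_Pi_pmf_subset[of "{Suc k..<m}" False "\<lambda>_. ?B"] by auto
      hence "f k = False" by simp
      hence "f(k := False) = f" by (rule fun_upd_idem)
      thus "st' (f(k := b)) = st b f" by (simp add: st'_def)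
    qed
    finally show ?thesis by (simp add: bind_map_pmf un)
  qed
  moreover have "5 + (7 * (m - Suc k) + 1) + 2 = 7 * (m - k) + 1" using km by simp
  ultimately have W: "ends (7 * (m - k) + 1) ?W s (map_pmf st' (Pi_pmf {k..<m} False (\<lambda>_. ?B)))" by (simp only:)
  have "st' f ''rnd'' (int j) = of_bool (f j)" if "k \<le> j" "j < m" for f j
    using st(2)[of j] st(3)[of j] that by (cases "j = k") (auto simp: st'_def nx_def)
  moreover have "st' f ''rnd'' (int j) = s ''rnd'' (int j)" if "j < k" for f j
    using st(3)[of j] that by (simp add: st'_def nx_def)
  ultimately show ?case using W by (intro exI[of _ st'] conjI) simp_all
qed

lemma ends_Flips:
  assumes "s ''nr'' 0 = int m"
  shows "\<exists>st. ends (7 * m + 3) Flips s (map_pmf st (random_bits m)) \<and>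
    (\<forall>f j. j < m \<longrightarrow> st f ''rnd'' (int j) = of_bool (f j))"
proof -
  define s1 where "s1 = upd s ''i'' 0 0"
  obtain st where st: "ends (7 * m + 1)
      (While (Less (Var ''i'') (Var ''nr'')) ((Flip ''coin'' ;; Assign ''rnd'' (Var ''i'') (Var ''coin'')) ;; ''i'' ::= Add (Var ''i'') (Const 1)))
      s1 (map_pmf st (Pi_pmf {0..<m} False (\<lambda>_. bernoulli_pmf (1 / 2))))"
    "\<And>f j. j < m \<Longrightarrow> st f ''rnd'' (int j) = of_bool (f j)"
    using ends_Flips_from[of 0 m s1] assms by (auto simp: s1_def)
  have "ends (1 + (7 * m + 1) + 1) Flips s (bind_pmf (return_pmf s1) (\<lambda>_. map_pmf st (Pi_pmf {0..<m} False (\<lambda>_. bernoulli_pmf (1 / 2)))))"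
    unfolding Flips_def For_def
    by (rule ends_Then) (use st ends_simple[of "''i'' ::= Const 0" 1 s] in \<open>auto simp: s1_def\<close>)
  hence "ends (7 * m + 3) Flips s (map_pmf st (random_bits m))"
    by (simp add: bind_return_pmf random_bits_def atLeast0LessThan numeral_eq_Suc)
  thus ?thesis using st(2) by blast
qed

text \<open>Two bit vectors may lead to the same intermediate store, so the continuation has to be a
  function \<open>h\<close> of the store; uniqueness of the final store identifies
  \<open>h (st f)\<close> with the result \<open>g f\<close>.\<close>

lemma ends_Then_wp:
  assumes "ends t c s (map_pmf st P)" "\<And>f. f \<in> set_pmf P \<Longrightarrow> wp u d (Q f) (st f)"
  shows "\<exists>fin. ends (t + u + 1) (Then c d) s (map_pmf fin P) \<and> (\<forall>f\<in>set_pmf P. Q f (fin f))"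
proof -
  have "\<exists>g. \<forall>f\<in>set_pmf P. ends u d (st f) (return_pmf (g f)) \<and> Q f (g f)"
    using assms(2) unfolding wp_def by (intro bchoice) blast
  then obtain g where g: "\<And>f. f \<in> set_pmf P \<Longrightarrow> ends u d (st f) (return_pmf (g f)) \<and> Q f (g f)" by blast
  define h where "h s' = (SOME s''. ends u d s' (return_pmf s''))" for s'
  have h: "ends u d (st f) (return_pmf (h (st f)))" if "f \<in> set_pmf P" for f
    unfolding h_def
    by (rule someI[of "\<lambda>s''. ends u d (st f) (return_pmf s'')", OF conjunct1[OF g[OF that]]])
  have hg: "h (st f) = g f" if "f \<in> set_pmf P" for f
  proof -
    have "return_pmf (Skip, h (st f)) = return_pmf (Skip, g f)"
      using h[OF that] g[OF that] unfolding ends_def map_return_pmf by simp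
    thus ?thesis by simp
  qed
  have "ends (t + u + 1) (Then c d) s (bind_pmf (map_pmf st P) (\<lambda>s'. return_pmf (h s')))"
  proof (rule ends_Then[OF assms(1)])
    fix s' assume "s' \<in> set_pmf (map_pmf st P)"
    then obtain f where "f \<in> set_pmf P" "s' = st f" by auto
    thus "ends u d s' (return_pmf (h s'))" using h by simp
  qed
  also have "bind_pmf (map_pmf st P) (\<lambda>s'. return_pmf (h s')) = map_pmf g P"
    unfolding bind_map_pmf map_pmf_def[of g] by (intro bind_pmf_cong refl) (simp add: hg)
  finally have "ends (t + u + 1) (Then c d) s (map_pmf g P)" .
  thus ?thesis using g by (intro exI[of _ g] conjI ballI) simp_all
qed

text \<open>All bits are extracted in one pass from the top: comparison with a power of two reveals
  a bit only after the higher ones have been removed.\<close>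

definition Read_bits :: com where
  "Read_bits =
    ''z'' ::= Add (Cell ''acc'' (Cell ''off'' (Var ''n''))) (Const 1) ;;
    For ''i'' (Add (Var ''L'') (Const 1))
      (''mh'' ::= Sub (Var ''L'') (Var ''i'') ;;
       If_then (Le (Cell ''pw'' (Var ''mh'')) (Var ''z''))
         (Incr ''z'' (Sub (Const 0) (Cell ''pw'' (Var ''mh''))) ;; Assign ''bit'' (Var ''mh'') (Const 1)))"

text \<open>Consecutive values of the weight are \<open>b\<close> positions apart, since a digit in
  base \<open>2^b\<close> has \<open>b\<close> bits; only its lowest bit, the parity, is
  inspected.\<close>

definition Search :: com where
  "Search =
    For ''i'' (Var ''lim'')
      (If_then (Pos (Cell ''bit'' (Var ''q''))) (''out'' ::= Const 1) ;; Incr ''q'' (Var ''b''))"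

text \<open>The product of \<open>M\<close> with the number of admissible sizes, obtained by
  additions. Every integer \<open>k\<close> is covered, as only sizes from 0 to \<open>n\<close> are
  compared with it.\<close>

definition Limit :: com where
  "Limit =
    ''lim'' ::= Const 0 ;;
    For ''j'' (Add (Var ''n'') (Const 1)) (If_then (Le (Var ''j'') (Var ''k'')) (Incr ''lim'' (Var ''M'')))"

lemma writes_answer: "writes Read_bits = {''z'', ''i'', ''mh'', ''bit''}" "writes Search = {''i'', ''out'', ''q''}"
  "writes Limit = {''lim'', ''j''}"
  by (auto simp: Read_bits_def Search_def Limit_def)

lemma bit_iff: "2 ^ h \<le> (Z :: int) mod 2 ^ Suc h \<longleftrightarrow> odd (Z div 2 ^ h)"
  using digit_step[where b = Z and h = h] by (cases "2 ^ h \<le> Z mod 2 ^ Suc h") (simp_all del: power_Suc)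

lemma wp_Read_bits:
  assumes p: "powers L s" and Z: "s ''acc'' (s ''off'' (s ''n'' 0)) + 1 = Z" "0 \<le> Z" "Z \<le> 2 ^ L" and b: "s ''bit'' = (\<lambda>_. 0)"
  shows "wp (11 * L + 20) Read_bits (\<lambda>s'. \<forall>h. s' ''bit'' (int h) = of_bool (odd (Z div 2 ^ h))) s"
proof -
  let ?body = "''mh'' ::= Sub (Var ''L'') (Var ''i'') ;;
       If_then (Le (Cell ''pw'' (Var ''mh'')) (Var ''z''))
         (Incr ''z'' (Sub (Const 0) (Cell ''pw'' (Var ''mh''))) ;; Assign ''bit'' (Var ''mh'') (Const 1))"
  define s1 where "s1 = upd s ''z'' 0 Z"
  define J where "J k s' \<longleftrightarrow> s' ''z'' 0 = Z mod 2 ^ (L + 1 - k) \<and>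
     (\<forall>h. s' ''bit'' (int h) = of_bool (L + 1 - k \<le> h \<and> odd (Z div 2 ^ h)))" for k and s' :: store
  have "(2::int) ^ L < 2 ^ (L + 1)" by simp
  hence ZL: "Z < 2 ^ (L + 1)" using Z(3) by linarith
  have loop: "wp ((L + 1) * (6 + 4) + 3) (For ''i'' (Add (Var ''L'') (Const 1)) ?body)
     (\<lambda>s'. \<forall>h. s' ''bit'' (int h) = of_bool (odd (Z div 2 ^ h))) s1"
  proof (rule wp_For[where I = J])
    fix s' assume "same (insert ''i'' (writes ?body)) s1 s'"
    thus "aval (Add (Var ''L'') (Const 1)) s' = int (L + 1)" using p by (simp add: same_def s1_def powers_def)
  next
    \<comment> \<open>Above position \<open>L\<close> all bits of \<open>Z\<close> vanish, in
      accordance with the cleared array \<open>bit\<close>.\<close>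
    have "even (Z div 2 ^ h)" if "L + 1 \<le> h" for h
    proof -
      have "(2::int) ^ (L + 1) \<le> 2 ^ h" using that by (intro power_increasing) auto
      hence "Z < 2 ^ h" using ZL by linarith
      thus ?thesis using Z(2) by simp
    qed
    hence "\<forall>h. \<not> (L + 1 \<le> h \<and> odd (Z div 2 ^ h))" by blast
    thus "J 0 (upd s1 ''i'' 0 0)" using Z(2) ZL b by (simp add: J_def s1_def del: power_Suc)
  next
    fix k s' assume k: "k < L + 1" and J: "J k s'" and i: "s' ''i'' 0 = int k" and sm: "same (insert ''i'' (writes ?body)) s1 s'"
    define h where "h = L - k"
    have h: "L + 1 - k = Suc h" "L + 1 - Suc k = h" "h \<le> L" "int L - int k = int h" using k by (auto simp: h_def)
    have f: "s' ''L'' 0 = int L" "s' ''pw'' (int h) = 2 ^ h" using sm p h by (simp_all add: same_def powers_def s1_def)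
    have J': "s' ''z'' 0 = Z mod 2 ^ Suc h" "\<And>h'. s' ''bit'' (int h') = of_bool (Suc h \<le> h' \<and> odd (Z div 2 ^ h'))"
      using J unfolding J_def h by simp_all
    show "wp 6 ?body (\<lambda>s'. J (Suc k) (upd s' ''i'' 0 (int (Suc k)))) s'"
    proof (cases "2 ^ h \<le> Z mod 2 ^ Suc h")
      case True
      have "exec ?body s' = upd (upd (upd s' ''mh'' 0 (int h)) ''z'' 0 (Z mod 2 ^ Suc h - 2 ^ h)) ''bit'' (int h) 1"
        using True by (simp add: i f h(4) J'(1) del: power_Suc)
      moreover have "Z mod 2 ^ Suc h - 2 ^ h = Z mod 2 ^ h" using digit_step(1)[OF True] by simp
      moreover have "odd (Z div 2 ^ h)" using True bit_iff by blast
      ultimately have "J (Suc k) (upd (exec ?body s') ''i'' 0 (int (Suc k)))"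
        unfolding J_def h by (auto simp: J'(2) le_less Suc_le_eq)
      thus ?thesis by (intro wp_simple) simp_all
    next
      case False
      have "exec ?body s' = upd s' ''mh'' 0 (int h)"
        using False by (simp add: i f h(4) J'(1) del: power_Suc)
      moreover have "Z mod 2 ^ Suc h = Z mod 2 ^ h" using digit_step(2)[OF False] by simp
      moreover have "even (Z div 2 ^ h)" using False bit_iff by blast
      ultimately have "J (Suc k) (upd (exec ?body s') ''i'' 0 (int (Suc k)))"
        unfolding J_def h by (auto simp: J' le_less Suc_le_eq simp del: power_Suc)
      thus ?thesis by (intro wp_simple) simp_all
    qed
  qed (auto simp: J_def)
  show ?thesis unfolding Read_bits_def
  proof (rule wp_seq)
    show "wp 1 (''z'' ::= Add (Cell ''acc'' (Cell ''off'' (Var ''n''))) (Const 1)) (\<lambda>s'. s' = s1) s"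
      by (rule wp_Assign) (use Z(1) in \<open>simp add: s1_def\<close>)
  next
    fix s' assume "s' = s1"
    thus "wp ((L + 1) * (6 + 4) + 3) (For ''i'' (Add (Var ''L'') (Const 1)) ?body)
     (\<lambda>s'. \<forall>h. s' ''bit'' (int h) = of_bool (odd (Z div 2 ^ h))) s'" using loop by simp
  qed simp
qed

lemma wp_Limit:
  assumes n: "s ''n'' 0 = int n" and k: "s ''k'' 0 = k" and M: "s ''M'' 0 = int M"
  shows "wp (6 * n + 11) Limit (\<lambda>s'. s' ''lim'' 0 = int (M * card {j. j \<le> n \<and> int j \<le> k})) s"
proof -
  let ?body = "If_then (Le (Var ''j'') (Var ''k'')) (Incr ''lim'' (Var ''M''))"
  define s1 where "s1 = upd s ''lim'' 0 0"
  let ?J = "\<lambda>m s'. s' ''lim'' 0 = int (M * card {j. j < m \<and> int j \<le> k})"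
  have loop: "wp ((n + 1) * (2 + 4) + 3) (For ''j'' (Add (Var ''n'') (Const 1)) ?body) (?J (n + 1)) s1"
  proof (rule wp_For[where I = ?J])
    fix s' assume "same (insert ''j'' (writes ?body)) s1 s'"
    thus "aval (Add (Var ''n'') (Const 1)) s' = int (n + 1)" using n by (simp add: same_def s1_def)
  next
    show "?J 0 (upd s1 ''j'' 0 0)" by (simp add: s1_def)
  next
    fix m s' assume J: "?J m s'" and j: "s' ''j'' 0 = int m" and sm: "same (insert ''j'' (writes ?body)) s1 s'"
    have f: "s' ''k'' 0 = k" "s' ''M'' 0 = int M" using sm k M by (simp_all add: same_def s1_def)
    have "{j. j < Suc m \<and> int j \<le> k} = (if int m \<le> k then insert m {j. j < m \<and> int j \<le> k} else {j. j < m \<and> int j \<le> k})"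
      by (auto simp: less_Suc_eq)
    hence "card {j. j < Suc m \<and> int j \<le> k} = card {j. j < m \<and> int j \<le> k} + of_bool (int m \<le> k)" by simp
    thus "wp 2 ?body (\<lambda>s'. ?J (Suc m) (upd s' ''j'' 0 (int (Suc m)))) s'"
      using J f j by (intro wp_simple) (auto simp: algebra_simps)
  qed auto
  show ?thesis unfolding Limit_def
  proof (rule wp_seq)
    show "wp 1 (''lim'' ::= Const 0) (\<lambda>s'. s' = s1) s" by (rule wp_Assign) (simp add: s1_def)
  next
    fix s' assume "s' = s1"
    moreover have "{j. j < n + 1 \<and> int j \<le> k} = {j. j \<le> n \<and> int j \<le> k}" by auto
    ultimately show "wp ((n + 1) * (2 + 4) + 3) (For ''j'' (Add (Var ''n'') (Const 1)) ?body)
      (\<lambda>s'. s' ''lim'' 0 = int (M * card {j. j \<le> n \<and> int j \<le> k})) s'" using loop by simp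
  qed simp
qed

lemma wp_Search:
  assumes lim: "s ''lim'' 0 = int m" and b: "s ''b'' 0 = int b" and q: "s ''q'' 0 = int q" and out: "s ''out'' 0 = 0"
    and bit: "\<And>h. s ''bit'' (int h) = of_bool (P h)"
  shows "wp (8 * m + 3) Search (\<lambda>s'. s' ''out'' 0 = of_bool (\<exists>w<m. P (q + b * w))) s"
proof -
  let ?body = "If_then (Pos (Cell ''bit'' (Var ''q''))) (''out'' ::= Const 1) ;; Incr ''q'' (Var ''b'')"
  let ?J = "\<lambda>k s'. s' ''out'' 0 = of_bool (\<exists>w<k. P (q + b * w)) \<and> s' ''q'' 0 = int (q + b * k)"
  have "wp (m * (4 + 4) + 3) Search (\<lambda>s'. s' ''out'' 0 = of_bool (\<exists>w<m. P (q + b * w))) s"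
    unfolding Search_def
  proof (rule wp_For[where I = ?J])
    fix s' assume "same (insert ''i'' (writes ?body)) s s'"
    thus "aval (Var ''lim'') s' = int m" using lim by (simp add: same_def)
  next
    show "?J 0 (upd s ''i'' 0 0)" using out q by simp
  next
    fix k s' assume J: "?J k s'" and sm: "same (insert ''i'' (writes ?body)) s s'"
    have f: "s' ''b'' 0 = int b" "s' ''bit'' (s' ''q'' 0) = of_bool (P (q + b * k))"
      using sm b bit[of "q + b * k"] J by (simp_all add: same_def)
    have "(\<exists>w<Suc k. P (q + b * w)) \<longleftrightarrow> (\<exists>w<k. P (q + b * w)) \<or> P (q + b * k)" by (auto simp: less_Suc_eq)
    moreover have "exec ?body s' ''out'' 0 = (if P (q + b * k) then 1 else s' ''out'' 0)" using f(2) by simp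
    moreover have "exec ?body s' ''q'' 0 = int (q + b * Suc k)" using f J by (simp add: algebra_simps)
    ultimately have "?J (Suc k) (upd (exec ?body s') ''i'' 0 (int (Suc k)))" using J by (simp del: exec.simps)
    thus "wp 4 ?body (\<lambda>s'. ?J (Suc k) (upd s' ''i'' 0 (int (Suc k)))) s'" by (intro wp_simple) simp_all
  qed auto
  thus ?thesis by (rule wp_conseq) simp_all
qed

section \<open>Composition of the program\<close>

lemma wp_obtain:
  assumes "wp t c P s"
  obtains s' where "ends t c s (return_pmf s')" "P s'" "same (writes c) s s'"
  using wp_frame[OF assms] unfolding wp_def by blast

lemma ends_seq:
  assumes "ends t c s (return_pmf s')" "ends u d s' (return_pmf s'')"
  shows "ends (t + u + 1) (Then c d) s (return_pmf s'')"
  using ends_Then[OF assms(1), of u d "\<lambda>_. return_pmf s''"] assms(2) by (simp add: bind_return_pmf)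

definition Prepare :: com where
  "Prepare = Weights ;; Table ''row'' (Var ''n'') (Var ''N'') ;; Table ''arow'' (Var ''n'') (Var ''n'') ;;
     Bag_size ;; Tops ;; Keys ;; Find_v0"

text \<open>\<open>M\<close> exceeds the weight of every set, \<open>D\<close> exceeds every
  combination of size and weight, \<open>b\<close> is the number of bits per digit,
  \<open>bD = b * D\<close> is the exponent of \<open>d\<close>, and \<open>L\<close> bounds the
  exponent of table entries. Initially \<open>lim = N * n\<close> lies above all keys.\<close>

definition Parameters :: com where
  "Parameters =
    ''b'' ::= Add (Double (Var ''n'')) (Const 1) ;;
    Times ''M'' (Var ''R'') (Var ''n'') ;;
    Times ''D'' (Var ''M'') (Add (Var ''n'') (Const 1)) ;;
    Times ''bD'' (Var ''D'') (Var ''b'') ;;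
    Times ''t'' (Double (Var ''bD'')) (Var ''p1'') ;;
    Times ''L'' (Add (Var ''t'') (Const 2)) (Var ''n'') ;;
    Exponents ;; Powers ;;
    Table ''off'' (Cell ''pw'' (Double (Var ''n''))) (Var ''n'') ;;
    ''lim'' ::= Cell ''row'' (Var ''N'')"

definition Answer :: com where
  "Answer = Main_loop ;; Read_bits ;; Times ''q'' (Var ''bD'') (Var ''n'') ;; Limit ;; Search"

definition Program :: com where
  "Program = Bits_size ;; Flips ;; Prepare ;; Parameters ;; Answer"

text \<open>Arrays outside \<open>W\<close> are still cleared, as \<open>acc\<close>,
  \<open>bit\<close> and \<open>out\<close> have to be when the answer is computed.\<close>

definition fresh :: "string set \<Rightarrow> store \<Rightarrow> bool" where
  "fresh W s \<longleftrightarrow> (\<forall>y. y \<notin> W \<longrightarrow> s y = (\<lambda>_. 0))"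

lemma fresh_same: "fresh W s \<Longrightarrow> same W' s s' \<Longrightarrow> W \<union> W' \<subseteq> W'' \<Longrightarrow> fresh W'' s'"
  unfolding fresh_def same_def by (metis UnCI subsetD)

context instance_data
begin

definition lg :: nat where "lg = log2_ceil n"
definition M :: nat where "M = n * 2 ^ lg"
definition D :: nat where "D = M * (n + 1)"
definition b :: nat where "b = 2 * n + 1"
definition bD :: nat where "bD = b * D"
definition L :: nat where "L = n * (2 * bD * (p + 1) + 2)"

definition exponent :: "(nat \<Rightarrow> bool) \<Rightarrow> nat \<Rightarrow> nat" where
  "exponent f v = b * (D + M + weight lg f v)"

lemma lg: "2 * n \<le> 2 ^ lg" "lg \<le> 2 * n" "2 ^ lg \<le> 4 * n"
  using log2_ceil[OF n_pos] by (simp_all add: lg_def)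

lemma weight_sum_less:
  assumes "F \<subseteq> {..<n}"
  shows "(\<Sum>v\<in>F. weight lg f v) < M"
proof -
  have "(\<Sum>v\<in>F. weight lg f v) \<le> (\<Sum>v\<in>{..<n}. weight lg f v)" using assms by (intro sum_mono2) auto
  also have "\<dots> < (\<Sum>v\<in>{..<n}. 2 ^ lg)" using n_pos by (intro sum_strict_mono weight_less) auto
  finally show ?thesis by (simp add: M_def)
qed

lemma machine_instance: "machine {..<N} r par G n X (2 ^ bD) (\<lambda>v. 2 ^ exponent f v) bD L (p + 1) (exponent f)"
proof unfold_locales
  fix c assume c: "c < n"
  \<comment> \<open>For \<open>n > 0\<close> a weight is below \<open>M\<close> and
    \<open>2 * M\<close> is at most \<open>D\<close>, so the exponent of a vertex is at most
    \<open>2 * bD\<close>.\<close>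
  have "weight lg f c < 2 ^ lg" by (rule weight_less)
  also have "1 * 2 ^ lg \<le> M" unfolding M_def using n_pos by (intro mult_le_mono1) simp
  finally have "M + weight lg f c \<le> M * 2" by simp
  also have "\<dots> \<le> D" unfolding D_def using n_pos by (intro mult_le_mono2) simp
  finally have "b * (D + M + weight lg f c) \<le> b * (2 * D)" by (intro mult_le_mono2) simp
  thus "exponent f c \<le> 2 * bD" by (simp add: exponent_def bD_def mult_ac)
  show "card (K c) < p + 1" using K_card(2)[OF width c] by simp
qed (use n_pos in \<open>simp_all add: L_def\<close>)

definition bits_time :: nat where "bits_time = 15 * n + 10"
definition flips_time :: nat where "flips_time = 7 * (n * lg) + 3"
text \<open>The bracketing and the summands 1 repeat the nesting of \<open>Then\<close> in
  \<open>Prepare\<close>, so that \<open>ends_seq\<close> composes to exactly this term.\<close>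

definition prepare_time :: nat where
  "prepare_time = (n * (7 * lg + 7) + 5) + ((N * 5 + 3) + ((n * 5 + 3) + ((N * (7 * n + 13) + 3) +
     ((N * (6 * n + 7) + 3) + ((n * (5 * N + 9) + 5) + (6 * n + 3) + 1) + 1) + 1) + 1) + 1) + 1"

definition prepared :: "(nat \<Rightarrow> bool) \<Rightarrow> store \<Rightarrow> bool" where
  "prepared f s \<longleftrightarrow> inputs s \<and> s ''R'' 0 = 2 ^ lg \<and> (\<forall>v<n. s ''w'' (int v) = int (weight lg f v)) \<and>
     (\<forall>i\<le>N. s ''row'' (int i) = int (i * n)) \<and> (\<forall>i\<le>n. s ''arow'' (int i) = int (i * n)) \<and>
     s ''p1'' 0 = int (p + 1) \<and> (\<forall>v<n. s ''top'' (int v) = int (top v)) \<and>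
     (\<forall>v<n. s ''key'' (int v) = int (key v)) \<and> s ''key'' (int n) = -1 \<and> (\<exists>v0\<in>S. s ''v0'' 0 = int v0)"

definition random_names :: "string set" where
  "random_names = input_names \<union> {''R'', ''lg'', ''nr'', ''it'', ''i'', ''coin'', ''rnd''}"

definition prepare_names :: "string set" where
  "prepare_names = random_names \<union> {''q'', ''v'', ''w'', ''row'', ''arow'', ''u'', ''cnt'', ''p1'', ''top'', ''key'', ''v0''}"

lemma wp_Prepare:
  assumes inp: "inputs s" and lg: "s ''lg'' 0 = int lg" and R: "s ''R'' 0 = 2 ^ lg"
    and rnd: "\<And>i. i < n * lg \<Longrightarrow> s ''rnd'' (int i) = of_bool (f i)" and fr: "fresh random_names s"
  shows "wp prepare_time Prepare (prepared f) s"
proof -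
  have zero: "s ''w'' = (\<lambda>_. 0)" "s ''row'' = (\<lambda>_. 0)" "s ''arow'' = (\<lambda>_. 0)" "s ''p1'' = (\<lambda>_. 0)"
    using fr by (simp_all add: fresh_def random_names_def input_names_def)
  have nn: "s ''n'' 0 = int n" "s ''N'' 0 = int N" using inp by (simp_all add: inputs_def)
  obtain s1 where e1: "ends (n * (7 * lg + 7) + 5) Weights s (return_pmf s1)"
    and q1: "\<forall>v<n. s1 ''w'' (int v) = int (weight lg f v)" and m1: "same (writes Weights) s s1"
    by (rule wp_obtain[OF wp_Weights[OF nn(1) lg zero(1) rnd]])
  have i1: "inputs s1" by (rule inputs_same[OF m1 _ inp]) (simp add: writes_preprocessing input_names_def)
  have "wp (N * 5 + 3) (Table ''row'' (Var ''n'') (Var ''N'')) (\<lambda>s'. \<forall>j\<le>N. s' ''row'' (int j) = int j * int n) s1"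
    by (rule wp_Table) (use i1 m1 zero in \<open>auto simp: same_def inputs_def writes_preprocessing\<close>)
  then obtain s2 where e2: "ends (N * 5 + 3) (Table ''row'' (Var ''n'') (Var ''N'')) s1 (return_pmf s2)"
    and q2: "\<forall>j\<le>N. s2 ''row'' (int j) = int j * int n" and m2: "same (writes (Table ''row'' (Var ''n'') (Var ''N''))) s1 s2"
    by (rule wp_obtain)
  have i2: "inputs s2" by (rule inputs_same[OF m2 _ i1]) (simp add: input_names_def)
  have "wp (n * 5 + 3) (Table ''arow'' (Var ''n'') (Var ''n'')) (\<lambda>s'. \<forall>j\<le>n. s' ''arow'' (int j) = int j * int n) s2"
    by (rule wp_Table) (use i2 m1 m2 zero in \<open>auto simp: same_def inputs_def writes_preprocessing\<close>)
  then obtain s3 where e3: "ends (n * 5 + 3) (Table ''arow'' (Var ''n'') (Var ''n'')) s2 (return_pmf s3)"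
    and q3: "\<forall>j\<le>n. s3 ''arow'' (int j) = int j * int n" and m3: "same (writes (Table ''arow'' (Var ''n'') (Var ''n''))) s2 s3"
    by (rule wp_obtain)
  have i3: "inputs s3" by (rule inputs_same[OF m3 _ i2]) (simp add: input_names_def)
  have r3: "s3 ''row'' (int i) = int (i * n)" if "i \<le> N" for i using q2 m3 that by (simp add: same_def)
  have p3: "s3 ''p1'' 0 = 0" using m1 m2 m3 zero by (simp add: same_def writes_preprocessing)
  obtain s4 where e4: "ends (N * (7 * n + 13) + 3) Bag_size s3 (return_pmf s4)"
    and q4: "s4 ''p1'' 0 = int (p + 1)" and m4: "same (writes Bag_size) s3 s4"
    by (rule wp_obtain[OF wp_Bag_size[OF i3 r3 p3]])
  have i4: "inputs s4" by (rule inputs_same[OF m4 _ i3]) (simp add: writes_preprocessing input_names_def)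
  have r4: "s4 ''row'' (int i) = int (i * n)" if "i \<le> N" for i using r3 m4 that by (simp add: same_def writes_preprocessing)
  obtain s5 where e5: "ends (N * (6 * n + 7) + 3) Tops s4 (return_pmf s5)"
    and q5: "\<forall>v<n. s5 ''top'' (int v) = int (top v)" and m5: "same (writes Tops) s4 s5"
    by (rule wp_obtain[OF wp_Tops[OF i4 r4]])
  have i5: "inputs s5" by (rule inputs_same[OF m5 _ i4]) (simp add: writes_preprocessing input_names_def)
  obtain s6 where e6: "ends (n * (5 * N + 9) + 5) Keys s5 (return_pmf s6)"
    and q6: "(\<forall>v<n. s6 ''key'' (int v) = int (key v)) \<and> s6 ''key'' (int n) = -1" and m6: "same (writes Keys) s5 s6"
  proof -
    have "wp (n * (5 * N + 9) + 5) Keys (\<lambda>s'. (\<forall>v<n. s' ''key'' (int v) = int (key v)) \<and> s' ''key'' (int n) = -1) s5"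
      by (rule wp_Keys[OF i5]) (use q5 in simp)
    thus ?thesis using that by (rule wp_obtain)
  qed
  have i6: "inputs s6" by (rule inputs_same[OF m6 _ i5]) (simp add: writes_preprocessing input_names_def)
  obtain s7 where e7: "ends (6 * n + 3) Find_v0 s6 (return_pmf s7)"
    and q7: "\<exists>v0\<in>S. s7 ''v0'' 0 = int v0" and m7: "same (writes Find_v0) s6 s7"
    by (rule wp_obtain[OF wp_Find_v0[OF i6]])
  have i7: "inputs s7" by (rule inputs_same[OF m7 _ i6]) (simp add: writes_preprocessing input_names_def)
  have "ends prepare_time Prepare s (return_pmf s7)"
    unfolding prepare_time_def Prepare_def
    by (rule ends_seq[OF e1 ends_seq[OF e2 ends_seq[OF e3 ends_seq[OF e4 ends_seq[OF e5 ends_seq[OF e6 e7]]]]]])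
  moreover have "prepared f s7"
    unfolding prepared_def
  proof (intro conjI i7 q7)
    show "s7 ''R'' 0 = 2 ^ lg" using R m1 m2 m3 m4 m5 m6 m7 by (simp add: same_def writes_preprocessing)
    show "\<forall>v<n. s7 ''w'' (int v) = int (weight lg f v)" using q1 m2 m3 m4 m5 m6 m7 by (simp add: same_def writes_preprocessing)
    show "\<forall>i\<le>N. s7 ''row'' (int i) = int (i * n)" using r4 m5 m6 m7 by (simp add: same_def writes_preprocessing)
    show "\<forall>i\<le>n. s7 ''arow'' (int i) = int (i * n)" using q3 m4 m5 m6 m7 by (simp add: same_def writes_preprocessing)
    show "s7 ''p1'' 0 = int (p + 1)" using q4 m5 m6 m7 by (simp add: same_def writes_preprocessing)
    show "\<forall>v<n. s7 ''top'' (int v) = int (top v)" using q5 m6 m7 by (simp add: same_def writes_preprocessing)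
    show "\<forall>v<n. s7 ''key'' (int v) = int (key v)" "s7 ''key'' (int n) = -1" using q6 m7 by (simp_all add: same_def writes_preprocessing)
  qed
  ultimately show ?thesis unfolding wp_def by blast
qed

definition parameters_time :: nat where
  "parameters_time = 1 + ((n * 5 + 5) + (((n + 1) * 5 + 5) + ((b * 5 + 5) + (((p + 1) * 5 + 5) + ((n * 5 + 5) +
     ((n * (5 * b + 11) + 3) + ((5 * L + 5) + ((n * 5 + 3) + 1 + 1) + 1) + 1) + 1) + 1) + 1) + 1) + 1) + 1"

definition ready :: "nat \<Rightarrow> (nat \<Rightarrow> bool) \<Rightarrow> store \<Rightarrow> bool" where
  "ready v0 f s \<longleftrightarrow> inputs s \<and> machine.tables {..<N} r par G n X S v0 bD L (exponent f) s \<and> (\<forall>v<n. int (key v) < s ''lim'' 0) \<and>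
     s ''b'' 0 = int b \<and> s ''M'' 0 = int M"

lemma wp_Parameters:
  assumes P: "prepared f s" and fr: "fresh prepare_names s"
  shows "\<exists>v0\<in>S. wp parameters_time Parameters (ready v0 f) s"
proof -
  obtain v0 where v0: "v0 \<in> S" "s ''v0'' 0 = int v0" using P by (auto simp: prepared_def)
  have inp: "inputs s" using P by (simp add: prepared_def)
  have nn: "s ''n'' 0 = int n" "s ''N'' 0 = int N" using inp by (simp_all add: inputs_def)
  have RP: "s ''R'' 0 = 2 ^ lg" "s ''p1'' 0 = int (p + 1)" using P by (simp_all add: prepared_def)
  define s1 where "s1 = upd s ''b'' 0 (s ''n'' 0 + s ''n'' 0 + 1)"
  have e1: "ends 1 (''b'' ::= Add (Double (Var ''n'')) (Const 1)) s (return_pmf s1)"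
    using ends_simple[of "''b'' ::= Add (Double (Var ''n'')) (Const 1)" 1 s] nn by (simp add: s1_def b_def)
  have m1: "same {''b''} s s1" by (simp add: s1_def same_def)
  have "wp (n * 5 + 5) (Times ''M'' (Var ''R'') (Var ''n'')) (\<lambda>s'. s' ''M'' 0 = int (2 ^ lg) * int n) s1"
    by (rule wp_Times) (use m1 RP nn in \<open>auto simp: same_def\<close>)
  then obtain s2 where e2: "ends (n * 5 + 5) (Times ''M'' (Var ''R'') (Var ''n'')) s1 (return_pmf s2)"
    and "s2 ''M'' 0 = int (2 ^ lg) * int n" and m2: "same (writes (Times ''M'' (Var ''R'') (Var ''n''))) s1 s2"
    by (rule wp_obtain)
  hence q2: "s2 ''M'' 0 = int M" by (simp add: M_def mult.commute)
  have "wp ((n + 1) * 5 + 5) (Times ''D'' (Var ''M'') (Add (Var ''n'') (Const 1))) (\<lambda>s'. s' ''D'' 0 = int M * int (n + 1)) s2"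
    by (rule wp_Times) (use m1 m2 q2 nn in \<open>auto simp: same_def\<close>)
  then obtain s3 where e3: "ends ((n + 1) * 5 + 5) (Times ''D'' (Var ''M'') (Add (Var ''n'') (Const 1))) s2 (return_pmf s3)"
    and "s3 ''D'' 0 = int M * int (n + 1)" and m3: "same (writes (Times ''D'' (Var ''M'') (Add (Var ''n'') (Const 1)))) s2 s3"
    by (rule wp_obtain)
  hence q3: "s3 ''D'' 0 = int D" by (simp add: D_def algebra_simps)
  have b3: "s3 ''b'' 0 = int b" using m2 m3 nn by (simp add: same_def s1_def b_def)
  have "wp (b * 5 + 5) (Times ''bD'' (Var ''D'') (Var ''b'')) (\<lambda>s'. s' ''bD'' 0 = int D * int b) s3"
    by (rule wp_Times) (use q3 b3 in \<open>auto simp: same_def\<close>)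
  then obtain s4 where e4: "ends (b * 5 + 5) (Times ''bD'' (Var ''D'') (Var ''b'')) s3 (return_pmf s4)"
    and "s4 ''bD'' 0 = int D * int b" and m4: "same (writes (Times ''bD'' (Var ''D'') (Var ''b''))) s3 s4"
    by (rule wp_obtain)
  hence q4: "s4 ''bD'' 0 = int bD" by (simp add: bD_def mult.commute)
  have "wp ((p + 1) * 5 + 5) (Times ''t'' (Double (Var ''bD'')) (Var ''p1'')) (\<lambda>s'. s' ''t'' 0 = int (2 * bD) * int (p + 1)) s4"
  proof (rule wp_Times)
    fix s' assume sm: "same {''t'', ''it''} s4 s'"
    show "aval (Double (Var ''bD'')) s' = int (2 * bD)" using sm q4 by (simp add: same_def)
    have "s4 ''p1'' = s ''p1''" using m1 m2 m3 m4 by (simp add: same_def)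
    thus "aval (Var ''p1'') s' = int (p + 1)" using sm RP(2) by (simp add: same_def)
  qed simp
  then obtain s5 where e5: "ends ((p + 1) * 5 + 5) (Times ''t'' (Double (Var ''bD'')) (Var ''p1'')) s4 (return_pmf s5)"
    and q5: "s5 ''t'' 0 = int (2 * bD) * int (p + 1)" and m5: "same (writes (Times ''t'' (Double (Var ''bD'')) (Var ''p1''))) s4 s5"
    by (rule wp_obtain)
  have "wp (n * 5 + 5) (Times ''L'' (Add (Var ''t'') (Const 2)) (Var ''n'')) (\<lambda>s'. s' ''L'' 0 = int (2 * bD * (p + 1) + 2) * int n) s5"
  proof (rule wp_Times)
    fix s' assume sm: "same {''L'', ''it''} s5 s'"
    show "aval (Add (Var ''t'') (Const 2)) s' = int (2 * bD * (p + 1) + 2)"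
    proof -
      define T where "T = 2 * bD * (p + 1)"
      have "s5 ''t'' 0 = int T" using q5 by (simp only: T_def of_nat_mult)
      thus ?thesis using sm unfolding T_def[symmetric] by (simp add: same_def)
    qed
    have "s5 ''n'' = s ''n''" using m1 m2 m3 m4 m5 by (simp add: same_def)
    thus "aval (Var ''n'') s' = int n" using sm nn(1) by (simp add: same_def)
  qed simp
  then obtain s6 where e6: "ends (n * 5 + 5) (Times ''L'' (Add (Var ''t'') (Const 2)) (Var ''n'')) s5 (return_pmf s6)"
    and "s6 ''L'' 0 = int (2 * bD * (p + 1) + 2) * int n" and m6: "same (writes (Times ''L'' (Add (Var ''t'') (Const 2)) (Var ''n''))) s5 s6"
    by (rule wp_obtain)
  hence q6: "s6 ''L'' 0 = int L" by (simp add: L_def algebra_simps)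
  have f6: "s6 y = s y" if "y \<notin> {''b'', ''M'', ''D'', ''bD'', ''t'', ''L'', ''it''}" for y
    using m1 m2 m3 m4 m5 m6 that by (simp add: same_def)
  have v6: "s6 ''b'' 0 = int b" "s6 ''M'' 0 = int M" "s6 ''D'' 0 = int D" "s6 ''bD'' 0 = int bD"
    using b3 q2 q3 q4 m3 m4 m5 m6 by (simp_all add: same_def)
  have "wp (n * (5 * b + 11) + 3) Exponents (\<lambda>s'. \<forall>v<n. s' ''xe'' (int v) = int (b * (D + M + weight lg f v))) s6"
    by (rule wp_Exponents) (use f6 nn v6 P in \<open>auto simp: prepared_def\<close>)
  then obtain s7 where e7: "ends (n * (5 * b + 11) + 3) Exponents s6 (return_pmf s7)"
    and q7: "\<forall>v<n. s7 ''xe'' (int v) = int (exponent f v)" and m7: "same (writes Exponents) s6 s7"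
    unfolding exponent_def by (rule wp_obtain)
  have L7: "s7 ''L'' 0 = int L" using q6 m7 by (simp add: same_def writes_preprocessing)
  obtain s8 where e8: "ends (5 * L + 5) Powers s7 (return_pmf s8)" and q8: "powers L s8" and m8: "same (writes Powers) s7 s8"
    by (rule wp_obtain[OF wp_Powers[where s = s7 and L = L, OF L7]])
  have f8: "s8 y = s y" if "y \<notin> {''b'', ''M'', ''D'', ''bD'', ''t'', ''L'', ''it'', ''v'', ''xe'', ''pw'', ''i''}" for y
    using m7 m8 f6[of y] that by (simp add: same_def writes_preprocessing)
  have "n * 2 \<le> n * (2 * bD * (p + 1) + 2)" by (intro mult_le_mono2) simp
  hence "2 * n \<le> L" by (simp only: L_def mult.commute)
  hence "s8 ''pw'' (int (2 * n)) = 2 ^ (2 * n)" using q8 unfolding powers_def by blast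
  moreover have "int (2 * n) = int n + int n" by simp
  moreover have "(2::int) ^ (2 * n) = int (4 ^ n)" unfolding power_mult by simp
  ultimately have pw: "s8 ''pw'' (int n + int n) = int (4 ^ n)" by (simp only:)
  have off0: "s8 ''off'' = (\<lambda>_. 0)" using f8 fr by (simp add: fresh_def prepare_names_def random_names_def input_names_def)
  have "wp (n * 5 + 3) (Table ''off'' (Cell ''pw'' (Double (Var ''n''))) (Var ''n'')) (\<lambda>s'. \<forall>j\<le>n. s' ''off'' (int j) = int j * int (4 ^ n)) s8"
  proof (rule wp_Table)
    fix s' assume sm: "same {''off'', ''it''} s8 s'"
    have n': "s' ''n'' 0 = int n" "s' ''pw'' = s8 ''pw''" using sm f8[of "''n''"] nn by (simp_all add: same_def)
    show "aval (Cell ''pw'' (Double (Var ''n''))) s' = int (4 ^ n)" using n' pw by simp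
    show "aval (Var ''n'') s' = int n" using n' by simp
  qed (use off0 in simp_all)
  then obtain s9 where e9: "ends (n * 5 + 3) (Table ''off'' (Cell ''pw'' (Double (Var ''n''))) (Var ''n'')) s8 (return_pmf s9)"
    and q9: "\<forall>j\<le>n. s9 ''off'' (int j) = int j * int (4 ^ n)"
    and m9: "same (writes (Table ''off'' (Cell ''pw'' (Double (Var ''n''))) (Var ''n''))) s8 s9"
    by (rule wp_obtain)
  define s10 where "s10 = upd s9 ''lim'' 0 (int (N * n))"
  have f9: "s9 y = s y" if "y \<notin> {''b'', ''M'', ''D'', ''bD'', ''t'', ''L'', ''it'', ''v'', ''xe'', ''pw'', ''i'', ''off''}" for y
    using m9 f8[of y] that by (simp add: same_def)
  have "s9 ''row'' (s9 ''N'' 0) = int (N * n)" using P nn by (simp add: f9 prepared_def)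
  hence e10: "ends 1 (''lim'' ::= Cell ''row'' (Var ''N'')) s9 (return_pmf s10)"
    using ends_simple[of "''lim'' ::= Cell ''row'' (Var ''N'')" 1 s9] by (simp add: s10_def)
  have ends: "ends parameters_time Parameters s (return_pmf s10)"
    unfolding parameters_time_def Parameters_def
    by (rule ends_seq[OF e1 ends_seq[OF e2 ends_seq[OF e3 ends_seq[OF e4 ends_seq[OF e5 ends_seq[OF e6 ends_seq[OF e7 ends_seq[OF e8 ends_seq[OF e9 e10]]]]]]]]])
  have f: "s10 y = s y" if "y \<notin> {''b'', ''M'', ''D'', ''bD'', ''t'', ''L'', ''it'', ''v'', ''xe'', ''pw'', ''i'', ''off'', ''lim''}" for y
    using f9[of y] that by (simp add: s10_def)
  interpret mach: machine "{..<N}" r par G n X S v0 "2 ^ bD" "\<lambda>v. 2 ^ exponent f v" bD L "p + 1" "exponent f"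
    by (rule machine_instance)
  have inp10: "inputs s10" using inp unfolding inputs_def by (simp add: f)
  have "mach.tables s10"
    unfolding mach.tables_def
  proof (intro conjI)
    show "powers L s10" using q8 m9 by (simp add: powers_def s10_def same_def)
    show "s10 ''n'' 0 = int n" "s10 ''v0'' 0 = int v0" using nn v0 by (simp_all add: f)
    show "s10 ''bD'' 0 = int bD" using v6 m7 m8 m9 by (simp add: same_def writes_preprocessing s10_def)
    have "s10 ''xe'' = s7 ''xe''" using m8 m9 by (simp add: same_def writes_preprocessing s10_def)
    thus "\<forall>c<n. s10 ''xe'' (int c) = int (exponent f c) \<and> s10 ''S'' (int c) = of_bool (c \<in> S) \<and> s10 ''key'' (int c) = int (key c)"
      using q7 inp P by (simp add: f inputs_def prepared_def)
    show "\<forall>c<n. \<forall>u<n. s10 ''adj'' (s10 ''arow'' (int c) + int u) = of_bool (adj c u)"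
      using inp P by (simp add: f inputs_def prepared_def)
    show "\<forall>u\<le>n. s10 ''off'' (int u) = int (u * 4 ^ n)" using q9 by (simp add: s10_def)
    show "s10 ''key'' (int n) = -1" using P by (simp add: f prepared_def)
    show "\<forall>c<n. \<forall>u<n. s10 ''bag'' (s10 ''row'' (s10 ''top'' (int c)) + int u) = of_bool (u \<in> X (top c))"
    proof (intro allI impI)
      fix c u assume c: "c < n" and u: "u < n"
      have t: "top c < N" using top_in[OF c] by simp
      hence "s ''row'' (int (top c)) = int (top c * n)" using P by (simp add: prepared_def)
      moreover have "s ''top'' (int c) = int (top c)" using P c by (simp add: prepared_def)
      moreover have "s ''bag'' (int (top c * n) + int u) = of_bool (u \<in> X (top c))" using inp t u by (simp add: inputs_def)
      ultimately show "s10 ''bag'' (s10 ''row'' (s10 ''top'' (int c)) + int u) = of_bool (u \<in> X (top c))" by (simp add: f)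
    qed
  qed
  moreover have "int (key v) < s10 ''lim'' 0" if "v < n" for v
    using key_bound[OF that] by (simp add: s10_def flip: of_nat_mult)
  moreover have "s10 ''b'' 0 = int b" "s10 ''M'' 0 = int M"
    using v6 m7 m8 m9 by (simp_all add: same_def writes_preprocessing s10_def)
  ultimately have "ready v0 f s10" using inp10 by (simp add: ready_def)
  with ends v0 show ?thesis unfolding wp_def by blast
qed


definition elim_time :: nat where
  "elim_time = 4 ^ (p + 1) * (78 * n + 65 * L + 304) + n * (15 * 4 ^ (p + 1) + 33) + 35"

text \<open>A solution of size \<open>j\<close> has total weight between \<open>M * j\<close> and \<open>M * j + M - 1\<close>, so the sizes at most
  \<open>k\<close> are those below \<open>limit\<close>. The set counts the possible sizes and is empty if \<open>k < 0\<close>.\<close>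

definition limit :: nat where
  "limit = M * card {j. j \<le> n \<and> int j \<le> k}"

definition answer_time :: nat where
  "answer_time = (n * (elim_time + 4) + 3) + ((11 * L + 20) + ((n * 5 + 5) + ((6 * n + 11) + (8 * limit + 3) + 1) + 1) + 1) + 1"

text \<open>Acceptance as a property of the coins, expressed by solutions instead of digits and
  independent of \<open>v0\<close>.\<close>

definition accepts :: "(nat \<Rightarrow> bool) \<Rightarrow> bool" where
  "accepts f \<longleftrightarrow> (\<exists>w<limit. odd (card {F \<in> solutions adj {..<n} S. M * card F + (\<Sum>v\<in>F. weight lg f v) = w}))"

lemma wp_Answer:
  assumes R: "ready v0 f s" and v0: "v0 \<in> S"
    and zero: "s ''acc'' = (\<lambda>_. 0)" "s ''bit'' = (\<lambda>_. 0)" "s ''out'' = (\<lambda>_. 0)"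
  shows "wp answer_time Answer (\<lambda>s'. s' ''out'' 0 = of_bool (accepts f)) s"
proof -
  interpret mach: machine "{..<N}" r par G n X S v0 "2 ^ bD" "\<lambda>v. 2 ^ exponent f v" bD L "p + 1" "exponent f"
    by (rule machine_instance)
  have T: "mach.tables s" and inp: "inputs s" and lim: "\<And>v. v < n \<Longrightarrow> int (key v) < s ''lim'' 0"
    and bM: "s ''b'' 0 = int b" "s ''M'' 0 = int M" using R by (auto simp: ready_def)
  have nn: "s ''n'' 0 = int n" "s ''k'' 0 = k" using inp by (simp_all add: inputs_def)
  define Z where "Z = (\<Sum>\<sigma>\<in>conf {..<n}. \<Prod>c<n. mach.lc c \<sigma>)"
  obtain s1 where e1: "ends (n * (mach.eliminate_time + 4) + 3) Main_loop s (return_pmf s1)"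
    and q1: "s1 ''acc'' (int (n * 4 ^ n)) + 1 = Z \<and> 0 \<le> s1 ''acc'' (int (n * 4 ^ n)) + 1 \<and> s1 ''acc'' (int (n * 4 ^ n)) + 1 \<le> 2 ^ L"
    and m1: "same (writes Main_loop) s s1"
    unfolding Z_def by (rule wp_obtain[OF mach.wp_Main_loop[OF T lim zero(1)]])
  have et: "mach.eliminate_time = elim_time"
    unfolding mach.eliminate_time_def mach.mul_time_def elim_time_def by (rule refl)
  have wm: "writes Main_loop = {''x'', ''z'', ''y'', ''i'', ''vv'', ''sig'', ''val'', ''st'', ''zf'', ''e'', ''u'', ''loc'',
     ''ma'', ''mb'', ''mr'', ''mi'', ''mh'', ''acc'', ''j'', ''best'', ''v'', ''c'', ''lim'', ''pr'', ''kf'', ''cfg'', ''len'', ''round''}"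
    by (auto simp: Main_loop_def writes_Eliminate writes_elimination)
  have T1: "mach.tables s1" by (rule mach.tables_same[OF m1 _ T]) (simp add: wm mach.table_names_def)
  have f1: "s1 ''n'' 0 = int n" "s1 ''k'' 0 = k" "s1 ''b'' 0 = int b" "s1 ''M'' 0 = int M" "s1 ''bit'' = (\<lambda>_. 0)"
    "s1 ''out'' = (\<lambda>_. 0)" using m1 nn bM zero by (simp_all add: same_def wm)
  have p1: "powers L s1" and bD1: "s1 ''bD'' 0 = int bD" and off1: "s1 ''off'' (s1 ''n'' 0) = int (n * 4 ^ n)"
    using T1 f1(1) by (simp_all add: mach.tables_def)
  have Z1: "s1 ''acc'' (s1 ''off'' (s1 ''n'' 0)) + 1 = Z" "0 \<le> Z" "Z \<le> 2 ^ L" using q1 off1 by simp_all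
  obtain s2 where e2: "ends (11 * L + 20) Read_bits s1 (return_pmf s2)"
    and q2: "\<forall>h. s2 ''bit'' (int h) = of_bool (odd (Z div 2 ^ h))" and m2: "same (writes Read_bits) s1 s2"
    by (rule wp_obtain[OF wp_Read_bits[OF p1 Z1 f1(5)]])
  have "wp (n * 5 + 5) (Times ''q'' (Var ''bD'') (Var ''n'')) (\<lambda>s'. s' ''q'' 0 = int bD * int n) s2"
    by (rule wp_Times) (use m2 f1 bD1 in \<open>simp_all add: same_def writes_answer\<close>)
  then obtain s3 where e3: "ends (n * 5 + 5) (Times ''q'' (Var ''bD'') (Var ''n'')) s2 (return_pmf s3)"
    and q3: "s3 ''q'' 0 = int bD * int n" and m3: "same (writes (Times ''q'' (Var ''bD'') (Var ''n''))) s2 s3"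
    by (rule wp_obtain)
  have f3: "s3 ''n'' 0 = int n" "s3 ''k'' 0 = k" "s3 ''M'' 0 = int M"
    using m2 m3 f1 by (simp_all add: same_def writes_answer)
  obtain s4 where e4: "ends (6 * n + 11) Limit s3 (return_pmf s4)"
    and q4: "s4 ''lim'' 0 = int limit" and m4: "same (writes Limit) s3 s4"
    unfolding limit_def by (rule wp_obtain[OF wp_Limit[where s = s3 and n = n and k = k and M = M, OF f3]])
  have f4: "s4 ''b'' 0 = int b" "s4 ''q'' 0 = int (bD * n)" "s4 ''out'' 0 = 0"
    "\<And>h. s4 ''bit'' (int h) = of_bool (odd (Z div 2 ^ h))"
    using m2 m3 m4 f1 q2 q3 by (simp_all add: same_def writes_answer)
  have wS: "wp (8 * limit + 3) Search (\<lambda>s'. s' ''out'' 0 = of_bool (\<exists>w<limit. odd (Z div 2 ^ (bD * n + b * w)))) s4"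
    by (rule wp_Search[where P = "\<lambda>h. odd (Z div 2 ^ h)", OF q4 f4])
  obtain s5 where e5: "ends (8 * limit + 3) Search s4 (return_pmf s5)"
    and q5: "s5 ''out'' 0 = of_bool (\<exists>w<limit. odd (Z div 2 ^ (bD * n + b * w)))" by (rule wp_obtain[OF wS])
  have e: "ends answer_time Answer s (return_pmf s5)"
    unfolding answer_time_def Answer_def et[symmetric]
    by (rule ends_seq[OF e1 ends_seq[OF e2 ends_seq[OF e3 ends_seq[OF e4 e5]]]])
  have "(\<exists>w<limit. odd (Z div 2 ^ (bD * n + b * w))) \<longleftrightarrow> accepts f"
  proof -
    have Zs: "Z = (\<Sum>F | S \<subseteq> F \<and> F \<subseteq> {..<n}. int (card (cuts adj v0 F)) *
        ((\<Prod>v\<in>F. 2 ^ (b * (D + M + weight lg f v))) * (2 ^ (b * D)) ^ excess adj {..<n} F))"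
      unfolding Z_def using partition_function[OF v0 S(1)] by (simp add: exponent_def bD_def)
    have card_le: "card {j. j \<le> n \<and> int j \<le> k} \<le> n + 1"
      using card_mono[of "{..n}" "{j. j \<le> n \<and> int j \<le> k}"] by auto
    have "odd (Z div 2 ^ (bD * n + b * w)) \<longleftrightarrow>
        odd (card {F \<in> solutions adj {..<n} S. M * card F + (\<Sum>v\<in>F. weight lg f v) = w})" if w: "w < limit" for w
    proof -
      \<comment> \<open>The searched offsets stay below \<open>D\<close>, that is, within the low
        digit of the exponent in base \<open>D\<close>.\<close>
      have "limit \<le> D" unfolding limit_def D_def using card_le by (intro mult_le_mono2)
      hence "w < D" using w by simp
      from solution_digit[OF _ v0 S(1) adj_sym _ _ weight_sum_less this Zs]
      have "odd (Z div 2 ^ (b * (D * card {..<n} + w))) \<longleftrightarrow>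
        odd (card {F \<in> solutions adj {..<n} S. M * card F + (\<Sum>v\<in>F. weight lg f v) = w})"
        by (simp add: b_def D_def)
      moreover have "b * (D * card {..<n} + w) = bD * n + b * w" by (simp add: bD_def algebra_simps)
      ultimately show ?thesis by simp
    qed
    thus ?thesis unfolding accepts_def by blast
  qed
  thus ?thesis using e q5 unfolding wp_def by auto
qed

text \<open>An odd count is positive, so acceptance exhibits a solution; this excludes false
  positives for every outcome of the coins. The bound on its size follows from
  \<open>M * card F \<le> w < limit\<close>.\<close>

lemma accepts_sound: "accepts f \<Longrightarrow> \<exists>F\<in>solutions adj {..<n} S. int (card F) \<le> k"
proof -
  assume "accepts f"
  then obtain w where w: "w < limit" "odd (card {F \<in> solutions adj {..<n} S. M * card F + (\<Sum>v\<in>F. weight lg f v) = w})"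
    by (auto simp: accepts_def)
  hence "{F \<in> solutions adj {..<n} S. M * card F + (\<Sum>v\<in>F. weight lg f v) = w} \<noteq> {}" by (metis card.empty even_zero)
  then obtain F where F: "F \<in> solutions adj {..<n} S" "M * card F + (\<Sum>v\<in>F. weight lg f v) = w" by blast
  have "M * card F < M * card {j. j \<le> n \<and> int j \<le> k}" using F(2) w(1) unfolding limit_def by linarith
  hence lt: "card F < card {j. j \<le> n \<and> int j \<le> k}" by simp
  have "int (card F) \<le> k"
  proof (rule ccontr)
    assume "\<not> int (card F) \<le> k"
    hence "{j. j \<le> n \<and> int j \<le> k} \<subseteq> {..<card F}" by auto
    hence "card {j. j \<le> n \<and> int j \<le> k} \<le> card {..<card F}" by (intro card_mono) auto
    thus False using lt by simp
  qed
  thus ?thesis using F(1) by blast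
qed

text \<open>Weights of sets stay below \<open>M\<close>, so \<open>M * card F\<close> separates the
  sizes, and the class of the isolated set contains no solution of another size. The set is
  therefore alone in its class, and 1 is odd.\<close>

lemma accepts_complete:
  assumes sol: "\<exists>F\<in>solutions adj {..<n} S. int (card F) \<le> k"
  defines "j \<equiv> LEAST j. \<exists>F\<in>solutions adj {..<n} S. card F = j"
  assumes iso: "isolates (weight lg f) {F \<in> solutions adj {..<n} S. card F = j}"
  shows "accepts f"
proof -
  let ?wt = "\<lambda>F. \<Sum>v\<in>F. weight lg f v"
  obtain F where F: "F \<in> solutions adj {..<n} S" "card F = j"
    "\<And>F'. F' \<in> solutions adj {..<n} S \<Longrightarrow> card F' = j \<Longrightarrow> F' \<noteq> F \<Longrightarrow> ?wt F < ?wt F'"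
    using iso unfolding isolates_def by blast
  have sub: "F' \<subseteq> {..<n}" if "F' \<in> solutions adj {..<n} S" for F' using that by (simp add: solutions_def)
  obtain F0 where F0: "F0 \<in> solutions adj {..<n} S" "int (card F0) \<le> k" using sol by blast
  have "j \<le> card F0" unfolding j_def using F0(1) by (intro Least_le) blast
  hence jk: "int j \<le> k" using F0(2) by linarith
  have jn: "j \<le> n" using card_mono[OF _ sub[OF F(1)]] F(2) by simp
  define w where "w = M * j + ?wt F"
  have "{F' \<in> solutions adj {..<n} S. M * card F' + ?wt F' = w} = {F}"
  proof (intro set_eqI iffI)
    fix F' assume "F' \<in> {F' \<in> solutions adj {..<n} S. M * card F' + ?wt F' = w}"
    hence F': "F' \<in> solutions adj {..<n} S" "M * card F' + ?wt F' = w" by auto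
    have l: "?wt F' < M" "?wt F < M" using weight_sum_less sub F' F by blast+
    have "card F' = (M * card F' + ?wt F') div M" using l by simp
    also have "\<dots> = (M * j + ?wt F) div M" using F'(2) by (simp only: w_def)
    also have "\<dots> = j" using l by simp
    finally have c: "card F' = j" .
    hence "?wt F' = ?wt F" using F'(2) by (simp add: w_def)
    thus "F' \<in> {F}" using F(3)[OF F'(1) c] by auto
  qed (use F in \<open>auto simp: w_def\<close>)
  hence "odd (card {F' \<in> solutions adj {..<n} S. M * card F' + ?wt F' = w})" by simp
  moreover have "w < limit"
  proof -
    have "{..j} \<subseteq> {j. j \<le> n \<and> int j \<le> k}" using jn jk by auto
    hence "card {..j} \<le> card {j. j \<le> n \<and> int j \<le> k}" by (intro card_mono) auto
    hence "M * Suc j \<le> limit" unfolding limit_def by (intro mult_le_mono2) simp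
    moreover have "?wt F < M" using weight_sum_less sub F by blast
    ultimately show ?thesis by (simp add: w_def)
  qed
  ultimately show ?thesis unfolding accepts_def by blast
qed

text \<open>Rejection implies that the weights fail to isolate a solution among those of minimum
  size.\<close>

lemma prob_accepts:
  assumes "\<exists>F\<in>solutions adj {..<n} S. int (card F) \<le> k"
  shows "measure_pmf.prob (random_bits (n * lg)) {f. \<not> accepts f} \<le> 1 / 2"
proof -
  define j where "j = (LEAST j. \<exists>F\<in>solutions adj {..<n} S. card F = j)"
  define \<F> where "\<F> = {F \<in> solutions adj {..<n} S. card F = j}"
  have "\<exists>j. \<exists>F\<in>solutions adj {..<n} S. card F = j" using assms by blast
  hence "\<exists>F\<in>solutions adj {..<n} S. card F = j" unfolding j_def by (rule LeastI_ex)
  hence ne: "\<F> \<noteq> {}" by (auto simp: \<F>_def)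
  have sub: "\<F> \<subseteq> Pow {..<n}" by (auto simp: \<F>_def solutions_def)
  have "{f. \<not> accepts f} \<subseteq> {f. \<not> isolates (weight lg f) \<F>}"
    using accepts_complete[OF assms] by (auto simp: \<F>_def j_def)
  hence "measure_pmf.prob (random_bits (n * lg)) {f. \<not> accepts f} \<le>
      measure_pmf.prob (random_bits (n * lg)) {f. \<not> isolates (weight lg f) \<F>}"
    by (intro measure_pmf.finite_measure_mono) auto
  also have "\<dots> \<le> 1 / 2" by (rule isolation[OF sub ne lg(1)])
  finally show ?thesis .
qed

lemma input_store_inputs:
  assumes "s0 = input_store n G S k N r par X"
  shows "inputs s0" "fresh input_names s0"
proof -
  have idx: "(u * m + v) div m = u" "(u * m + v) mod m = v" "u * m + v < l * m" if "u < l" "v < m" for u v l m :: nat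
  proof -
    show "(u * m + v) div m = u" "(u * m + v) mod m = v" using that by simp_all
    have "Suc u * m \<le> l * m" using that by (intro mult_le_mono1) simp
    thus "u * m + v < l * m" using that by simp
  qed
  have vec_nat: "vec m f (int i) = (if i < m then f i else 0)" for m f i by (simp add: vec_def)
  have vec2: "vec (l * m) f (int (u * m) + int v) = f (u * m + v)" if "u < l" "v < m" for f u v l m
    using vec_nat[of "l * m" f "u * m + v"] idx(3)[OF that] by simp
  have vec0: "vec 1 f 0 = f 0" for f by (simp add: vec_def)
  show "inputs s0"
    unfolding inputs_def
  proof (intro conjI allI impI)
    show "s0 ''n'' 0 = int n" "s0 ''k'' 0 = k" "s0 ''N'' 0 = int N" "s0 ''root'' 0 = int r"
      unfolding assms input_store_def by (simp_all add: vec_def)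
    fix u v assume "u < n" "v < n"
    thus "s0 ''adj'' (int (u * n) + int v) = of_bool (adj u v)"
      unfolding assms input_store_def using vec2[of u n v n] idx(1,2)[of u n v n] by (simp add: adj_def del: of_nat_mult)
  next
    fix v assume "v < n"
    thus "s0 ''S'' (int v) = of_bool (v \<in> S)" unfolding assms input_store_def by (simp add: vec_nat)
  next
    fix i assume "i < N"
    thus "s0 ''parent'' (int i) = int (par i)" unfolding assms input_store_def by (simp add: vec_nat)
  next
    fix i v assume "i < N" "v < n"
    thus "s0 ''bag'' (int (i * n) + int v) = of_bool (v \<in> X i)"
      unfolding assms input_store_def using vec2[of i N v n] idx(1,2)[of i N v n] by (simp del: of_nat_mult)
  qed
  show "fresh input_names s0"
    unfolding assms input_store_def fresh_def input_names_def by simp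
qed

section \<open>The whole program and its running time\<close>

definition total_time :: nat where
  "total_time = bits_time + (flips_time + (prepare_time + (parameters_time + answer_time + 1) + 1) + 1) + 1"

lemma ends_Program:
  assumes s0: "s0 = input_store n G S k N r par X"
  shows "\<exists>fin. ends total_time Program s0 (map_pmf fin (random_bits (n * lg))) \<and>
    (\<forall>f\<in>set_pmf (random_bits (n * lg)). fin f ''out'' 0 = of_bool (accepts f))"
proof -
  note inp0 = input_store_inputs[OF s0]
  have z: "s0 ''n'' 0 = int n" "s0 ''lg'' 0 = 0" using inp0 by (simp_all add: inputs_def fresh_def input_names_def)
  obtain s1 where e1: "ends (15 * n + 10) Bits_size s0 (return_pmf s1)"
    and q1: "s1 ''lg'' 0 = int (log2_ceil n) \<and> s1 ''R'' 0 = 2 ^ log2_ceil n \<and> s1 ''nr'' 0 = int (n * log2_ceil n)"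
    and m1: "same (writes Bits_size) s0 s1"
    by (rule wp_obtain[OF wp_Bits_size[where s = s0 and n = n, OF z(1) n_pos z(2)]])
  have inp1: "inputs s1" by (rule inputs_same[OF m1 _ inp0(1)]) (simp add: writes_preprocessing input_names_def)
  obtain st where st: "ends (7 * (n * lg) + 3) Flips s1 (map_pmf st (random_bits (n * lg)))"
    "\<And>f j. j < n * lg \<Longrightarrow> st f ''rnd'' (int j) = of_bool (f j)"
    using ends_Flips[of s1 "n * lg"] q1 by (auto simp: lg_def)
  have rest: "wp (prepare_time + (parameters_time + answer_time + 1) + 1) (Prepare ;; Parameters ;; Answer)
      (\<lambda>s'. s' ''out'' 0 = of_bool (accepts f)) (st f)" if f: "f \<in> set_pmf (random_bits (n * lg))" for f
  proof -
    have m2: "same (writes Flips) s1 (st f)"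
      using ends_writes[OF st(1), of "st f"] f by (auto simp: same_def)
    have inp2: "inputs (st f)" by (rule inputs_same[OF m2 _ inp1]) (simp add: writes_Flips input_names_def)
    have "fresh (input_names \<union> writes Bits_size) s1" by (rule fresh_same[OF inp0(2) m1]) simp
    hence fr2: "fresh random_names (st f)"
      by (rule fresh_same[OF _ m2]) (auto simp: writes_preprocessing writes_Flips random_names_def)
    have r2: "st f ''lg'' 0 = int lg" "st f ''R'' 0 = 2 ^ lg"
      using q1 m2 by (simp_all add: same_def writes_Flips lg_def)
    have wpP: "wp prepare_time Prepare (prepared f) (st f)"
      using inp2 r2 st(2) fr2 by (rule wp_Prepare)
    show ?thesis
    proof (rule wp_seq[OF wpP])
      fix s3 assume P: "prepared f s3" and m3: "same (writes Prepare) (st f) s3"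
      have wP: "writes Prepare = {''q'', ''v'', ''i'', ''w'', ''row'', ''it'', ''arow'', ''u'', ''cnt'', ''p1'', ''top'', ''key'', ''v0''}"
        unfolding Prepare_def by (auto simp: writes_preprocessing)
      have fr3: "fresh prepare_names s3"
        by (rule fresh_same[OF fr2 m3]) (auto simp: wP prepare_names_def random_names_def)
      obtain v0 where v0: "v0 \<in> S" "wp parameters_time Parameters (ready v0 f) s3" using wp_Parameters[OF P fr3] by blast
      show "wp (parameters_time + answer_time + 1) (Parameters ;; Answer) (\<lambda>s'. s' ''out'' 0 = of_bool (accepts f)) s3"
      proof (rule wp_seq[OF v0(2)])
        fix s4 assume R: "ready v0 f s4" and m4: "same (writes Parameters) s3 s4"
        have wP: "writes Parameters = {''b'', ''M'', ''it'', ''D'', ''bD'', ''t'', ''L'', ''v'', ''xe'', ''pw'', ''i'', ''off'', ''lim''}"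
          unfolding Parameters_def by (auto simp: writes_preprocessing)
        have "fresh (prepare_names \<union> writes Parameters) s4" by (rule fresh_same[OF fr3 m4]) simp
        hence "s4 ''acc'' = (\<lambda>_. 0)" "s4 ''bit'' = (\<lambda>_. 0)" "s4 ''out'' = (\<lambda>_. 0)"
          by (simp_all add: fresh_def wP prepare_names_def random_names_def input_names_def)
        thus "wp answer_time Answer (\<lambda>s'. s' ''out'' 0 = of_bool (accepts f)) s4"
          by (rule wp_Answer[OF R v0(1)])
      qed simp
    qed simp
  qed
  obtain fin where fin: "ends (7 * (n * lg) + 3 + (prepare_time + (parameters_time + answer_time + 1) + 1) + 1)
      (Flips ;; Prepare ;; Parameters ;; Answer) s1 (map_pmf fin (random_bits (n * lg)))"
    "\<forall>f\<in>set_pmf (random_bits (n * lg)). fin f ''out'' 0 = of_bool (accepts f)"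
    using ends_Then_wp[OF st(1) rest] by blast
  have "ends total_time Program s0 (bind_pmf (return_pmf s1) (\<lambda>_. map_pmf fin (random_bits (n * lg))))"
    unfolding total_time_def Program_def bits_time_def flips_time_def
    by (rule ends_Then[OF e1]) (use fin in simp)
  thus ?thesis using fin(2) by (auto simp: bind_return_pmf)
qed

text \<open>The constants multiply up: \<open>2^lg \<le> 4 * n\<close> gives 4,
  \<open>n + 1 \<le> 2 * n\<close> gives 8, \<open>b \<le> 3 * n\<close> makes 24 for
  \<open>bD\<close>, and \<open>p + 1 \<le> 2 * max 1 p\<close> together with the factor 2 makes 96;
  the additive 2 raises it to 98.\<close>

lemma parameter_bounds:
  "M \<le> 4 * n ^ 2" "D \<le> 8 * n ^ 3" "b \<le> 3 * n" "L \<le> 98 * (n ^ 5 * max 1 p)" "limit \<le> 8 * n ^ 3"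
proof -
  have n1: "n + 1 \<le> 2 * n" using n_pos by simp
  have pow: "n ^ 4 = n * n ^ 3" "n ^ 5 = n * n ^ 4" using power_Suc[of n 3] power_Suc[of n 4] by simp_all
  have "M \<le> n * (4 * n)" unfolding M_def using lg(3) by (intro mult_le_mono2)
  thus M: "M \<le> 4 * n ^ 2" by (simp add: power2_eq_square)
  have "D \<le> 4 * n ^ 2 * (2 * n)" unfolding D_def by (rule mult_le_mono[OF M n1])
  thus D: "D \<le> 8 * n ^ 3" by (simp add: power3_eq_cube power2_eq_square)
  show b: "b \<le> 3 * n" using n_pos by (simp add: b_def)
  have "bD \<le> 3 * n * (8 * n ^ 3)" unfolding bD_def by (rule mult_le_mono[OF b D])
  hence bD: "bD \<le> 24 * n ^ 4" by (simp add: pow(1) mult_ac)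
  have p1: "p + 1 \<le> 2 * max 1 p" by simp
  have "bD * (p + 1) \<le> 24 * n ^ 4 * (2 * max 1 p)" by (rule mult_le_mono[OF bD p1])
  hence "2 * bD * (p + 1) \<le> 96 * (n ^ 4 * max 1 p)" by simp
  moreover have "1 \<le> n ^ 4 * max 1 p" using n_pos by (simp add: Suc_le_eq)
  ultimately have "2 * bD * (p + 1) + 2 \<le> 98 * (n ^ 4 * max 1 p)" by linarith
  hence "L \<le> n * (98 * (n ^ 4 * max 1 p))" unfolding L_def by (intro mult_le_mono2)
  thus "L \<le> 98 * (n ^ 5 * max 1 p)" by (simp only: pow(2) mult_ac)
  have "card {j. j \<le> n \<and> int j \<le> k} \<le> n + 1" using card_mono[of "{..n}" "{j. j \<le> n \<and> int j \<le> k}"] by auto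
  hence "limit \<le> D" unfolding limit_def D_def by (rule mult_le_mono2)
  thus "limit \<le> 8 * n ^ 3" using D by simp
qed

text \<open>The dominating part is \<open>n * 4^(p + 1) * L\<close> for the table updates. Only the
  preprocessing depends on \<open>N\<close>, mainly through the scans of the bags and the walks to
  the root.\<close>

lemma total_time_le: "total_time \<le> 100000 * max (4 ^ p * max 1 p * n ^ 6) (N * n)"
proof -
  define m where "m = max 1 p"
  define W where "W = 4 ^ p * m * n ^ 6"
  define B where "B = max W (N * n)"
  have m: "1 \<le> m" by (simp add: m_def)
  have n1: "1 \<le> n" using n_pos by simp
  have low: "n ^ i * m \<le> W" if "i \<le> 6" for i
  proof -
    have "n ^ i \<le> n ^ 6" using that n1 by (intro power_increasing)
    hence "1 * (m * n ^ i) \<le> 4 ^ p * (m * n ^ 6)" by (intro mult_le_mono) auto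
    thus ?thesis by (simp add: W_def mult_ac)
  qed
  have low': "n ^ i \<le> W" if "i \<le> 6" for i
  proof -
    have "n ^ i * 1 \<le> n ^ i * m" using m by (rule mult_le_mono2)
    also have "\<dots> \<le> W" by (rule low[OF that])
    finally show ?thesis by (simp only: mult_1_right)
  qed
  have low4: "4 ^ p * n ^ i \<le> W" if "i \<le> 6" for i
  proof -
    have "n ^ i \<le> n ^ 6" using that n1 by (intro power_increasing)
    hence "4 ^ p * (1 * n ^ i) \<le> 4 ^ p * (m * n ^ 6)" using m by (intro mult_le_mono) auto
    thus ?thesis by (simp add: W_def mult_ac)
  qed
  have W: "1 \<le> W" "n \<le> W" "n * n \<le> W" "n ^ 3 \<le> W" "n ^ 5 * m \<le> W" "m \<le> W"
    using low'[of 0] low'[of 1] low'[of 2] low'[of 3] low[of 5] low[of 0] by (simp_all add: power2_eq_square)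
  have N: "N \<le> N * n" "1 \<le> N * n" using n1 N_pos by (simp_all add: Suc_le_eq)
  note pb = parameter_bounds[folded m_def]
  have bits: "bits_time \<le> 25 * W" using W unfolding bits_time_def by linarith
  have "n * lg \<le> n * (2 * n)" using lg(2) by (rule mult_le_mono2)
  also have "\<dots> = 2 * (n * n)" by (rule mult.left_commute)
  finally have nlg: "n * lg \<le> 2 * W" using W(3) by linarith
  have flips: "flips_time \<le> 17 * W" using nlg W unfolding flips_time_def by linarith
  \<comment> \<open>The multiples of \<open>N * n\<close> add up to 7 + 6 + 5 = 18, written as 23 -
    5.\<close>
  have "prepare_time = 7 * (n * lg) + 18 * n + 23 * (N * n) - 5 * (N * n) + 25 * N + 14 + 9 * n + 17"
    unfolding prepare_time_def by (simp add: algebra_simps)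
  hence prep: "prepare_time \<le> 100 * W + 100 * (N * n)" using nlg W N by linarith
  have "n * b \<le> n * (3 * n)" using pb(3) by (rule mult_le_mono2)
  also have "\<dots> = 3 * (n * n)" by (rule mult.left_commute)
  finally have nb: "n * b \<le> 3 * W" using W(3) by linarith
  have L: "L \<le> 98 * W" using pb(4) W(5) by linarith
  have p: "p \<le> m" by (simp add: m_def)
  have "parameters_time = 5 * (n * b) + 31 * n + 5 * L + 5 * b + 5 * p + 57"
    unfolding parameters_time_def by (simp add: algebra_simps)
  hence para: "parameters_time \<le> 2000 * W" using nb L W(1,2,6) p pb(3) by linarith
  have elim: "n * (elim_time + 4) \<le> 28000 * W"
  proof -
    have nL: "n * L \<le> 98 * (n ^ 6 * m)"
    proof -
      have "n * L \<le> n * (98 * (n ^ 5 * m))" using pb(4) by (rule mult_le_mono2)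
      moreover have "n ^ 6 = n * n ^ 5" using power_Suc[of n 5] by simp
      ultimately show ?thesis by (simp only: mult_ac)
    qed
    have "4 ^ p * (n * L) \<le> 4 ^ p * (98 * (n ^ 6 * m))" using nL by (rule mult_le_mono2)
    hence a: "4 ^ p * (n * L) \<le> 98 * W" by (simp add: W_def mult_ac)
    have c: "4 ^ p * (n * n) \<le> W" "4 ^ p * n \<le> W" using low4[of 2] low4[of 1] by (simp_all add: power2_eq_square)
    have "n * (elim_time + 4) = 4 * (78 * (4 ^ p * (n * n)) + 65 * (4 ^ p * (n * L)) + 304 * (4 ^ p * n)) +
        60 * (4 ^ p * (n * n)) + 33 * (n * n) + 39 * n"
      unfolding elim_time_def by (simp add: algebra_simps)
    \<comment> \<open>The products are generalised to variables, which leaves a linear estimate: 4 *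
      (78 + 65 * 98 + 304) + 132 = 27140.\<close>
    moreover have "T \<le> 28000 * W" if "T = 4 * (78 * a + 65 * b + 304 * c) + 60 * a + 33 * d + 39 * e"
        "b \<le> 98 * W" "a \<le> W" "c \<le> W" "d \<le> W" "e \<le> W" for T a b c d e :: nat
      using that by simp
    ultimately show ?thesis using a c W(2,3) by blast
  qed
  have answ: "answer_time \<le> 30000 * W"
    using elim L W pb(5) unfolding answer_time_def by linarith
  have "total_time \<le> 35000 * W + 100 * (N * n)"
    using bits flips prep para answ W unfolding total_time_def by linarith
  moreover have "W \<le> B" "N * n \<le> B" by (simp_all add: B_def)
  ultimately have "total_time \<le> 100000 * B" by linarith
  thus ?thesis by (simp add: B_def W_def m_def)
qed

theorem Program_correct:
  assumes "t = 100000 * max (4 ^ p * max 1 p * n ^ 6) (N * n)" "final = run t (Program, input_store n G S k N r par X)"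
  shows "\<forall>cfg\<in>set_pmf final. answers_yes cfg \<or> answers_no cfg"
    and "\<not> constrained_CVCP3 G S k \<Longrightarrow> \<forall>cfg\<in>set_pmf final. answers_no cfg"
    and "constrained_CVCP3 G S k \<Longrightarrow> measure_pmf.prob final {cfg. answers_no cfg} \<le> 1 / 2"
proof -
  let ?P = "random_bits (n * lg)"
  obtain fin where fin: "ends total_time Program (input_store n G S k N r par X) (map_pmf fin ?P)"
    "\<And>f. f \<in> set_pmf ?P \<Longrightarrow> fin f ''out'' 0 = of_bool (accepts f)"
    using ends_Program[OF refl] by blast
  have "ends t Program (input_store n G S k N r par X) (map_pmf fin ?P)"
    by (rule ends_mono[OF fin(1)]) (simp only: assms(1) total_time_le)
  hence final: "final = map_pmf (\<lambda>f. (Skip, fin f)) ?P"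
    by (simp add: ends_def assms(2) map_pmf_comp)
  have no: "answers_no (Skip, fin f) \<longleftrightarrow> \<not> accepts f" and yes: "answers_yes (Skip, fin f) \<longleftrightarrow> accepts f"
    if "f \<in> set_pmf ?P" for f
    using fin(2)[OF that] by (simp_all add: answers_no_def answers_yes_def halted_def)
  show "\<forall>cfg\<in>set_pmf final. answers_yes cfg \<or> answers_no cfg" using no yes by (auto simp: final)
  have iff: "constrained_CVCP3 G S k \<longleftrightarrow> (\<exists>F\<in>solutions adj {..<n} S. int (card F) \<le> k)"
    by (rule constrained_iff[OF S(2)])
  show "\<forall>cfg\<in>set_pmf final. answers_no cfg" if "\<not> constrained_CVCP3 G S k"
    using that no accepts_sound unfolding iff final by auto
  show "measure_pmf.prob final {cfg. answers_no cfg} \<le> 1 / 2" if "constrained_CVCP3 G S k"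
  proof -
    have "measure_pmf.prob final {cfg. answers_no cfg} = measure_pmf.prob ?P {f. answers_no (Skip, fin f)}"
      by (simp add: final vimage_def)
    \<comment> \<open>The final store is known only for bit vectors in the support, hence equality
      almost everywhere.\<close>
    also have "\<dots> = measure_pmf.prob ?P {f. \<not> accepts f}"
      by (intro measure_pmf.finite_measure_eq_AE) (auto simp: AE_measure_pmf_iff no)
    also have "\<dots> \<le> 1 / 2" using that prob_accepts unfolding iff by blast
    finally show ?thesis .
  qed
qed

end

text \<open>\<open>N * n\<close> is the size of the bag matrix, which belongs to the input and is
  not bounded in terms of \<open>n\<close>, as bags may repeat. \<open>max 1 p\<close> covers width
  0, where a factor \<open>p\<close> would make the bound vanish.\<close>

theorem theorem3:
  "\<exists>(prog :: com) (C :: nat). \<forall>n (G :: nat pair_pre_digraph) S (k :: int) N r par X p.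
     pair_graph G \<and> pverts G = {..<n} \<and> S \<subseteq> pverts G \<and> S \<noteq> {} \<and>
     tree_decomposition G {..<N} r par X \<and> width {..<N} X = p \<longrightarrow>
     (let t = C * max (4 ^ p * max 1 p * n ^ 6) (N * n);
          final = run t (prog, input_store n G S k N r par X)
      in (\<forall>cfg\<in>set_pmf final. answers_yes cfg \<or> answers_no cfg) \<and>
         (\<not> constrained_CVCP3 G S k \<longrightarrow> (\<forall>cfg\<in>set_pmf final. answers_no cfg)) \<and>
         (constrained_CVCP3 G S k \<longrightarrow> measure_pmf.prob final {cfg. answers_no cfg} \<le> 1 / 2))"
proof (intro exI[of _ Program] exI[of _ 100000] allI impI, unfold Let_def)
  fix n :: nat and G :: "nat pair_pre_digraph" and S :: "nat set" and k :: int and N r :: nat and par :: "nat \<Rightarrow> nat"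
    and X :: "nat \<Rightarrow> nat set" and p :: nat
  assume A: "pair_graph G \<and> pverts G = {..<n} \<and> S \<subseteq> pverts G \<and> S \<noteq> {} \<and>
     tree_decomposition G {..<N} r par X \<and> width {..<N} X = p"
  have "rooted_tree {..<N} r par" using A by (simp add: tree_decomposition_def)
  then interpret instance_data N r par G n X S k p
    using A by (intro instance_data.intro decomposed.intro rooted.intro decomposed_axioms.intro instance_data_axioms.intro) auto
  let ?final = "run (100000 * max (4 ^ p * max 1 p * n ^ 6) (N * n)) (Program, input_store n G S k N r par X)"
  show "(\<forall>cfg\<in>set_pmf ?final. answers_yes cfg \<or> answers_no cfg) \<and>
         (\<not> constrained_CVCP3 G S k \<longrightarrow> (\<forall>cfg\<in>set_pmf ?final. answers_no cfg)) \<and>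
         (constrained_CVCP3 G S k \<longrightarrow> measure_pmf.prob ?final {cfg. answers_no cfg} \<le> 1 / 2)"
    using Program_correct[OF refl refl] by blast
qed

end
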